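(* Let $N\ge3$ be an integer and $0<c<1$. Let $x_1^*\to+\infty$, $x_2^*\to+\infty$ so that $\rho=\sqrt{x_2^*/x_1^*}$ is fixed and $c<\rho<\frac1c$. Then $$\alpha(x_1^*,x_2^* )=\frac{(x_1^* )^{\frac N2-2}\left(\frac{\rho}{2c}\right)^{\frac N2-1}(1-c^2)^{\frac32}\,e^{-\frac{x_1^*}{2(1-c^2)}(\rho^2-2c\rho+1)}}{\sqrt\pi\,\Gamma(\frac{N-1}2)(\rho-c)(1-c\rho)}\cdot\left(1+O\left(\frac{\ln x_1^*}{x_1^*}\right)\right).$$
   Context: Definition of $\alpha$. Consider independent trials with $N$ outcomes, the $j$-th outcome having probability $p_j>0$ ($\sum_j p_j=1$). Let $\nu_j(n)$ be the number of occurrences of outcome $j$ in the first $n$ trials and $X(n)=\sum_{j=1}^N\frac{(\nu_j(n)-np_j)^2}{np_j}$ the Pearson statistic. For $c\in(0,1)$, $\alpha(x_1^*,x_2^* )$ denotes the limit of $P(X(n_1)>x_1^*,X(n_2)>x_2^* )$ as $n_1<n_2$ tend to infinity with $\sqrt{n_1/n_2}\to c$. The paper takes as its starting point the known formula $$\alpha(x_1^*,x_2^* )=\int_{x_1^*/2}^\infty\int_{x_2^*/2}^\infty p_{2,0}(u_1,u_2)\,du_2\,du_1,$$ $$p_{2,0}(u_1,u_2)=\frac{e^{-(\frac{u_1}\beta+\frac{u_2}\beta)}}{K_2^{1+\delta}c^\delta\Gamma(1+\delta)\beta^2}\left(\frac{u_1u_2}{\beta^2}\right)^{\frac\delta2}I_\delta\left(\frac{2c\sqrt{u_1u_2}}\beta\right),$$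 where $\beta=1-c^2$, $K_2=\frac1{1-c^2}$, $\delta=\frac{N-3}2$, and $I_\delta(x)=\sum_{k=0}^\infty\frac{(x/2)^{\delta+2k}}{\Gamma(k+1)\Gamma(k+\delta+1)}$ is the Infeld (modified Bessel) function. The parameters $N,c,\rho$ are fixed in the asymptotics. *)

theory Defs
  imports "HOL-Probability.Probability" "HOL-Library.Landau_Symbols"
begin

text \<open>
  Trials are numbered from 0, so the first \<open>n\<close> trials are those with index \<open>i < n\<close>; the outcomes
  are the numbers \<open>1, \<dots>, N\<close>.
\<close>

definition occurrences :: "(nat \<Rightarrow> 'a \<Rightarrow> nat) \<Rightarrow> nat \<Rightarrow> nat \<Rightarrow> 'a \<Rightarrow> nat" where
  "occurrences T j n \<omega> = card {i. i < n \<and> T i \<omega> = j}"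

definition pearson :: "nat \<Rightarrow> (nat \<Rightarrow> real) \<Rightarrow> (nat \<Rightarrow> 'a \<Rightarrow> nat) \<Rightarrow> nat \<Rightarrow> 'a \<Rightarrow> real" where
  "pearson N p T n \<omega> =
     (\<Sum>j=1..N. (real (occurrences T j n \<omega>) - real n * p j)\<^sup>2 / (real n * p j))"

text \<open>
  The predicate \<open>indep_vars\<close> includes measurability of each \<open>T i\<close> into \<open>count_space {1..N}\<close>, so
  every trial takes its values in \<open>{1..N}\<close>.
\<close>

definition independent_trials ::
    "'a measure \<Rightarrow> nat \<Rightarrow> (nat \<Rightarrow> real) \<Rightarrow> (nat \<Rightarrow> 'a \<Rightarrow> nat) \<Rightarrow> bool" where
  "independent_trials M N p T \<longleftrightarrow>
     prob_space M \<and>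
     prob_space.indep_vars M (\<lambda>_. count_space {1..N}) T UNIV \<and>
     (\<forall>i. \<forall>j\<in>{1..N}. measure M {\<omega> \<in> space M. T i \<omega> = j} = p j)"

definition ratio_filter :: "real \<Rightarrow> (nat \<times> nat) filter" where
  "ratio_filter c =
     inf (at_top \<times>\<^sub>F at_top)
       (inf (principal {(n1, n2). n1 < n2})
            (filtercomap (\<lambda>(n1, n2). sqrt (real n1 / real n2)) (nhds c)))"

text \<open>
  For \<open>0 < c < 1\<close> the filter \<open>ratio_filter c\<close> is not \<open>bot\<close>, so that the limit below, where it
  exists, is unique.
\<close>

definition alpha ::
    "'a measure \<Rightarrow> nat \<Rightarrow> (nat \<Rightarrow> real) \<Rightarrow> (nat \<Rightarrow> 'a \<Rightarrow> nat) \<Rightarrow> real \<Rightarrow> real \<Rightarrow> real \<Rightarrow> real" where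
  "alpha M N p T c x1 x2 =
     Lim (ratio_filter c)
       (\<lambda>(n1, n2). measure M {\<omega> \<in> space M. pearson N p T n1 \<omega> > x1 \<and> pearson N p T n2 \<omega> > x2})"

end

theory Submission
  imports Defs "HOL-Real_Asymp.Real_Asymp"
begin

text \<open>
  The Pearson statistic is a squared norm: with the orthonormal Helmert contrasts \<open>h\<^sub>1, \<dots>, h\<^sub>N\<^sub>-\<^sub>1\<close>
  of \<open>L\<^sup>2(p)\<close>, all orthogonal to the constants, \<open>X(n)\<close> is the sum over \<open>r\<close> of the squares of
  \<open>(\<Sum>i<n. h\<^sub>r(T\<^sub>i)) / sqrt n\<close> (\<open>pearson_eq_helmert_norm\<close>). So \<open>(X(n\<^sub>1), X(n\<^sub>2))\<close> ought to
  behave like \<open>(|G\<^sub>1|\<^sup>2, |G\<^sub>2|\<^sup>2)\<close> for standard Gaussian vectors in dimension \<open>N - 1\<close> whose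
  coordinates are correlated pairwise with coefficient \<open>c\<close>. The proof has two independent halves:
  the limit law, and the tail of that law.

  The limit law is found through Laplace transforms, so that no central limit theorem in several
  dimensions is needed. Writing \<open>exp (- k s\<^sup>2)\<close> as the mean of \<open>exp (\<i> sqrt (2 k) s Z)\<close> over a
  standard Gaussian \<open>Z\<close> turns \<open>E exp (- k X(n\<^sub>1) - l X(n\<^sub>2))\<close> into a Gaussian average of
  characteristic functions of sums of independent variables; these converge pointwise, and dominated
  convergence gives the limit \<open>((1 + 2 k) (1 + 2 l) - 4 k l c\<^sup>2) powr (- (N - 1) / 2)\<close>
  (\<open>pearson_laplace_limit\<close>). For natural numbers \<open>k, l\<close> the transform is a mixed moment of the pair
  \<open>(exp (- X(n\<^sub>1)), exp (- X(n\<^sub>2)))\<close>, which lives in the compact unit square, so the approximation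
  theorem of Weierstrass yields convergence of rectangle probabilities without any tightness argument
  (\<open>rectangle_limit_from_moments\<close>). The law with this transform is \<open>2 (1 - c\<^sup>2)\<close> times Kibble's
  bivariate gamma law of shape \<open>a = (N - 1) / 2\<close>: expanding the Bessel function in its density into
  its power series exhibits a negative binomial mixture of products of gamma densities
  (\<open>kibble_laplace\<close>). Hence \<open>alpha\<close> is a corner probability of Kibble's law
  (\<open>alpha_eq_kibble_tail\<close>).

  For the tail, put \<open>X = x\<^sub>1 / (2 (1 - c\<^sup>2))\<close>; the corner is \<open>(X, \<rho>\<^sup>2 X)\<close>. The Bessel function grows like
  an exponential times a power, with relative error \<open>O(1 / X)\<close> (\<open>bessel_ratio_asymptotics\<close>).
  Up to powers, the density is then \<open>exp (- x - y + 2 c sqrt (x y))\<close>, whose exponent has at the corner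
  the partial derivatives \<open>- (1 - c \<rho>)\<close> and \<open>- (1 - c / \<rho>)\<close>. Both are negative precisely because
  \<open>c < \<rho> < 1 / c\<close>, so the mass sits within a bounded distance of the corner, and there the
  exponent differs from its tangent by \<open>O(1 / X)\<close> only. Integrating the tangent exponential gives
  the factor \<open>1 / ((1 - c \<rho>) (1 - c / \<rho>))\<close> (\<open>kibble_corner_asymptotics\<close>). The relative error
  obtained is \<open>O(1 / x\<^sub>1)\<close>, which is stronger than \<open>O(ln x\<^sub>1 / x\<^sub>1)\<close>.
\<close>

section \<open>Helmert contrasts and the Pearson statistic\<close>

text \<open>
  The \<open>r\<close>-th contrast compares outcome \<open>r + 1\<close> with the outcomes \<open>1, \<dots>, r\<close> taken together; the two
  values are those that make it centred and of norm one in \<open>L\<^sup>2(p)\<close>.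
\<close>

definition helmert :: "(nat \<Rightarrow> real) \<Rightarrow> nat \<Rightarrow> nat \<Rightarrow> real" where
  "helmert p r j =
     (let s = (\<Sum>i=1..r. p i); t = (\<Sum>i=1..Suc r. p i)
      in if j \<le> r then sqrt (p (Suc r) / (s * t))
         else if j = Suc r then - sqrt (s / (p (Suc r) * t)) else 0)"

text \<open>
  All later computations with a contrast use only its two values \<open>u\<close> and \<open>- w\<close> and the relations
  between them, so the square roots of the definition are eliminated once and for all.
\<close>

lemma helmert_initial:
  assumes "r \<ge> 1" "\<And>j. j \<in> {1..Suc r} \<Longrightarrow> p j > 0"
  obtains s u w where "s = (\<Sum>i=1..r. p i)" "s > 0"
    "\<forall>j\<le>r. helmert p r j = u" "helmert p r (Suc r) = - w"
    "u\<^sup>2 = p (Suc r) / (s * (s + p (Suc r)))" "w\<^sup>2 = s / (p (Suc r) * (s + p (Suc r)))"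
    "u * w = 1 / (s + p (Suc r))" "s * u = p (Suc r) * w"
proof -
  define s where "s = (\<Sum>i=1..r. p i)"
  define q where "q = p (Suc r)"
  define u where "u = sqrt (q / (s * (s + q)))"
  define w where "w = sqrt (s / (q * (s + q)))"
  have s: "s > 0" unfolding s_def using assms by (intro sum_pos) auto
  have q: "q > 0" unfolding q_def using assms by auto
  have u2: "u\<^sup>2 = q / (s * (s + q))" unfolding u_def using s q by simp
  have w2: "w\<^sup>2 = s / (q * (s + q))" unfolding w_def using s q by simp
  have "u * w = sqrt ((1 / (s + q))\<^sup>2)"
    unfolding u_def w_def real_sqrt_mult[symmetric] using s q
    by (simp add: power2_eq_square)
  then have uw: "u * w = 1 / (s + q)" using s q by (simp del: real_sqrt_abs add: real_sqrt_unique)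
  have "(s * u)\<^sup>2 = (q * w)\<^sup>2"
    unfolding power_mult_distrib u2 w2 using s q by (simp add: divide_simps power2_eq_square)
  then have su: "s * u = q * w"
    by (rule power2_eq_imp_eq) (use s q in \<open>auto simp: u_def w_def\<close>)
  have h: "\<forall>j\<le>r. helmert p r j = u"
    by (simp add: helmert_def u_def s_def q_def)
  have h': "helmert p r (Suc r) = - w"
    by (simp add: helmert_def w_def s_def q_def)
  show ?thesis
    by (rule that[OF s_def s h h' u2[unfolded q_def] w2[unfolded q_def] uw[unfolded q_def] su[unfolded q_def]])
qed

lemma helmert_beyond: "j > Suc r \<Longrightarrow> helmert p r j = 0"
  by (simp add: helmert_def)

lemma helmert_mean_zero:
  assumes "r \<ge> 1" "r < N" "\<And>j. j \<in> {1..N} \<Longrightarrow> p j > 0"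
  shows "(\<Sum>j=1..N. p j * helmert p r j) = 0"
proof -
  have pos: "p j > 0" if "j \<in> {1..Suc r}" for j using that assms by auto
  obtain s u w where h: "s = (\<Sum>i=1..r. p i)" "s > 0" "\<forall>j\<le>r. helmert p r j = u"
      "helmert p r (Suc r) = - w" "u\<^sup>2 = p (Suc r) / (s * (s + p (Suc r)))"
      "w\<^sup>2 = s / (p (Suc r) * (s + p (Suc r)))" "u * w = 1 / (s + p (Suc r))" "s * u = p (Suc r) * w"
    by (rule helmert_initial[OF assms(1) pos])
  have "(\<Sum>j=1..N. p j * helmert p r j) = (\<Sum>j=1..Suc r. p j * helmert p r j)"
    using assms by (intro sum.mono_neutral_right) (auto simp: helmert_beyond)
  also have "\<dots> = (\<Sum>j=1..r. p j * u) - p (Suc r) * w"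
    using h by simp
  also have "\<dots> = 0" using h by (simp add: sum_distrib_right[symmetric])
  finally show ?thesis .
qed

text \<open>
  Orthonormality in the form in which it is used: passing from \<open>m\<close> to \<open>m + 1\<close> outcomes adds one
  contrast, which is constant on the outcomes \<open>1, \<dots>, m\<close>, so that the cross term is a multiple of
  the mean of the earlier contrasts and vanishes.
\<close>

lemma helmert_isometry:
  assumes "m \<ge> 1" "\<And>j. j \<in> {1..m} \<Longrightarrow> p j > 0"
  shows "(\<Sum>j=1..m. p j * (\<Sum>r=1..<m. \<theta> r * helmert p r j)\<^sup>2) = (\<Sum>r=1..<m. (\<theta> r)\<^sup>2)"
  using assms
proof (induction m rule: nat_induct_at_least)
  case base
  then show ?case by simp
next
  case (Suc m)
  define \<xi> where "\<xi> j = (\<Sum>r=1..<m. \<theta> r * helmert p r j)" for j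
  obtain s u w where h: "s = (\<Sum>i=1..m. p i)" "s > 0" "\<forall>j\<le>m. helmert p m j = u"
      "helmert p m (Suc m) = - w" "u\<^sup>2 = p (Suc m) / (s * (s + p (Suc m)))"
      "w\<^sup>2 = s / (p (Suc m) * (s + p (Suc m)))" "u * w = 1 / (s + p (Suc m))" "s * u = p (Suc m) * w"
    by (rule helmert_initial[OF Suc.hyps Suc.prems])
  have q: "p (Suc m) > 0" using Suc.prems by auto
  have mean: "(\<Sum>j=1..m. p j * \<xi> j) = 0"
  proof -
    have "(\<Sum>j=1..m. p j * \<xi> j) = (\<Sum>r=1..<m. \<theta> r * (\<Sum>j=1..m. p j * helmert p r j))"
      unfolding \<xi>_def sum_distrib_left by (subst sum.swap) (simp add: mult_ac)
    also have "\<dots> = 0"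
    proof (intro sum.neutral ballI)
      fix r assume "r \<in> {1..<m}"
      then have "(\<Sum>j=1..m. p j * helmert p r j) = 0"
        using Suc.prems by (intro helmert_mean_zero) auto
      then show "\<theta> r * (\<Sum>j=1..m. p j * helmert p r j) = 0" by simp
    qed
    finally show ?thesis .
  qed
  have IH: "(\<Sum>j=1..m. p j * (\<xi> j)\<^sup>2) = (\<Sum>r=1..<m. (\<theta> r)\<^sup>2)"
    unfolding \<xi>_def using Suc.prems by (intro Suc.IH) auto
  have split: "(\<Sum>r=1..<Suc m. \<theta> r * helmert p r j) = \<xi> j + \<theta> m * helmert p m j" for j
    using Suc.hyps unfolding \<xi>_def by (simp add: atLeastLessThanSuc)
  have "\<xi> (Suc m) = 0" unfolding \<xi>_def by (intro sum.neutral) (auto simp: helmert_beyond)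
  then have "(\<Sum>j=1..Suc m. p j * (\<Sum>r=1..<Suc m. \<theta> r * helmert p r j)\<^sup>2)
      = (\<Sum>j=1..m. p j * (\<xi> j + \<theta> m * u)\<^sup>2) + p (Suc m) * (\<theta> m * w)\<^sup>2"
    unfolding split using h(3,4) by simp
  also have "(\<Sum>j=1..m. p j * (\<xi> j + \<theta> m * u)\<^sup>2)
      = (\<Sum>j=1..m. p j * (\<xi> j)\<^sup>2 + 2 * \<theta> m * u * (p j * \<xi> j) + (\<theta> m * u)\<^sup>2 * p j)"
    by (intro sum.cong) (auto simp: power2_eq_square algebra_simps)
  also have "\<dots> = (\<Sum>j=1..m. p j * (\<xi> j)\<^sup>2) + 2 * \<theta> m * u * (\<Sum>j=1..m. p j * \<xi> j) + (\<theta> m * u)\<^sup>2 * s"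
    unfolding h(1) by (simp add: sum.distrib sum_distrib_left)
  also have "\<dots> + p (Suc m) * (\<theta> m * w)\<^sup>2
      = (\<Sum>r=1..<m. (\<theta> r)\<^sup>2) + (\<theta> m)\<^sup>2 * (s * u\<^sup>2 + p (Suc m) * w\<^sup>2)"
    unfolding mean IH by (simp add: power_mult_distrib algebra_simps)
  also have "s * u\<^sup>2 + p (Suc m) * w\<^sup>2 = 1"
    unfolding h(5,6) using h(2) q by (simp add: divide_simps)
  finally show ?case using Suc.hyps by (simp add: atLeastLessThanSuc)
qed

text \<open>
  The contrasts together with the constant function form an orthonormal basis, so this is Parseval's
  identity for the function \<open>a j / p j\<close>; the first term on the right is its component along
  the constants. The induction adds one outcome and its contrast at a time.
\<close>

lemma helmert_parseval:
  assumes "m \<ge> 1" "\<And>j. j \<in> {1..m} \<Longrightarrow> p j > 0"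
  shows "(\<Sum>j=1..m. (a j)\<^sup>2 / p j)
    = (\<Sum>j=1..m. a j)\<^sup>2 / (\<Sum>j=1..m. p j) + (\<Sum>r=1..<m. (\<Sum>j=1..m. a j * helmert p r j)\<^sup>2)"
  using assms
proof (induction m rule: nat_induct_at_least)
  case base
  then show ?case by simp
next
  case (Suc m)
  define A where "A = (\<Sum>j=1..m. a j)"
  obtain s u w where h: "s = (\<Sum>i=1..m. p i)" "s > 0" "\<forall>j\<le>m. helmert p m j = u"
      "helmert p m (Suc m) = - w" "u\<^sup>2 = p (Suc m) / (s * (s + p (Suc m)))"
      "w\<^sup>2 = s / (p (Suc m) * (s + p (Suc m)))" "u * w = 1 / (s + p (Suc m))" "s * u = p (Suc m) * w"
    by (rule helmert_initial[OF Suc.hyps Suc.prems])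
  have q: "p (Suc m) > 0" using Suc.prems by auto
  define q where "q = p (Suc m)"
  define b where "b = a (Suc m)"
  have q0: "q > 0" using q q_def by simp
  have IH: "(\<Sum>j=1..m. (a j)\<^sup>2 / p j) = A\<^sup>2 / s + (\<Sum>r=1..<m. (\<Sum>j=1..m. a j * helmert p r j)\<^sup>2)"
    unfolding A_def h(1) using Suc.prems by (intro Suc.IH) auto
  have "(\<Sum>r=1..<Suc m. (\<Sum>j=1..Suc m. a j * helmert p r j)\<^sup>2)
      = (\<Sum>r=1..<m. (\<Sum>j=1..m. a j * helmert p r j)\<^sup>2) + (\<Sum>j=1..Suc m. a j * helmert p m j)\<^sup>2"
    using Suc.hyps by (simp add: atLeastLessThanSuc helmert_beyond)
  also have "(\<Sum>j=1..Suc m. a j * helmert p m j) = A * u - b * w"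
    unfolding A_def b_def using h(3,4) by (simp add: sum_distrib_right)
  finally have 1: "(\<Sum>r=1..<Suc m. (\<Sum>j=1..Suc m. a j * helmert p r j)\<^sup>2)
      = (\<Sum>r=1..<m. (\<Sum>j=1..m. a j * helmert p r j)\<^sup>2) + (A * u - b * w)\<^sup>2" .
  have "(A * u - b * w)\<^sup>2 = A\<^sup>2 * u\<^sup>2 + b\<^sup>2 * w\<^sup>2 - 2 * A * b * (u * w)"
    by (simp add: power2_eq_square algebra_simps)
  also have "\<dots> = A\<^sup>2 / s + b\<^sup>2 / q - (A + b)\<^sup>2 / (s + q)"
    unfolding h(5-7) q_def[symmetric] using h(2) q0
    by (simp add: divide_simps) (simp add: algebra_simps power2_eq_square)
  finally have 2: "(A * u - b * w)\<^sup>2 = A\<^sup>2 / s + b\<^sup>2 / q - (A + b)\<^sup>2 / (s + q)" .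
  show ?case
  proof -
    have "(\<Sum>j=1..Suc m. a j) = A + b" "(\<Sum>j=1..Suc m. p j) = s + q"
      "(\<Sum>j=1..Suc m. (a j)\<^sup>2 / p j) = (\<Sum>j=1..m. (a j)\<^sup>2 / p j) + b\<^sup>2 / q"
      by (simp_all add: A_def b_def h(1) q_def)
    then show ?thesis unfolding 1 2 using IH by simp
  qed
qed

lemma sum_over_trials:
  fixes g :: "nat \<Rightarrow> real"
  assumes "\<And>i. i < n \<Longrightarrow> T i \<omega> \<in> {1..N}"
  shows "(\<Sum>i<n. g (T i \<omega>)) = (\<Sum>j=1..N. real (occurrences T j n \<omega>) * g j)"
proof -
  have "(\<Sum>i<n. g (T i \<omega>)) = (\<Sum>j=1..N. \<Sum>i\<in>{i\<in>{..<n}. T i \<omega> = j}. g (T i \<omega>))"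
    using assms by (intro sum.group[symmetric]) auto
  also have "\<dots> = (\<Sum>j=1..N. real (occurrences T j n \<omega>) * g j)"
    by (intro sum.cong refl) (simp add: occurrences_def)
  finally show ?thesis .
qed

text \<open>
  The deviations \<open>occurrences - n p\<close> sum to zero, so the constant direction contributes nothing to
  Parseval's identity, and what remains are \<open>N - 1\<close> squares of normalised sums over the trials.
\<close>

lemma pearson_eq_helmert_norm:
  assumes "N \<ge> 1" "\<And>j. j \<in> {1..N} \<Longrightarrow> p j > 0" "(\<Sum>j=1..N. p j) = 1" "n > 0"
    and T: "\<And>i. i < n \<Longrightarrow> T i \<omega> \<in> {1..N}"
  shows "pearson N p T n \<omega> = (\<Sum>r=1..<N. ((\<Sum>i<n. helmert p r (T i \<omega>)) / sqrt (real n))\<^sup>2)"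
proof -
  define a where "a j = real (occurrences T j n \<omega>) - real n * p j" for j
  have "(\<Sum>j=1..N. a j) = 0"
    using sum_over_trials[of n T \<omega> N "\<lambda>_. 1"] T assms(3)
    by (simp add: a_def sum_subtractf sum_distrib_left[symmetric])
  then have "(\<Sum>j=1..N. (a j)\<^sup>2 / p j) = (\<Sum>r=1..<N. (\<Sum>j=1..N. a j * helmert p r j)\<^sup>2)"
    using helmert_parseval[of N p a] assms by simp
  also have "\<dots> = (\<Sum>r=1..<N. (\<Sum>i<n. helmert p r (T i \<omega>))\<^sup>2)"
  proof (rule sum.cong[OF refl])
    fix r assume r: "r \<in> {1..<N}"
    have "(\<Sum>j=1..N. a j * helmert p r j)
        = (\<Sum>j=1..N. real (occurrences T j n \<omega>) * helmert p r j)
          - real n * (\<Sum>j=1..N. p j * helmert p r j)"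
      unfolding a_def left_diff_distrib sum_subtractf sum_distrib_left by (simp add: mult.assoc)
    also have "(\<Sum>j=1..N. p j * helmert p r j) = 0"
      using r assms by (intro helmert_mean_zero) auto
    finally show "(\<Sum>j=1..N. a j * helmert p r j)\<^sup>2 = (\<Sum>i<n. helmert p r (T i \<omega>))\<^sup>2"
      using sum_over_trials[of n T \<omega> N "helmert p r"] T by simp
  qed
  finally have *: "(\<Sum>j=1..N. (a j)\<^sup>2 / p j) = (\<Sum>r=1..<N. (\<Sum>i<n. helmert p r (T i \<omega>))\<^sup>2)" .
  have "pearson N p T n \<omega> = (\<Sum>j=1..N. (a j)\<^sup>2 / p j) / real n"
    unfolding pearson_def sum_divide_distrib
    by (intro sum.cong refl) (simp add: a_def)
  also have "\<dots> = (\<Sum>r=1..<N. ((\<Sum>i<n. helmert p r (T i \<omega>)) / sqrt (real n))\<^sup>2)"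
    unfolding * sum_divide_distrib[of _ _ "real n"]
    by (intro sum.cong refl) (simp only: power_divide real_sqrt_pow2 of_nat_0_le_iff)
  finally show ?thesis .
qed

section \<open>Powers of a characteristic function with small variance\<close>

text \<open>
  The central limit theorem for rows of variables with finitely many values, for characteristic
  functions only. Each value is at most a constant times the square root of the variance \<open>Q\<close>, so the
  third-order Taylor error is \<open>O(Q powr (3/2))\<close>, and \<open>m\<close> such factors differ from
  \<open>exp (- m Q / 2)\<close> by \<open>m Q\<close> times a null sequence.
\<close>

lemma char_fun_power_limit:
  fixes p :: "nat \<Rightarrow> real" and x :: "nat \<Rightarrow> nat \<Rightarrow> real" and m :: "nat \<Rightarrow> nat"
  assumes p: "\<And>j. j \<in> {1..N} \<Longrightarrow> p j > 0" "(\<Sum>j=1..N. p j) = 1"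
    and mean: "\<And>k. (\<Sum>j=1..N. p j * x k j) = 0"
    and var: "\<And>k. (\<Sum>j=1..N. p j * (x k j)\<^sup>2) = Q k"
    and Q: "Q \<longlonglongrightarrow> 0" and mQ: "(\<lambda>k. real (m k) * Q k) \<longlonglongrightarrow> \<tau>"
  shows "(\<lambda>k. (\<Sum>j=1..N. complex_of_real (p j) * iexp (x k j)) ^ m k) \<longlonglongrightarrow> exp (- of_real \<tau> / 2)"
proof -
  define \<phi> where "\<phi> k = (\<Sum>j=1..N. complex_of_real (p j) * iexp (x k j))" for k
  \<comment> \<open>Any bound for all \<open>1 / sqrt (p j)\<close> would do.\<close>
  define C where "C = (\<Sum>j=1..N. (1 / p j) powr (1/2))"
  have Q0: "Q k \<ge> 0" for k
    unfolding var[symmetric] using p by (intro sum_nonneg mult_nonneg_nonneg) (auto intro: less_imp_le)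
  have C0: "C \<ge> 0" unfolding C_def by (intro sum_nonneg) auto
  have bd: "\<bar>x k j\<bar> \<le> C * sqrt (Q k)" if j: "j \<in> {1..N}" for k j
  proof -
    have "p j * (x k j)\<^sup>2 \<le> Q k"
      unfolding var[symmetric] using p j
      by (intro member_le_sum) (auto intro!: mult_nonneg_nonneg intro: less_imp_le)
    then have "(x k j)\<^sup>2 \<le> (1 / p j) * Q k" using p(1)[OF j] by (simp add: field_simps)
    then have "\<bar>x k j\<bar> \<le> sqrt ((1 / p j) * Q k)"
      using real_sqrt_le_mono by fastforce
    also have "\<dots> = (1 / p j) powr (1/2) * sqrt (Q k)"
      using p(1)[OF j] by (simp only: real_sqrt_mult powr_half_sqrt zero_le_divide_1_iff less_imp_le)
    also have "(1 / p j) powr (1/2) \<le> C"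
      unfolding C_def using j by (intro member_le_sum) auto
    finally show ?thesis using Q0 by (simp add: mult_right_mono)
  qed
  have \<phi>1: "cmod (\<phi> k) \<le> 1" for k
  proof -
    have "cmod (\<phi> k) \<le> (\<Sum>j=1..N. cmod (complex_of_real (p j) * iexp (x k j)))"
      unfolding \<phi>_def by (rule norm_sum)
    also have "\<dots> = (\<Sum>j=1..N. p j)"
      using p by (intro sum.cong refl) (auto simp: norm_mult less_imp_le)
    finally show ?thesis using p by simp
  qed
  have approx: "cmod (\<phi> k - (1 - of_real (Q k / 2))) \<le> C * sqrt (Q k) * Q k" for k
  proof -
    have "(1 :: complex) - of_real (Q k / 2)
        = of_real ((\<Sum>j=1..N. p j) - (\<Sum>j=1..N. p j * (x k j)\<^sup>2) / 2)"
      unfolding p(2) var by simp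
    also have "\<dots> = of_real (\<Sum>j=1..N. p j) + \<i> * of_real (\<Sum>j=1..N. p j * x k j)
        - of_real ((\<Sum>j=1..N. p j * (x k j)\<^sup>2) / 2)"
      by (simp only: mean) simp
    also have "\<dots> = (\<Sum>j=1..N. of_real (p j) * (\<Sum>l\<le>2. (\<i> * of_real (x k j))^l / fact l))"
      by (simp add: numeral_2_eq_2 algebra_simps sum.distrib sum_distrib_left sum_divide_distrib
          sum_subtractf sum_negf)
    finally have e: "(1 :: complex) - of_real (Q k / 2)
        = (\<Sum>j=1..N. of_real (p j) * (\<Sum>l\<le>2. (\<i> * of_real (x k j))^l / fact l))" .
    have "cmod (\<phi> k - (1 - of_real (Q k / 2)))
        = cmod (\<Sum>j=1..N. of_real (p j) * (iexp (x k j) - (\<Sum>l\<le>2. (\<i> * of_real (x k j))^l / fact l)))"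
      unfolding \<phi>_def e by (simp only: sum_subtractf right_diff_distrib)
    also have "\<dots> \<le> (\<Sum>j=1..N. C * sqrt (Q k) * (p j * (x k j)\<^sup>2))"
    proof (rule sum_norm_le)
      fix j assume j: "j \<in> {1..N}"
      have "cmod (iexp (x k j) - (\<Sum>l\<le>2. (\<i> * of_real (x k j))^l / fact l)) \<le> \<bar>x k j\<bar> ^ Suc 2 / fact (Suc 2)"
        by (rule iexp_approx1)
      also have "\<dots> \<le> \<bar>x k j\<bar> ^ Suc 2 / 1"
        by (rule divide_left_mono) (auto simp: numeral_2_eq_2)
      also have "\<dots> = \<bar>x k j\<bar> * (x k j)\<^sup>2" by (simp add: numeral_2_eq_2)
      also have "\<dots> \<le> C * sqrt (Q k) * (x k j)\<^sup>2" using bd[OF j] by (intro mult_right_mono) auto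
      finally show "cmod (of_real (p j) * (iexp (x k j) - (\<Sum>l\<le>2. (\<i> * of_real (x k j))^l / fact l)))
          \<le> C * sqrt (Q k) * (p j * (x k j)\<^sup>2)"
        using p(1)[OF j] by (simp add: norm_mult mult_left_mono mult.left_commute)
    qed
    also have "\<dots> = C * sqrt (Q k) * Q k" by (simp only: sum_distrib_left[symmetric] var)
    finally show ?thesis .
  qed
  have e2: "\<bar>exp (- Q k / 2) - (1 - Q k / 2)\<bar> \<le> (Q k)\<^sup>2" if "Q k \<le> 1" for k
  proof -
    have "exp (- Q k / 2) \<ge> 1 - Q k / 2" using exp_ge_add_one_self[of "- Q k / 2"] by simp
    moreover have "exp (- Q k / 2) \<le> 1 - Q k / 2 + (Q k)\<^sup>2"
    proof -
      have "1 + Q k / 2 \<le> exp (Q k / 2)" by (rule exp_ge_add_one_self)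
      then have "exp (- Q k / 2) \<le> 1 / (1 + Q k / 2)"
        using Q0[of k] by (simp add: exp_minus field_simps)
      also have "\<dots> \<le> 1 - Q k / 2 + (Q k)\<^sup>2"
        using Q0[of k] by (simp add: field_simps power2_eq_square)
      finally show ?thesis .
    qed
    ultimately show ?thesis by simp
  qed
  have "(\<lambda>k. \<phi> k ^ m k - of_real (exp (- Q k / 2)) ^ m k) \<longlonglongrightarrow> 0"
  proof (rule Lim_null_comparison)
    have "eventually (\<lambda>k. Q k < 1) sequentially" using Q by (rule order_tendstoD) simp
    then show "\<forall>\<^sub>F k in sequentially. norm (\<phi> k ^ m k - of_real (exp (- Q k / 2)) ^ m k)
        \<le> (real (m k) * Q k) * (C * sqrt (Q k) + Q k)"
    proof eventually_elim
      case (elim k)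
      have "cmod (\<phi> k - of_real (exp (- Q k / 2)))
         \<le> cmod (\<phi> k - (1 - of_real (Q k / 2))) + cmod (of_real (exp (- Q k / 2)) - (1 - of_real (Q k / 2)))"
        by (rule order_trans[OF _ norm_triangle_ineq4]) (simp add: algebra_simps)
      also have "complex_of_real (exp (- Q k / 2)) - (1 - of_real (Q k / 2))
          = of_real (exp (- Q k / 2) - (1 - Q k / 2))"
        by (simp only: of_real_diff of_real_1)
      also have "cmod \<dots> = \<bar>exp (- Q k / 2) - (1 - Q k / 2)\<bar>"
        by (rule norm_of_real)
      also have "cmod (\<phi> k - (1 - of_real (Q k / 2))) + \<bar>exp (- Q k / 2) - (1 - Q k / 2)\<bar>
          \<le> Q k * (C * sqrt (Q k) + Q k)"
        using approx[of k] e2[of k] elim by (simp add: power2_eq_square algebra_simps)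
      finally have step: "cmod (\<phi> k - of_real (exp (- Q k / 2))) \<le> Q k * (C * sqrt (Q k) + Q k)" .
      have "norm (\<phi> k ^ m k - of_real (exp (- Q k / 2)) ^ m k)
          \<le> real (m k) * cmod (\<phi> k - of_real (exp (- Q k / 2)))"
        using \<phi>1 Q0[of k] by (intro norm_power_diff) auto
      also have "\<dots> \<le> real (m k) * (Q k * (C * sqrt (Q k) + Q k))"
        by (rule mult_left_mono[OF step]) simp
      finally show ?case by (simp only: mult.assoc)
    qed
    have "(\<lambda>k. (real (m k) * Q k) * (C * sqrt (Q k) + Q k)) \<longlonglongrightarrow> \<tau> * (C * sqrt 0 + 0)"
      by (intro tendsto_intros mQ Q)
    then show "(\<lambda>k. (real (m k) * Q k) * (C * sqrt (Q k) + Q k)) \<longlonglongrightarrow> 0" by simp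
  qed
  moreover have "(\<lambda>k. complex_of_real (exp (- Q k / 2)) ^ m k) \<longlonglongrightarrow> exp (- of_real \<tau> / 2)"
  proof -
    have "complex_of_real (exp (- Q k / 2)) ^ m k = of_real (exp (- (real (m k) * Q k) / 2))" for k
      by (simp flip: of_real_power exp_of_nat_mult)
    moreover have "(\<lambda>k. complex_of_real (exp (- (real (m k) * Q k) / 2))) \<longlonglongrightarrow> of_real (exp (- \<tau> / 2))"
      by (intro tendsto_intros mQ) simp
    ultimately show ?thesis by (simp flip: exp_of_real)
  qed
  ultimately show ?thesis
    using tendsto_add[of "\<lambda>k. \<phi> k ^ m k - of_real (exp (- Q k / 2)) ^ m k" 0 sequentially]
    by (fastforce simp: \<phi>_def)
qed

section \<open>The joint Laplace transform of two Pearson statistics\<close>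

text \<open>
  Completing the square turns the integrand into a multiple of a normal density with variance
  \<open>1 / (1 + 2 m)\<close>.
\<close>

lemma gaussian_exp_quadratic:
  fixes m b :: real
  assumes "m \<ge> 0"
  shows "(\<integral>z. exp (- m * z\<^sup>2 - b * z) \<partial>std_normal_distribution) = exp (b\<^sup>2 / (2 * (1 + 2 * m))) / sqrt (1 + 2 * m)"
proof -
  define q where "q = 1 + 2 * m"
  have q: "q > 0" using assms by (simp add: q_def)
  have "std_normal_density z * exp (- m * z\<^sup>2 - b * z)
      = exp (b\<^sup>2 / (2 * q)) / sqrt q * normal_density (- b / q) (1 / sqrt q) z" for z
  proof -
    have "- z\<^sup>2 / 2 + (- m * z\<^sup>2 - b * z) = b\<^sup>2 / (2 * q) + (- (z - (- b / q))\<^sup>2 / (2 * (1 / sqrt q)\<^sup>2))"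
    proof -
      have mq: "m = (q - 1) / 2" by (simp add: q_def)
      show ?thesis unfolding mq using q by (simp add: power_divide divide_simps) (simp add: power2_eq_square algebra_simps)
    qed
    then have "exp (- z\<^sup>2 / 2) * exp (- m * z\<^sup>2 - b * z)
        = exp (b\<^sup>2 / (2 * q)) * exp (- (z - (- b / q))\<^sup>2 / (2 * (1 / sqrt q)\<^sup>2))"
      by (simp only: exp_add[symmetric])
    moreover have "1 / sqrt (2 * pi) = 1 / sqrt q * (1 / sqrt (2 * pi * (1 / sqrt q)\<^sup>2))"
      using q by (simp add: power_divide real_sqrt_divide real_sqrt_mult)
    ultimately show ?thesis
      unfolding normal_density_def by (simp add: mult.assoc)
  qed
  then have "(\<integral>z. exp (- m * z\<^sup>2 - b * z) \<partial>std_normal_distribution)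
      = (\<integral>z. exp (b\<^sup>2 / (2 * q)) / sqrt q * normal_density (- b / q) (1 / sqrt q) z \<partial>lborel)"
    by (subst integral_density) auto
  also have "\<dots> = exp (b\<^sup>2 / (2 * q)) / sqrt q"
    using q by (simp only: integral_mult_right_zero) simp
  finally show ?thesis by (simp add: q_def)
qed

abbreviation std_normal_pair :: "(real \<times> real) measure" where
  "std_normal_pair \<equiv> std_normal_distribution \<Otimes>\<^sub>M std_normal_distribution"

lemma prob_space_std_normal: "prob_space std_normal_distribution"
  using real_dist_normal_dist by (simp add: real_distribution_def)

lemma prob_space_std_normal_pair: "prob_space std_normal_pair"
proof -
  interpret N: prob_space std_normal_distribution by (rule prob_space_std_normal)
  interpret P: pair_prob_space std_normal_distribution std_normal_distribution ..
  show ?thesis by (rule P.prob_space_axioms)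
qed

lemma fourier_std_normal_pair:
  "(\<integral>z. iexp (s * fst z + t * snd z) \<partial>std_normal_pair)
    = complex_of_real (exp (- (s\<^sup>2 + t\<^sup>2) / 2))"
proof -
  interpret N: prob_space std_normal_distribution by (rule prob_space_std_normal)
  interpret P: pair_prob_space std_normal_distribution std_normal_distribution ..
  have "integrable std_normal_pair (\<lambda>z. iexp (s * fst z + t * snd z))"
    by (rule P.integrable_const_bound[of _ 1]) auto
  then have "(\<integral>z. iexp (s * fst z + t * snd z) \<partial>std_normal_pair)
      = (\<integral>x. \<integral>y. iexp (s * x + t * y) \<partial>std_normal_distribution \<partial>std_normal_distribution)"
    by (subst P.integral_fst'[symmetric]) auto
  also have "\<dots> = (\<integral>x. \<integral>y. iexp (s * x) * iexp (t * y) \<partial>std_normal_distribution \<partial>std_normal_distribution)"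
    by (simp add: ring_distribs exp_add)
  also have "\<dots> = char std_normal_distribution s * char std_normal_distribution t"
    by (simp add: char_def)
  also have "\<dots> = complex_of_real (exp (- s\<^sup>2 / 2) * exp (- t\<^sup>2 / 2))"
    by (simp add: char_std_normal_distribution)
  also have "exp (- s\<^sup>2 / 2) * exp (- t\<^sup>2 / 2) = exp (- (s\<^sup>2 + t\<^sup>2) / 2)"
    by (simp add: exp_add[symmetric] field_simps)
  finally show ?thesis .
qed

text \<open>
  For \<open>c \<le> 1\<close> the form is \<open>(sqrt a x + c sqrt b y)\<^sup>2 + (1 - c\<^sup>2) b y\<^sup>2\<close>. It makes the integrands below bounded
  by one.
\<close>

lemma quadratic_form_nonneg:
  fixes a b c x y :: real
  assumes "a \<ge> 0" "b \<ge> 0" "0 \<le> c" "c \<le> 1"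
  shows "0 \<le> a * x\<^sup>2 + 2 * c * sqrt (a * b) * x * y + b * y\<^sup>2"
proof -
  have "a * x\<^sup>2 + 2 * c * sqrt (a * b) * x * y + b * y\<^sup>2
     = (sqrt a * x + c * (sqrt b * y))\<^sup>2 + (1 - c\<^sup>2) * (b * y\<^sup>2)"
    using assms by (simp add: power2_sum power_mult_distrib real_sqrt_mult algebra_simps)
  also have "\<dots> \<ge> 0"
    using assms by (intro add_nonneg_nonneg mult_nonneg_nonneg) (auto simp: power_le_one)
  finally show ?thesis .
qed

text \<open>
  The two-dimensional Gaussian integral is done one variable at a time; the first integration
  replaces \<open>1 + 2 b\<close> by the Schur complement \<open>1 + 2 m\<close>.
\<close>

lemma gaussian_pair_quadratic:
  fixes a b c :: real
  assumes "a \<ge> 0" "b \<ge> 0" "0 \<le> c" "c \<le> 1"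
  shows "(\<integral>z. exp (- (a * (fst z)\<^sup>2 + 2 * c * sqrt (a * b) * fst z * snd z + b * (snd z)\<^sup>2)) \<partial>std_normal_pair)
    = ((1 + 2 * a) * (1 + 2 * b) - 4 * a * b * c\<^sup>2) powr (- 1 / 2)"
proof -
  interpret N: prob_space std_normal_distribution by (rule prob_space_std_normal)
  interpret P: pair_prob_space std_normal_distribution std_normal_distribution ..
  define m where "m = b - 2 * c\<^sup>2 * a * b / (1 + 2 * a)"
  have "2 * c\<^sup>2 * a * b / (1 + 2 * a) \<le> b"
  proof -
    have "c\<^sup>2 * (a * b) \<le> 1 * (a * b)"
      using assms by (intro mult_right_mono) (auto simp: power_le_one)
    then show ?thesis using assms by (simp add: field_simps)
  qed
  then have m: "m \<ge> 0" by (simp add: m_def)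
  have "integrable std_normal_pair (\<lambda>z. exp (- (a * (fst z)\<^sup>2 + 2 * c * sqrt (a * b) * fst z * snd z + b * (snd z)\<^sup>2)))"
    using quadratic_form_nonneg[OF assms]
    by (intro P.integrable_const_bound[of _ 1]) (auto simp del: minus_add_distrib)
  then have "(\<integral>z. exp (- (a * (fst z)\<^sup>2 + 2 * c * sqrt (a * b) * fst z * snd z + b * (snd z)\<^sup>2)) \<partial>std_normal_pair)
      = (\<integral>y. \<integral>x. exp (- (a * x\<^sup>2 + 2 * c * sqrt (a * b) * x * y + b * y\<^sup>2)) \<partial>std_normal_distribution \<partial>std_normal_distribution)"
    using P.integral_snd[of "\<lambda>x y. exp (- (a * x\<^sup>2 + 2 * c * sqrt (a * b) * x * y + b * y\<^sup>2))"]
    by (simp add: case_prod_unfold)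
  also have "\<dots> = (\<integral>y. 1 / sqrt (1 + 2 * a) * exp (- m * y\<^sup>2 - 0 * y) \<partial>std_normal_distribution)"
  proof (intro Bochner_Integration.integral_cong refl)
    fix y :: real
    have "(\<integral>x. exp (- (a * x\<^sup>2 + 2 * c * sqrt (a * b) * x * y + b * y\<^sup>2)) \<partial>std_normal_distribution)
      = (\<integral>x. exp (- b * y\<^sup>2) * exp (- a * x\<^sup>2 - (2 * c * sqrt (a * b) * y) * x) \<partial>std_normal_distribution)"
      by (intro Bochner_Integration.integral_cong refl) (simp add: exp_add[symmetric] algebra_simps)
    also have "\<dots> = exp (- b * y\<^sup>2) * (exp ((2 * c * sqrt (a * b) * y)\<^sup>2 / (2 * (1 + 2 * a))) / sqrt (1 + 2 * a))"
      by (simp only: integral_mult_right_zero gaussian_exp_quadratic[OF assms(1)])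
    also have "\<dots> = 1 / sqrt (1 + 2 * a) * exp (- b * y\<^sup>2 + (2 * c * sqrt (a * b) * y)\<^sup>2 / (2 * (1 + 2 * a)))"
      by (simp only: exp_add) simp
    also have "- b * y\<^sup>2 + (2 * c * sqrt (a * b) * y)\<^sup>2 / (2 * (1 + 2 * a)) = - m * y\<^sup>2 - 0 * y"
      using assms unfolding m_def by (simp add: power_mult_distrib divide_simps) (simp add: algebra_simps)
    finally show "(\<integral>x. exp (- (a * x\<^sup>2 + 2 * c * sqrt (a * b) * x * y + b * y\<^sup>2)) \<partial>std_normal_distribution)
        = 1 / sqrt (1 + 2 * a) * exp (- m * y\<^sup>2 - 0 * y)" .
  qed
  also have "\<dots> = 1 / sqrt (1 + 2 * a) * (1 / sqrt (1 + 2 * m))"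
    by (simp only: integral_mult_right_zero gaussian_exp_quadratic[OF m]) simp
  also have "\<dots> = ((1 + 2 * a) * (1 + 2 * m)) powr (- (1 / 2))"
    using assms m by (simp add: powr_minus_divide powr_half_sqrt real_sqrt_mult)
  also have "(1 + 2 * a) * (1 + 2 * m) = (1 + 2 * a) * (1 + 2 * b) - 4 * a * b * c\<^sup>2"
    using assms unfolding m_def by (simp add: divide_simps) (simp add: algebra_simps)
  finally show ?thesis by simp
qed

lemma independent_trialsD:
  assumes "independent_trials M N p T"
  shows "prob_space M" "prob_space.indep_vars M (\<lambda>_. count_space {1..N}) T UNIV"
    "T i \<in> measurable M (count_space {1..N})"
    "j \<in> {1..N} \<Longrightarrow> measure M {\<omega> \<in> space M. T i \<omega> = j} = p j"
proof -
  show 1: "prob_space M"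
    using assms unfolding independent_trials_def by (elim conjE)
  show 2: "prob_space.indep_vars M (\<lambda>_. count_space {1..N}) T UNIV"
    using assms unfolding independent_trials_def by (elim conjE)
  have 3: "\<forall>i. \<forall>j\<in>{1..N}. measure M {\<omega> \<in> space M. T i \<omega> = j} = p j"
    using assms unfolding independent_trials_def by (elim conjE)
  show "j \<in> {1..N} \<Longrightarrow> measure M {\<omega> \<in> space M. T i \<omega> = j} = p j"
    by (rule 3[rule_format])
  show "T i \<in> measurable M (count_space {1..N})"
    using 2[unfolded prob_space.indep_vars_def2[OF 1]] by simp
qed

lemma integral_trial:
  fixes g :: "nat \<Rightarrow> complex"
  assumes "independent_trials M N p T"
  shows "(\<integral>\<omega>. g (T i \<omega>) \<partial>M) = (\<Sum>j=1..N. complex_of_real (p j) * g j)"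
proof -
  interpret prob_space M by (rule independent_trialsD[OF assms])
  have T: "T i \<in> measurable M (count_space {1..N})"
    by (rule independent_trialsD[OF assms])
  have sets: "{\<omega> \<in> space M. T i \<omega> = j} \<in> sets M" for j
  proof (cases "j \<in> {1..N}")
    case True
    have "T i -` {j} \<inter> space M \<in> sets M" using True by (intro measurable_sets[OF T]) auto
    then show ?thesis by (simp add: vimage_def Int_def conj_commute)
  next
    case False
    then have "{\<omega> \<in> space M. T i \<omega> = j} = {}" using measurable_space[OF T] by auto
    then show ?thesis by (simp only: sets.empty_sets)
  qed
  have "(\<integral>\<omega>. g (T i \<omega>) \<partial>M)
      = (\<integral>\<omega>. (\<Sum>j=1..N. indicator {\<omega> \<in> space M. T i \<omega> = j} \<omega> *\<^sub>R g j) \<partial>M)"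
  proof (intro Bochner_Integration.integral_cong refl)
    fix \<omega> assume w: "\<omega> \<in> space M"
    then have "T i \<omega> \<in> {1..N}" using measurable_space[OF T] by simp
    then have "g (T i \<omega>) = (\<Sum>j=1..N. if j = T i \<omega> then g j else 0)" by simp
    also have "\<dots> = (\<Sum>j=1..N. indicator {\<omega> \<in> space M. T i \<omega> = j} \<omega> *\<^sub>R g j)"
      using w by (intro sum.cong) (auto simp: indicator_def)
    finally show "g (T i \<omega>) = (\<Sum>j=1..N. indicator {\<omega> \<in> space M. T i \<omega> = j} \<omega> *\<^sub>R g j)" .
  qed
  also have "\<dots> = (\<Sum>j=1..N. \<integral>\<omega>. indicator {\<omega> \<in> space M. T i \<omega> = j} \<omega> *\<^sub>R g j \<partial>M)"
    using sets by (intro Bochner_Integration.integral_sum integrable_scaleR_left)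
       (auto intro!: integrable_real_indicator simp: emeasure_eq_measure)
  also have "\<dots> = (\<Sum>j=1..N. complex_of_real (p j) * g j)"
  proof (intro sum.cong refl)
    fix j assume "j \<in> {1..N}"
    then have "measure M {\<omega> \<in> space M. T i \<omega> = j} = p j"
      by (rule independent_trialsD[OF assms])
    moreover have "(\<integral>\<omega>. indicator {\<omega> \<in> space M. T i \<omega> = j} \<omega> *\<^sub>R g j \<partial>M) = measure M {\<omega> \<in> space M. T i \<omega> = j} *\<^sub>R g j"
      using sets by (subst integral_scaleR_left) (auto simp: emeasure_eq_measure)
    ultimately show "(\<integral>\<omega>. indicator {\<omega> \<in> space M. T i \<omega> = j} \<omega> *\<^sub>R g j \<partial>M) = complex_of_real (p j) * g j"
      by (simp add: scaleR_conv_of_real)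
  qed
  finally show ?thesis .
qed

lemma trial_measurable:
  assumes "independent_trials M N p T"
  shows "(\<lambda>\<omega>. f (T i \<omega>)) \<in> borel_measurable M"
  by (rule measurable_compose[OF independent_trialsD(3)[OF assms]]) (simp add: measurable_count_space_eq1)

text \<open>
  The exponential of minus a squared norm is a Gaussian average of characters. This linearises the
  statistic in the trials, so that independence becomes applicable.
\<close>

lemma hubbard_stratonovich_vector:
  fixes S1 S2 :: "nat \<Rightarrow> real"
  assumes I: "finite I" and ab: "a \<ge> 0" "b \<ge> 0"
  shows "(\<integral>z. (\<Prod>r\<in>I. iexp (sqrt (2 * a) * S1 r * fst (z r) + sqrt (2 * b) * S2 r * snd (z r))) \<partial>Pi\<^sub>M I (\<lambda>_. std_normal_pair))
    = complex_of_real (exp (- a * (\<Sum>r\<in>I. (S1 r)\<^sup>2) - b * (\<Sum>r\<in>I. (S2 r)\<^sup>2)))"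
proof -
  interpret G: prob_space std_normal_pair by (rule prob_space_std_normal_pair)
  interpret product_sigma_finite "\<lambda>_::nat. std_normal_pair"
    by (intro product_sigma_finite.intro prob_space_imp_sigma_finite prob_space_std_normal_pair)
  have "(\<integral>z. (\<Prod>r\<in>I. iexp (sqrt (2 * a) * S1 r * fst (z r) + sqrt (2 * b) * S2 r * snd (z r))) \<partial>Pi\<^sub>M I (\<lambda>_. std_normal_pair))
     = (\<Prod>r\<in>I. \<integral>z. iexp (sqrt (2 * a) * S1 r * fst z + sqrt (2 * b) * S2 r * snd z) \<partial>std_normal_pair)"
    using I by (intro product_integral_prod) (auto intro!: G.integrable_const_bound[of _ 1])
  also have "\<dots> = (\<Prod>r\<in>I. complex_of_real (exp (- ((sqrt (2 * a) * S1 r)\<^sup>2 + (sqrt (2 * b) * S2 r)\<^sup>2) / 2)))"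
    by (simp only: fourier_std_normal_pair)
  also have "\<dots> = complex_of_real (exp (\<Sum>r\<in>I. - ((sqrt (2 * a) * S1 r)\<^sup>2 + (sqrt (2 * b) * S2 r)\<^sup>2) / 2))"
    using I by (simp only: exp_sum of_real_prod)
  also have "(\<Sum>r\<in>I. - ((sqrt (2 * a) * S1 r)\<^sup>2 + (sqrt (2 * b) * S2 r)\<^sup>2) / 2)
      = (\<Sum>r\<in>I. - (a * (S1 r)\<^sup>2) - b * (S2 r)\<^sup>2)"
    using ab by (intro sum.cong refl) (simp add: power_mult_distrib)
  also have "\<dots> = - a * (\<Sum>r\<in>I. (S1 r)\<^sup>2) - b * (\<Sum>r\<in>I. (S2 r)\<^sup>2)"
    by (simp add: sum_subtractf sum_negf sum_distrib_left)
  finally show ?thesis .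
qed

text \<open>
  The first \<open>n1\<close> trials enter both normalised sums, the remaining \<open>n2 - n1\<close> only the second one, so
  the expectation is a product of two powers of one-trial characteristic functions.
\<close>

lemma two_stage_char_fun:
  fixes \<theta>1 \<theta>2 :: "nat \<Rightarrow> real"
  assumes tr: "independent_trials M N p T" and n: "0 < n1" "n1 < n2"
  shows "(\<integral>\<omega>. (\<Prod>r\<in>{1..<N}. iexp (\<theta>1 r * ((\<Sum>i<n1. helmert p r (T i \<omega>)) / sqrt (real n1))
             + \<theta>2 r * ((\<Sum>i<n2. helmert p r (T i \<omega>)) / sqrt (real n2)))) \<partial>M)
    = (\<Sum>j=1..N. complex_of_real (p j)
          * iexp (\<Sum>r=1..<N. (\<theta>1 r / sqrt (real n1) + \<theta>2 r / sqrt (real n2)) * helmert p r j)) ^ n1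
      * (\<Sum>j=1..N. complex_of_real (p j)
          * iexp (\<Sum>r=1..<N. (\<theta>2 r / sqrt (real n2)) * helmert p r j)) ^ (n2 - n1)"
proof -
  interpret prob_space M by (rule independent_trialsD[OF tr])
  define \<xi>1 where "\<xi>1 j = (\<Sum>r=1..<N. (\<theta>1 r / sqrt (real n1) + \<theta>2 r / sqrt (real n2)) * helmert p r j)" for j
  define \<xi>2 where "\<xi>2 j = (\<Sum>r=1..<N. (\<theta>2 r / sqrt (real n2)) * helmert p r j)" for j
  define g where "g i j = iexp (if i < n1 then \<xi>1 j else \<xi>2 j)" for i j
  have split: "(\<Sum>i<n2. f i) = (\<Sum>i<n1. f i) + (\<Sum>i=n1..<n2. f i)" for f :: "nat \<Rightarrow> real"
    using n by (subst sum.union_disjoint[symmetric]) (auto intro!: sum.cong)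
  have splitp: "(\<Prod>i<n2. f i) = (\<Prod>i<n1. f i) * (\<Prod>i=n1..<n2. f i)" for f :: "nat \<Rightarrow> complex"
    using n by (subst prod.union_disjoint[symmetric]) (auto intro!: prod.cong)
  have prodform: "(\<Prod>r\<in>{1..<N}. iexp (\<theta>1 r * ((\<Sum>i<n1. helmert p r (T i \<omega>)) / sqrt (real n1))
             + \<theta>2 r * ((\<Sum>i<n2. helmert p r (T i \<omega>)) / sqrt (real n2)))) = (\<Prod>i<n2. g i (T i \<omega>))" for \<omega>
  proof -
    define H where "H r i = helmert p r (T i \<omega>)" for r i
    have "(\<Sum>r=1..<N. \<theta>1 r * ((\<Sum>i<n1. H r i) / sqrt (real n1)) + \<theta>2 r * ((\<Sum>i<n2. H r i) / sqrt (real n2)))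
        = (\<Sum>r=1..<N. (\<Sum>i<n1. (\<theta>1 r / sqrt (real n1) + \<theta>2 r / sqrt (real n2)) * H r i)
             + (\<Sum>i=n1..<n2. \<theta>2 r / sqrt (real n2) * H r i))"
    proof (rule sum.cong[OF refl])
      fix r
      show "\<theta>1 r * ((\<Sum>i<n1. H r i) / sqrt (real n1)) + \<theta>2 r * ((\<Sum>i<n2. H r i) / sqrt (real n2))
        = (\<Sum>i<n1. (\<theta>1 r / sqrt (real n1) + \<theta>2 r / sqrt (real n2)) * H r i)
             + (\<Sum>i=n1..<n2. \<theta>2 r / sqrt (real n2) * H r i)"
        unfolding split sum_distrib_left[symmetric] by (simp add: algebra_simps add_divide_distrib)
    qed
    also have "\<dots> = (\<Sum>i<n1. \<xi>1 (T i \<omega>)) + (\<Sum>i=n1..<n2. \<xi>2 (T i \<omega>))"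
      unfolding sum.distrib H_def \<xi>1_def \<xi>2_def
      by (rule arg_cong2[where f="(+)"]; rule sum.swap)
    also have "\<dots> = (\<Sum>i<n2. if i < n1 then \<xi>1 (T i \<omega>) else \<xi>2 (T i \<omega>))"
      unfolding split by simp
    finally have e: "(\<Sum>r=1..<N. \<theta>1 r * ((\<Sum>i<n1. H r i) / sqrt (real n1)) + \<theta>2 r * ((\<Sum>i<n2. H r i) / sqrt (real n2)))
        = (\<Sum>i<n2. if i < n1 then \<xi>1 (T i \<omega>) else \<xi>2 (T i \<omega>))" .
    have ie: "(\<Prod>k\<in>A. iexp (f k)) = iexp (\<Sum>k\<in>A. f k)" if "finite A" for A :: "nat set" and f
      using that by (simp add: exp_sum sum_distrib_left)
    show ?thesis
      unfolding g_def H_def[symmetric] by (subst (1 2) ie) (simp_all only: finite_atLeastLessThan finite_lessThan e)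
  qed
  have indep: "indep_vars (\<lambda>_. borel) (\<lambda>i \<omega>. g i (T i \<omega>)) {..<n2}"
    by (rule indep_vars_compose2[OF indep_vars_subset[OF independent_trialsD(2)[OF tr]]])
      (auto simp: measurable_count_space_eq1)
  have "(\<integral>\<omega>. (\<Prod>i<n2. g i (T i \<omega>)) \<partial>M) = (\<Prod>i<n2. \<integral>\<omega>. g i (T i \<omega>) \<partial>M)"
  proof (rule indep_vars_lebesgue_integral[OF _ indep])
    show "integrable M (\<lambda>\<omega>. g i (T i \<omega>))" if "i \<in> {..<n2}" for i
      by (rule integrable_const_bound[of _ 1])
        (auto simp: g_def intro!: measurable_compose[OF independent_trialsD(3)[OF tr]] simp: measurable_count_space_eq1)
  qed simp
  also have "\<dots> = (\<Prod>i<n2. \<Sum>j=1..N. complex_of_real (p j) * g i j)"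
    by (simp only: integral_trial[OF tr])
  also have "\<dots> = (\<Sum>j=1..N. complex_of_real (p j) * iexp (\<xi>1 j)) ^ n1
      * (\<Sum>j=1..N. complex_of_real (p j) * iexp (\<xi>2 j)) ^ (n2 - n1)"
    unfolding splitp by (simp add: g_def)
  finally show ?thesis unfolding prodform \<xi>1_def \<xi>2_def .
qed

text \<open>
  By the isometry property the one-trial variances are squared norms of the coefficient vectors.
  The overlap of the two stages is what produces the correlation: the first stage contributes
  \<open>|\<theta>1 + c \<theta>2|\<^sup>2\<close> and the second \<open>(1 - c\<^sup>2) |\<theta>2|\<^sup>2\<close>.
\<close>

lemma two_stage_char_fun_limit:
  fixes \<theta>1 \<theta>2 :: "nat \<Rightarrow> real" and n1 n2 :: "nat \<Rightarrow> nat"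
  assumes N: "N \<ge> 1" and p: "\<And>j. j \<in> {1..N} \<Longrightarrow> p j > 0" "(\<Sum>j=1..N. p j) = 1"
    and n: "\<And>m. 0 < n1 m" "\<And>m. n1 m < n2 m" "filterlim n1 at_top sequentially"
      "(\<lambda>m. sqrt (real (n1 m) / real (n2 m))) \<longlonglongrightarrow> c"
  shows "(\<lambda>m. (\<Sum>j=1..N. complex_of_real (p j)
          * iexp (\<Sum>r=1..<N. (\<theta>1 r / sqrt (real (n1 m)) + \<theta>2 r / sqrt (real (n2 m))) * helmert p r j)) ^ n1 m
      * (\<Sum>j=1..N. complex_of_real (p j)
          * iexp (\<Sum>r=1..<N. (\<theta>2 r / sqrt (real (n2 m))) * helmert p r j)) ^ (n2 m - n1 m))
    \<longlonglongrightarrow> of_real (exp (- (\<Sum>r=1..<N. (\<theta>1 r)\<^sup>2 + 2 * c * \<theta>1 r * \<theta>2 r + (\<theta>2 r)\<^sup>2) / 2))"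
proof -
  have mean: "(\<Sum>j=1..N. p j * (\<Sum>r=1..<N. \<theta> r * helmert p r j)) = 0" for \<theta>
  proof -
    have "(\<Sum>j=1..N. p j * (\<Sum>r=1..<N. \<theta> r * helmert p r j)) = (\<Sum>r=1..<N. \<theta> r * (\<Sum>j=1..N. p j * helmert p r j))"
      unfolding sum_distrib_left by (subst sum.swap) (simp add: mult_ac)
    also have "\<dots> = (\<Sum>r=1..<N. \<theta> r * 0)"
    proof (rule sum.cong[OF refl])
      fix r assume "r \<in> {1..<N}"
      then have "(\<Sum>j=1..N. p j * helmert p r j) = 0"
        using p by (intro helmert_mean_zero) auto
      then show "\<theta> r * (\<Sum>j=1..N. p j * helmert p r j) = \<theta> r * 0" by simp
    qed
    finally show ?thesis by simp
  qed
  have n2pos: "0 < n2 m" for m using n(2)[of m] by linarith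
  have inv1: "(\<lambda>m. inverse (real (n1 m))) \<longlonglongrightarrow> 0"
    by (rule filterlim_compose[OF tendsto_inverse_0_at_top filterlim_compose[OF filterlim_real_sequentially n(3)]])
       (rule filterlim_ident)
  have n2top: "filterlim n2 at_top sequentially"
    by (rule filterlim_at_top_mono[OF n(3)]) (intro always_eventually allI less_imp_le n(2))
  have inv2: "(\<lambda>m. inverse (real (n2 m))) \<longlonglongrightarrow> 0"
    by (rule filterlim_compose[OF tendsto_inverse_0_at_top filterlim_compose[OF filterlim_real_sequentially n2top]])
       (rule filterlim_ident)
  have rat: "(\<lambda>m. real (n1 m) / real (n2 m)) \<longlonglongrightarrow> c\<^sup>2"
  proof -
    have "(\<lambda>m. (sqrt (real (n1 m) / real (n2 m)))\<^sup>2) \<longlonglongrightarrow> c\<^sup>2" by (intro tendsto_intros n)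
    then show ?thesis by simp
  qed
  define Q1 where "Q1 m = (\<Sum>r=1..<N. (\<theta>1 r / sqrt (real (n1 m)) + \<theta>2 r / sqrt (real (n2 m)))\<^sup>2)" for m
  define Q2 where "Q2 m = (\<Sum>r=1..<N. (\<theta>2 r / sqrt (real (n2 m)))\<^sup>2)" for m
  define \<tau>1 where "\<tau>1 = (\<Sum>r=1..<N. (\<theta>1 r + \<theta>2 r * c)\<^sup>2)"
  define \<tau>2 where "\<tau>2 = (\<Sum>r=1..<N. (\<theta>2 r)\<^sup>2) * (1 - c\<^sup>2)"
  have Q1: "real (n1 m) * Q1 m = (\<Sum>r=1..<N. (\<theta>1 r + \<theta>2 r * sqrt (real (n1 m) / real (n2 m)))\<^sup>2)" for m
    unfolding Q1_def sum_distrib_left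
  proof (rule sum.cong[OF refl])
    fix r
    have "real (n1 m) * (\<theta>1 r / sqrt (real (n1 m)) + \<theta>2 r / sqrt (real (n2 m)))\<^sup>2
       = (sqrt (real (n1 m)) * (\<theta>1 r / sqrt (real (n1 m)) + \<theta>2 r / sqrt (real (n2 m))))\<^sup>2"
      by (simp add: power_mult_distrib)
    also have "sqrt (real (n1 m)) * (\<theta>1 r / sqrt (real (n1 m)) + \<theta>2 r / sqrt (real (n2 m)))
        = \<theta>1 r + \<theta>2 r * sqrt (real (n1 m) / real (n2 m))"
      using n(1)[of m] by (simp add: distrib_left real_sqrt_divide)
    finally show "real (n1 m) * (\<theta>1 r / sqrt (real (n1 m)) + \<theta>2 r / sqrt (real (n2 m)))\<^sup>2
       = (\<theta>1 r + \<theta>2 r * sqrt (real (n1 m) / real (n2 m)))\<^sup>2" .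
  qed
  have Q2: "Q2 m = (\<Sum>r=1..<N. (\<theta>2 r)\<^sup>2) * inverse (real (n2 m))" for m
    unfolding Q2_def sum_distrib_right by (simp add: power_divide field_simps)
  have l1: "(\<lambda>m. real (n1 m) * Q1 m) \<longlonglongrightarrow> \<tau>1"
    unfolding Q1 \<tau>1_def by (intro tendsto_intros n)
  have "(\<lambda>m. (real (n1 m) * Q1 m) * inverse (real (n1 m))) \<longlonglongrightarrow> \<tau>1 * 0"
    by (intro tendsto_mult l1 inv1)
  moreover have "(real (n1 m) * Q1 m) * inverse (real (n1 m)) = Q1 m" for m using n(1)[of m] by simp
  ultimately have z1: "Q1 \<longlonglongrightarrow> 0" by simp
  have "Q2 = (\<lambda>m. (\<Sum>r=1..<N. (\<theta>2 r)\<^sup>2) * inverse (real (n2 m)))" by (rule ext) (rule Q2)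
  then have z2: "Q2 \<longlonglongrightarrow> 0"
    using tendsto_mult[OF tendsto_const inv2, of "(\<Sum>r=1..<N. (\<theta>2 r)\<^sup>2)"] by simp
  have l2: "(\<lambda>m. real (n2 m - n1 m) * Q2 m) \<longlonglongrightarrow> \<tau>2"
  proof -
    have "real (n2 m - n1 m) * Q2 m = (\<Sum>r=1..<N. (\<theta>2 r)\<^sup>2) * (1 - real (n1 m) / real (n2 m))" for m
      using n(2)[of m] n2pos[of m] unfolding Q2 by (simp add: of_nat_diff field_simps)
    then show ?thesis unfolding \<tau>2_def by (simp only:) (intro tendsto_intros rat)
  qed
  have iso1: "(\<Sum>j=1..N. p j * (\<Sum>r=1..<N. (\<theta>1 r / sqrt (real (n1 m)) + \<theta>2 r / sqrt (real (n2 m))) * helmert p r j)\<^sup>2) = Q1 m" for m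
    unfolding Q1_def by (rule helmert_isometry[OF N p(1)])
  have iso2: "(\<Sum>j=1..N. p j * (\<Sum>r=1..<N. (\<theta>2 r / sqrt (real (n2 m))) * helmert p r j)\<^sup>2) = Q2 m" for m
    unfolding Q2_def by (rule helmert_isometry[OF N p(1)])
  have "(\<lambda>m. (\<Sum>j=1..N. complex_of_real (p j)
          * iexp (\<Sum>r=1..<N. (\<theta>1 r / sqrt (real (n1 m)) + \<theta>2 r / sqrt (real (n2 m))) * helmert p r j)) ^ n1 m)
      \<longlonglongrightarrow> exp (- of_real \<tau>1 / 2)"
    by (rule char_fun_power_limit[where Q=Q1, OF p mean iso1 z1 l1])
  moreover have "(\<lambda>m. (\<Sum>j=1..N. complex_of_real (p j)
          * iexp (\<Sum>r=1..<N. (\<theta>2 r / sqrt (real (n2 m))) * helmert p r j)) ^ (n2 m - n1 m))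
      \<longlonglongrightarrow> exp (- of_real \<tau>2 / 2)"
    by (rule char_fun_power_limit[where Q=Q2, OF p mean iso2 z2 l2])
  ultimately have "(\<lambda>m. (\<Sum>j=1..N. complex_of_real (p j)
          * iexp (\<Sum>r=1..<N. (\<theta>1 r / sqrt (real (n1 m)) + \<theta>2 r / sqrt (real (n2 m))) * helmert p r j)) ^ n1 m
      * (\<Sum>j=1..N. complex_of_real (p j)
          * iexp (\<Sum>r=1..<N. (\<theta>2 r / sqrt (real (n2 m))) * helmert p r j)) ^ (n2 m - n1 m))
      \<longlonglongrightarrow> exp (- of_real \<tau>1 / 2) * exp (- of_real \<tau>2 / 2)"
    by (rule tendsto_mult)
  also have "exp (- of_real \<tau>1 / 2) * exp (- of_real \<tau>2 / 2) = complex_of_real (exp (- (\<tau>1 + \<tau>2) / 2))"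
  proof -
    have "- (\<tau>1 + \<tau>2) / 2 = - \<tau>1 / 2 + - \<tau>2 / 2" by simp
    then show ?thesis by (simp only: exp_add exp_of_real of_real_mult of_real_minus of_real_divide of_real_numeral flip: exp_of_real)
  qed
  also have "\<tau>1 + \<tau>2 = (\<Sum>r=1..<N. (\<theta>1 r)\<^sup>2 + 2 * c * \<theta>1 r * \<theta>2 r + (\<theta>2 r)\<^sup>2)"
    unfolding \<tau>1_def \<tau>2_def sum_distrib_right sum.distrib[symmetric]
    by (intro sum.cong refl) (simp add: power2_eq_square algebra_simps)
  finally show ?thesis .
qed

text \<open>
  Linearise with Gaussian variables, exchange the two expectations, and pass to the limit inside the
  Gaussian average, where every integrand has modulus at most one. The limit factorises over the
  \<open>N - 1\<close> contrasts.
\<close>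

lemma pearson_laplace_limit:
  fixes n1 n2 :: "nat \<Rightarrow> nat"
  assumes N: "N \<ge> 1" and p: "\<And>j. j \<in> {1..N} \<Longrightarrow> p j > 0" "(\<Sum>j=1..N. p j) = 1"
    and tr: "independent_trials M N p T"
    and c: "0 \<le> c" "c \<le> 1"
    and n: "\<And>m. 0 < n1 m" "\<And>m. n1 m < n2 m" "filterlim n1 at_top sequentially"
      "(\<lambda>m. sqrt (real (n1 m) / real (n2 m))) \<longlonglongrightarrow> c"
    and ab: "a \<ge> 0" "b \<ge> 0"
  shows "(\<lambda>m. \<integral>\<omega>. exp (- a * pearson N p T (n1 m) \<omega> - b * pearson N p T (n2 m) \<omega>) \<partial>M)
    \<longlonglongrightarrow> ((1 + 2 * a) * (1 + 2 * b) - 4 * a * b * c\<^sup>2) powr (- (real N - 1) / 2)"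
proof -
  define I where "I = {1..<N}"
  have I: "finite I" by (simp add: I_def)
  define \<Gamma> where "\<Gamma> = Pi\<^sub>M I (\<lambda>_. std_normal_pair)"
  define S where "S n r \<omega> = (\<Sum>i<n. helmert p r (T i \<omega>)) / sqrt (real n)" for n r \<omega>
  define F where "F m z \<omega> = (\<Prod>r\<in>I. iexp (sqrt (2 * a) * S (n1 m) r \<omega> * fst (z r)
       + sqrt (2 * b) * S (n2 m) r \<omega> * snd (z r)))" for m and z :: "nat \<Rightarrow> real \<times> real" and \<omega>
  interpret M: prob_space M by (rule independent_trialsD[OF tr])
  interpret G: prob_space std_normal_pair by (rule prob_space_std_normal_pair)
  interpret \<Gamma>: prob_space \<Gamma> unfolding \<Gamma>_def by (intro prob_space_PiM prob_space_std_normal_pair)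
  interpret P: pair_prob_space \<Gamma> M ..
  interpret product_sigma_finite "\<lambda>_::nat. std_normal_pair"
    by (intro product_sigma_finite.intro prob_space_imp_sigma_finite prob_space_std_normal_pair)
  have Smeas[measurable]: "S n r \<in> borel_measurable M" for n r
    unfolding S_def
    by (intro borel_measurable_divide borel_measurable_sum trial_measurable[OF tr] borel_measurable_const)
  have comp: "(\<lambda>x. (fst x) r) \<in> measurable (\<Gamma> \<Otimes>\<^sub>M M) std_normal_pair" if "r \<in> I" for r
    unfolding \<Gamma>_def using that by measurable
  have fstm: "(\<lambda>x. fst ((fst x) r)) \<in> borel_measurable (\<Gamma> \<Otimes>\<^sub>M M)" 
    and sndm: "(\<lambda>x. snd ((fst x) r)) \<in> borel_measurable (\<Gamma> \<Otimes>\<^sub>M M)" if "r \<in> I" for r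
    by (auto intro!: measurable_compose[OF comp[OF that]])
  have Fmeas: "(\<lambda>x. F m (fst x) (snd x)) \<in> borel_measurable (\<Gamma> \<Otimes>\<^sub>M M)" for m
    unfolding F_def
    by (intro borel_measurable_prod borel_measurable_exp measurable_compose[of _ _ borel exp]
        borel_measurable_times borel_measurable_const borel_measurable_add
        measurable_compose[OF _ borel_measurable_of_real] fstm sndm
        measurable_compose[OF measurable_snd Smeas])
  have Fmeas': "case_prod (F m) \<in> borel_measurable (\<Gamma> \<Otimes>\<^sub>M M)" for m
    using Fmeas[of m] by (simp add: case_prod_unfold)
  have normF: "cmod (F m z \<omega>) = 1" for m z \<omega>
    unfolding F_def by (simp add: prod_norm[symmetric])
  have X: "pearson N p T n \<omega> = (\<Sum>r\<in>I. (S n r \<omega>)\<^sup>2)" if "n > 0" "\<omega> \<in> space M" for n \<omega>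
    unfolding S_def I_def
    by (rule pearson_eq_helmert_norm[OF N p that(1)])
      (use measurable_space[OF independent_trialsD(3)[OF tr] that(2)] in auto)
  have swap: "complex_of_real (\<integral>\<omega>. exp (- a * pearson N p T (n1 m) \<omega> - b * pearson N p T (n2 m) \<omega>) \<partial>M)
      = (\<integral>z. \<integral>\<omega>. F m z \<omega> \<partial>M \<partial>\<Gamma>)" for m
  proof -
    have "complex_of_real (\<integral>\<omega>. exp (- a * pearson N p T (n1 m) \<omega> - b * pearson N p T (n2 m) \<omega>) \<partial>M)
      = (\<integral>\<omega>. complex_of_real (exp (- a * pearson N p T (n1 m) \<omega> - b * pearson N p T (n2 m) \<omega>)) \<partial>M)"
      by (rule integral_complex_of_real[symmetric])
    also have "\<dots> = (\<integral>\<omega>. \<integral>z. F m z \<omega> \<partial>\<Gamma> \<partial>M)"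
    proof (intro Bochner_Integration.integral_cong refl)
      fix \<omega> assume w: "\<omega> \<in> space M"
      have "n2 m > 0" using n(1,2)[of m] by linarith
      then show "complex_of_real (exp (- a * pearson N p T (n1 m) \<omega> - b * pearson N p T (n2 m) \<omega>)) = (\<integral>z. F m z \<omega> \<partial>\<Gamma>)"
        unfolding F_def \<Gamma>_def hubbard_stratonovich_vector[OF I ab] using w n(1)[of m] by (simp only: X)
    qed
    also have "\<dots> = (\<integral>z. \<integral>\<omega>. F m z \<omega> \<partial>M \<partial>\<Gamma>)"
      by (rule P.Fubini_integral, rule P.integrable_const_bound[of _ 1]) (auto simp: normF Fmeas')
    finally show ?thesis .
  qed
  define q where "q y = exp (- (a * (fst y)\<^sup>2 + 2 * c * sqrt (a * b) * fst y * snd y + b * (snd y)\<^sup>2))"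
    for y :: "real \<times> real"
  have "(\<lambda>m. \<integral>z. \<integral>\<omega>. F m z \<omega> \<partial>M \<partial>\<Gamma>) \<longlonglongrightarrow> (\<integral>z. (\<Prod>r\<in>I. complex_of_real (q (z r))) \<partial>\<Gamma>)"
  proof (rule integral_dominated_convergence[where w="\<lambda>_. 1"])
    have "(\<lambda>x. x r) \<in> measurable \<Gamma> std_normal_pair" if "r \<in> I" for r
      unfolding \<Gamma>_def using that by measurable
    moreover have "(\<lambda>y. complex_of_real (q y)) \<in> borel_measurable std_normal_pair"
      unfolding q_def by measurable
    ultimately show "(\<lambda>z. \<Prod>r\<in>I. complex_of_real (q (z r))) \<in> borel_measurable \<Gamma>"
      by (auto intro!: borel_measurable_prod intro: measurable_compose)
    show "(\<lambda>z. \<integral>\<omega>. F m z \<omega> \<partial>M) \<in> borel_measurable \<Gamma>" for m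
      by (rule M.borel_measurable_lebesgue_integral[OF Fmeas'])
    show "AE z in \<Gamma>. cmod (\<integral>\<omega>. F m z \<omega> \<partial>M) \<le> 1" for m
    proof (intro AE_I2)
      fix z
      have "cmod (\<integral>\<omega>. F m z \<omega> \<partial>M) \<le> (\<integral>\<omega>. cmod (F m z \<omega>) \<partial>M)" by simp
      then show "cmod (\<integral>\<omega>. F m z \<omega> \<partial>M) \<le> 1" by (simp add: normF M.prob_space)
    qed
    show "AE z in \<Gamma>. (\<lambda>m. \<integral>\<omega>. F m z \<omega> \<partial>M) \<longlonglongrightarrow> (\<Prod>r\<in>I. complex_of_real (q (z r)))"
    proof (intro AE_I2)
      fix z :: "nat \<Rightarrow> real \<times> real"
      define \<theta>1 where "\<theta>1 r = sqrt (2 * a) * fst (z r)" for r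
      define \<theta>2 where "\<theta>2 r = sqrt (2 * b) * snd (z r)" for r
      have "F m z \<omega> = (\<Prod>r\<in>{1..<N}. iexp (\<theta>1 r * ((\<Sum>i<n1 m. helmert p r (T i \<omega>)) / sqrt (real (n1 m)))
             + \<theta>2 r * ((\<Sum>i<n2 m. helmert p r (T i \<omega>)) / sqrt (real (n2 m)))))" for m \<omega>
        unfolding F_def S_def I_def \<theta>1_def \<theta>2_def by (intro prod.cong refl) (simp only: mult_ac)
      then have "(\<lambda>m. \<integral>\<omega>. F m z \<omega> \<partial>M) \<longlonglongrightarrow>
          of_real (exp (- (\<Sum>r=1..<N. (\<theta>1 r)\<^sup>2 + 2 * c * \<theta>1 r * \<theta>2 r + (\<theta>2 r)\<^sup>2) / 2))"
        using two_stage_char_fun_limit[OF N p n, of \<theta>1 \<theta>2]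
        by (simp only: two_stage_char_fun[OF tr n(1) n(2)])
      also have "exp (- (\<Sum>r=1..<N. (\<theta>1 r)\<^sup>2 + 2 * c * \<theta>1 r * \<theta>2 r + (\<theta>2 r)\<^sup>2) / 2)
          = (\<Prod>r\<in>I. q (z r))"
      proof -
        have "- (\<Sum>r=1..<N. (\<theta>1 r)\<^sup>2 + 2 * c * \<theta>1 r * \<theta>2 r + (\<theta>2 r)\<^sup>2) / 2
          = (\<Sum>r\<in>I. - (a * (fst (z r))\<^sup>2 + 2 * c * sqrt (a * b) * fst (z r) * snd (z r) + b * (snd (z r))\<^sup>2))"
          unfolding sum_negf[symmetric] sum_divide_distrib I_def
        proof (rule sum.cong[OF refl])
          fix r
          have s: "sqrt (2 * a) * sqrt (2 * b) = 2 * sqrt (a * b)"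
            by (simp add: real_sqrt_mult)
          have "\<theta>1 r * \<theta>2 r = (sqrt (2 * a) * sqrt (2 * b)) * fst (z r) * snd (z r)"
            unfolding \<theta>1_def \<theta>2_def by simp
          then have "\<theta>1 r * \<theta>2 r = 2 * sqrt (a * b) * fst (z r) * snd (z r)" unfolding s .
          moreover have "(\<theta>1 r)\<^sup>2 = 2 * a * (fst (z r))\<^sup>2" "(\<theta>2 r)\<^sup>2 = 2 * b * (snd (z r))\<^sup>2"
            unfolding \<theta>1_def \<theta>2_def using ab by (simp_all add: power_mult_distrib)
          ultimately show "- ((\<theta>1 r)\<^sup>2 + 2 * c * \<theta>1 r * \<theta>2 r + (\<theta>2 r)\<^sup>2) / 2
             = - (a * (fst (z r))\<^sup>2 + 2 * c * sqrt (a * b) * fst (z r) * snd (z r) + b * (snd (z r))\<^sup>2)"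
            by (simp add: mult.assoc)
        qed
        then show ?thesis unfolding q_def by (simp only: exp_sum[OF I])
      qed
      finally show "(\<lambda>m. \<integral>\<omega>. F m z \<omega> \<partial>M) \<longlonglongrightarrow> (\<Prod>r\<in>I. complex_of_real (q (z r)))"
        by (simp only: of_real_prod)
    qed
  qed simp
  also have "(\<integral>z. (\<Prod>r\<in>I. complex_of_real (q (z r))) \<partial>\<Gamma>) = (\<Prod>r\<in>I. \<integral>y. complex_of_real (q y) \<partial>std_normal_pair)"
    unfolding \<Gamma>_def
  proof (rule product_integral_prod[OF I])
    show "integrable std_normal_pair (\<lambda>y. complex_of_real (q y))" for i :: nat
      by (rule G.integrable_const_bound[of _ 1])
        (use quadratic_form_nonneg[OF ab c] in \<open>auto simp: q_def simp del: minus_add_distrib\<close>)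
  qed
  also have "\<dots> = (\<Prod>r\<in>I. complex_of_real (((1 + 2 * a) * (1 + 2 * b) - 4 * a * b * c\<^sup>2) powr (- 1 / 2)))"
    unfolding integral_complex_of_real q_def gaussian_pair_quadratic[OF ab c] ..
  also have "\<dots> = of_real (((1 + 2 * a) * (1 + 2 * b) - 4 * a * b * c\<^sup>2) powr (- (real N - 1) / 2))"
  proof -
    have "card I = N - 1" by (simp add: I_def)
    moreover have "0 < (1 + 2 * a) * (1 + 2 * b) - 4 * a * b * c\<^sup>2"
    proof -
      have "c\<^sup>2 * (a * b) \<le> 1 * (a * b)"
        using ab c by (intro mult_right_mono) (auto simp: power_le_one)
      then have "4 * a * b * c\<^sup>2 \<le> 4 * a * b" by (simp add: mult_ac)
      then show ?thesis using ab by (simp add: algebra_simps add_pos_nonneg)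
    qed
    moreover have "real (N - 1) * (- 1 / 2) = - (real N - 1) / 2"
      using N by (simp add: of_nat_diff field_simps)
    ultimately show ?thesis
      by (simp only: prod_constant of_real_power[symmetric] powr_power less_imp_neq[symmetric] not_False_eq_True)
  qed
  finally show ?thesis
    unfolding swap[symmetric] tendsto_of_real_iff .
qed

section \<open>Rectangle probabilities from moments on the unit square\<close>

text \<open>
  Uniform approximation of both factors by polynomials on the unit interval reduces the claim to the
  mixed moments.
\<close>

lemma product_expectation_limit_from_moments:
  fixes A B :: "nat \<Rightarrow> 'a \<Rightarrow> real" and U V :: "'b \<Rightarrow> real"
  assumes M: "prob_space M" and L: "prob_space L"
    and meas[measurable]: "\<And>n. A n \<in> borel_measurable M" "\<And>n. B n \<in> borel_measurable M"
      "U \<in> borel_measurable L" "V \<in> borel_measurable L"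
    and range: "\<And>n \<omega>. A n \<omega> \<in> {0..1}" "\<And>n \<omega>. B n \<omega> \<in> {0..1}" "\<And>x. U x \<in> {0..1}" "\<And>x. V x \<in> {0..1}"
    and moments: "\<And>i j. (\<lambda>n. \<integral>\<omega>. A n \<omega> ^ i * B n \<omega> ^ j \<partial>M) \<longlonglongrightarrow> (\<integral>x. U x ^ i * V x ^ j \<partial>L)"
    and cont: "continuous_on UNIV \<phi>" "continuous_on UNIV \<psi>"
    and bound: "\<And>x. \<bar>\<phi> x\<bar> \<le> (1::real)" "\<And>x. \<bar>\<psi> x\<bar> \<le> (1::real)"
  shows "(\<lambda>n. \<integral>\<omega>. \<phi> (A n \<omega>) * \<psi> (B n \<omega>) \<partial>M) \<longlonglongrightarrow> (\<integral>x. \<phi> (U x) * \<psi> (V x) \<partial>L)"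
proof (rule LIMSEQ_I)
  fix r :: real assume r: "r > 0"
  interpret M: prob_space M by fact
  interpret L: prob_space L by fact
  note [measurable] = borel_measurable_continuous_onI[OF cont(1)] borel_measurable_continuous_onI[OF cont(2)]
  \<comment> \<open>The approximation costs \<open>3 e\<close> on each side and the moments cost \<open>e\<close>, which is below \<open>9 e \<le> r\<close>.\<close>
  define e where "e = min 1 (r / 9)"
  have e: "e > 0" "e \<le> 1" "9 * e \<le> r" using r by (auto simp: e_def)
  obtain P where P: "real_polynomial_function P" "\<And>x. x \<in> {0..1} \<Longrightarrow> \<bar>\<phi> x - P x\<bar> < e"
    by (rule Stone_Weierstrass_real_polynomial_function[of "{0..1}" \<phi> e])
      (use e continuous_on_subset[OF cont(1)] in auto)
  obtain Q where Q: "real_polynomial_function Q" "\<And>x. x \<in> {0..1} \<Longrightarrow> \<bar>\<psi> x - Q x\<bar> < e"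
    by (rule Stone_Weierstrass_real_polynomial_function[of "{0..1}" \<psi> e])
      (use e continuous_on_subset[OF cont(2)] in auto)
  have [measurable]: "P \<in> borel_measurable borel" "Q \<in> borel_measurable borel"
    using P(1) Q(1) by (auto intro!: borel_measurable_continuous_onI continuous_on_polymonial_function
        simp: real_polynomial_function_eq)
  obtain a k where a: "P = (\<lambda>x. \<Sum>i\<le>k. a i * x ^ i)" using P(1) by (auto simp: real_polynomial_function_iff_sum)
  obtain b l where b: "Q = (\<lambda>x. \<Sum>i\<le>l. b i * x ^ i)" using Q(1) by (auto simp: real_polynomial_function_iff_sum)
  have diff: "\<bar>\<phi> x * \<psi> y - P x * Q y\<bar> \<le> 3 * e" if "x \<in> {0..1}" "y \<in> {0..1}" for x y
  proof -
    have Qb: "\<bar>Q y\<bar> \<le> 1 + e" using Q(2)[OF that(2)] bound(2)[of y] by linarith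
    have "\<phi> x * \<psi> y - P x * Q y = \<phi> x * (\<psi> y - Q y) + (\<phi> x - P x) * Q y" by (simp add: algebra_simps)
    then have "\<bar>\<phi> x * \<psi> y - P x * Q y\<bar> \<le> \<bar>\<phi> x\<bar> * \<bar>\<psi> y - Q y\<bar> + \<bar>\<phi> x - P x\<bar> * \<bar>Q y\<bar>"
      by (metis abs_mult abs_triangle_ineq)
    also have "\<dots> \<le> 1 * e + e * (1 + e)"
      using bound(1)[of x] P(2)[OF that(1)] Q(2)[OF that(2)] Qb by (intro add_mono mult_mono) auto
    also have "\<dots> \<le> 3 * e" using e by (simp add: algebra_simps mult_left_le)
    finally show ?thesis .
  qed
  have mb: "\<bar>x ^ i * y ^ j\<bar> \<le> 1" if "x \<in> {0..1}" "y \<in> {0..1}" for x y :: real and i j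
    using that by (auto simp: abs_mult power_abs intro!: mult_le_one power_le_one)
  have intM: "integrable M (\<lambda>\<omega>. A n \<omega> ^ i * B n \<omega> ^ j)" for n i j
    by (rule M.integrable_const_bound[of _ 1]) (use mb[OF range(1) range(2)] in auto)
  have intL: "integrable L (\<lambda>x. U x ^ i * V x ^ j)" for i j
    by (rule L.integrable_const_bound[of _ 1]) (use mb[OF range(3) range(4)] in auto)
  have expand: "P x * Q y = (\<Sum>i\<le>k. \<Sum>j\<le>l. a i * b j * (x ^ i * y ^ j))" for x y
    unfolding a b sum_product by (simp add: mult_ac)
  have PQM: "integrable M (\<lambda>\<omega>. P (A n \<omega>) * Q (B n \<omega>))" for n
    unfolding expand by (intro Bochner_Integration.integrable_sum integrable_mult_right intM)
  have PQL: "integrable L (\<lambda>x. P (U x) * Q (V x))"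
    unfolding expand by (intro Bochner_Integration.integrable_sum integrable_mult_right intL)
  have fM: "integrable M (\<lambda>\<omega>. \<phi> (A n \<omega>) * \<psi> (B n \<omega>))" for n
    by (rule M.integrable_const_bound[of _ 1]) (auto simp: abs_mult intro!: mult_le_one bound)
  have fL: "integrable L (\<lambda>x. \<phi> (U x) * \<psi> (V x))"
    by (rule L.integrable_const_bound[of _ 1]) (auto simp: abs_mult intro!: mult_le_one bound)
  have "(\<lambda>n. \<integral>\<omega>. P (A n \<omega>) * Q (B n \<omega>) \<partial>M) \<longlonglongrightarrow> (\<integral>x. P (U x) * Q (V x) \<partial>L)"
  proof -
    have "(\<integral>\<omega>. P (A n \<omega>) * Q (B n \<omega>) \<partial>M) = (\<Sum>i\<le>k. \<Sum>j\<le>l. a i * b j * (\<integral>\<omega>. A n \<omega> ^ i * B n \<omega> ^ j \<partial>M))" for n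
      unfolding expand by (simp add: Bochner_Integration.integral_sum Bochner_Integration.integrable_sum intM)
    moreover have "(\<integral>x. P (U x) * Q (V x) \<partial>L) = (\<Sum>i\<le>k. \<Sum>j\<le>l. a i * b j * (\<integral>x. U x ^ i * V x ^ j \<partial>L))"
      unfolding expand by (simp add: Bochner_Integration.integral_sum Bochner_Integration.integrable_sum intL)
    ultimately show ?thesis
      by (simp only:) (intro tendsto_sum tendsto_mult tendsto_const moments)
  qed
  then obtain n0 where n0: "\<And>n. n \<ge> n0 \<Longrightarrow>
      \<bar>(\<integral>\<omega>. P (A n \<omega>) * Q (B n \<omega>) \<partial>M) - (\<integral>x. P (U x) * Q (V x) \<partial>L)\<bar> < e"
    using e(1) unfolding LIMSEQ_iff real_norm_def by blast
  have dM: "\<bar>(\<integral>\<omega>. \<phi> (A n \<omega>) * \<psi> (B n \<omega>) \<partial>M) - (\<integral>\<omega>. P (A n \<omega>) * Q (B n \<omega>) \<partial>M)\<bar> \<le> 3 * e" for n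
  proof -
    have "\<bar>\<integral>\<omega>. \<phi> (A n \<omega>) * \<psi> (B n \<omega>) - P (A n \<omega>) * Q (B n \<omega>) \<partial>M\<bar>
        \<le> (\<integral>\<omega>. \<bar>\<phi> (A n \<omega>) * \<psi> (B n \<omega>) - P (A n \<omega>) * Q (B n \<omega>)\<bar> \<partial>M)"
      by (rule integral_abs_bound)
    also have "\<dots> \<le> (\<integral>\<omega>. 3 * e \<partial>M)"
      by (intro integral_mono) (use diff range fM PQM in auto)
    finally show ?thesis using fM PQM by (simp add: M.prob_space)
  qed
  have dL: "\<bar>(\<integral>x. \<phi> (U x) * \<psi> (V x) \<partial>L) - (\<integral>x. P (U x) * Q (V x) \<partial>L)\<bar> \<le> 3 * e"
  proof -
    have "\<bar>\<integral>x. \<phi> (U x) * \<psi> (V x) - P (U x) * Q (V x) \<partial>L\<bar>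
        \<le> (\<integral>x. \<bar>\<phi> (U x) * \<psi> (V x) - P (U x) * Q (V x)\<bar> \<partial>L)"
      by (rule integral_abs_bound)
    also have "\<dots> \<le> (\<integral>x. 3 * e \<partial>L)"
      by (intro integral_mono) (use diff range fL PQL in auto)
    finally show ?thesis using fL PQL by (simp add: L.prob_space)
  qed
  show "\<exists>n0. \<forall>n\<ge>n0. norm ((\<integral>\<omega>. \<phi> (A n \<omega>) * \<psi> (B n \<omega>) \<partial>M) - (\<integral>x. \<phi> (U x) * \<psi> (V x) \<partial>L)) < r"
  proof (intro exI allI impI)
    fix n assume "n \<ge> n0"
    from n0[OF this] dM[of n] dL e show "norm ((\<integral>\<omega>. \<phi> (A n \<omega>) * \<psi> (B n \<omega>) \<partial>M) - (\<integral>x. \<phi> (U x) * \<psi> (V x) \<partial>L)) < r"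
      unfolding real_norm_def abs_le_iff abs_less_iff by linarith
  qed
qed

lemma cts_step_shrink_right:
  "(\<lambda>k. cts_step s (s + 1 / real (Suc k)) x) \<longlonglongrightarrow> indicator {..s} x"
proof (cases "x \<le> s")
  case False
  have "eventually (\<lambda>k. 1 / real (Suc k) < x - s) sequentially"
    using LIMSEQ_Suc[OF lim_1_over_n] False by (intro order_tendstoD) auto
  then have "eventually (\<lambda>k. cts_step s (s + 1 / real (Suc k)) x = 0) sequentially"
    by eventually_elim (use False in \<open>auto simp: cts_step_def simp del: of_nat_Suc\<close>)
  then show ?thesis using False by (simp add: tendsto_eventually)
qed (simp add: cts_step_def)

lemma cts_step_shrink_left:
  "(\<lambda>k. cts_step (s - 1 / real (Suc k)) s x) \<longlonglongrightarrow> indicator {..<s} x"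
proof (cases "x < s")
  case True
  have "eventually (\<lambda>k. 1 / real (Suc k) < s - x) sequentially"
    using LIMSEQ_Suc[OF lim_1_over_n] True by (intro order_tendstoD) auto
  then have "eventually (\<lambda>k. cts_step (s - 1 / real (Suc k)) s x = 1) sequentially"
    by eventually_elim (use True in \<open>auto simp: cts_step_def simp del: of_nat_Suc\<close>)
  then show ?thesis using True by (simp add: tendsto_eventually)
next
  case False
  have "cts_step (s - 1 / real (Suc k)) s x = 0" for k
  proof -
    have "0 < 1 / real (Suc k)" by simp
    then have "\<not> x \<le> s - 1 / real (Suc k)" using False by linarith
    then show ?thesis using False unfolding cts_step_def by (simp del: of_nat_Suc)
  qed
  then show ?thesis using False by simp
qed

lemma cts_step_range: "a < b \<Longrightarrow> 0 \<le> cts_step a b x \<and> cts_step a b x \<le> 1"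
  by (auto simp: cts_step_def divide_simps)

text \<open>
  The indicator of a half line is squeezed between continuous steps; since the limit law does not
  charge the boundary, shrinking the steps makes both bounds meet.
\<close>

lemma rectangle_limit_from_moments:
  fixes A B :: "nat \<Rightarrow> 'a \<Rightarrow> real" and U V :: "'b \<Rightarrow> real"
  assumes M: "prob_space M" and L: "prob_space L"
    and meas[measurable]: "\<And>n. A n \<in> borel_measurable M" "\<And>n. B n \<in> borel_measurable M"
      "U \<in> borel_measurable L" "V \<in> borel_measurable L"
    and range: "\<And>n \<omega>. A n \<omega> \<in> {0..1}" "\<And>n \<omega>. B n \<omega> \<in> {0..1}" "\<And>x. U x \<in> {0..1}" "\<And>x. V x \<in> {0..1}"
    and moments: "\<And>i j. (\<lambda>n. \<integral>\<omega>. A n \<omega> ^ i * B n \<omega> ^ j \<partial>M) \<longlonglongrightarrow> (\<integral>x. U x ^ i * V x ^ j \<partial>L)"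
    and boundary: "AE x in L. U x \<noteq> s" "AE x in L. V x \<noteq> t"
  shows "(\<lambda>n. measure M {\<omega> \<in> space M. A n \<omega> < s \<and> B n \<omega> < t}) \<longlonglongrightarrow> measure L {x \<in> space L. U x < s \<and> V x < t}"
proof -
  interpret M: prob_space M by fact
  interpret L: prob_space L by fact
  define up where "up s k = cts_step s (s + 1 / real (Suc k))" for s k
  define lo where "lo s k = cts_step (s - 1 / real (Suc k)) s" for s k
  have cont: "continuous_on UNIV (up s k)" "continuous_on UNIV (lo s k)" for s k
    unfolding up_def lo_def
    by (intro uniformly_continuous_imp_continuous cts_step_uniformly_continuous; simp)+
  have [measurable]: "up s k \<in> borel_measurable borel" "lo s k \<in> borel_measurable borel" for s k
    by (intro borel_measurable_continuous_onI cont)+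
  have rg: "0 \<le> up s k x" "up s k x \<le> 1" "0 \<le> lo s k x" "lo s k x \<le> 1" for s k x
    unfolding up_def lo_def using cts_step_range by (auto simp del: of_nat_Suc)
  have ab: "\<bar>up s k x\<bar> \<le> 1" "\<bar>lo s k x\<bar> \<le> 1" for s k x using rg by (auto simp: abs_le_iff intro: order_trans[of _ 0])
  have upper: "indicator {..<s} x \<le> up s k x" for s x k
    using rg(1)[of s k x] by (auto simp: up_def cts_step_def indicator_def simp del: of_nat_Suc)
  have lower: "lo s k x \<le> indicator {..<s} x" for s x k
  proof (cases "x < s")
    case False
    have "0 < 1 / real (Suc k)" by simp
    then have "\<not> x \<le> s - 1 / real (Suc k)" using False by linarith
    then show ?thesis using False unfolding lo_def cts_step_def by (simp del: of_nat_Suc)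
  qed (simp add: rg)
  have shrink: "(\<lambda>k. up s k x) \<longlonglongrightarrow> indicator {..s} x" "(\<lambda>k. lo s k x) \<longlonglongrightarrow> indicator {..<s} x" for s x
    unfolding up_def lo_def by (rule cts_step_shrink_right cts_step_shrink_left)+
  define P where "P = measure L {x \<in> space L. U x < s \<and> V x < t}"
  have limup: "(\<lambda>k. \<integral>x. up s k (U x) * up t k (V x) \<partial>L) \<longlonglongrightarrow> P"
  proof -
    have "(\<lambda>k. \<integral>x. up s k (U x) * up t k (V x) \<partial>L) \<longlonglongrightarrow> (\<integral>x. indicator {..s} (U x) * indicator {..t} (V x) \<partial>L)"
      by (rule integral_dominated_convergence[where w="\<lambda>_. 1"])
        (auto simp: abs_mult intro!: tendsto_mult shrink mult_le_one ab)
    also have "(\<integral>x. indicat_real {..s} (U x) * indicator {..t} (V x) \<partial>L) = (\<integral>x. indicator {x \<in> space L. U x < s \<and> V x < t} x \<partial>L)"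
    proof (rule integral_cong_AE)
      show "AE x in L. indicator {..s} (U x) * indicator {..t} (V x) = (indicator {x \<in> space L. U x < s \<and> V x < t} x :: real)"
        using boundary AE_space by eventually_elim (auto simp: indicator_def)
    qed measurable
    also have "\<dots> = P" by (simp add: P_def)
    finally show ?thesis .
  qed
  have limlo: "(\<lambda>k. \<integral>x. lo s k (U x) * lo t k (V x) \<partial>L) \<longlonglongrightarrow> P"
  proof -
    have "(\<lambda>k. \<integral>x. lo s k (U x) * lo t k (V x) \<partial>L) \<longlonglongrightarrow> (\<integral>x. indicator {..<s} (U x) * indicator {..<t} (V x) \<partial>L)"
      by (rule integral_dominated_convergence[where w="\<lambda>_. 1"])
        (auto simp: abs_mult intro!: tendsto_mult shrink mult_le_one ab)
    also have "(\<integral>x. indicat_real {..<s} (U x) * indicator {..<t} (V x) \<partial>L) = (\<integral>x. indicator {x \<in> space L. U x < s \<and> V x < t} x \<partial>L)"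
      by (intro Bochner_Integration.integral_cong) (auto simp: indicator_def)
    also have "\<dots> = P" by (simp add: P_def)
    finally show ?thesis .
  qed
  have limn: "(\<lambda>n. \<integral>\<omega>. f (A n \<omega>) * g (B n \<omega>) \<partial>M) \<longlonglongrightarrow> (\<integral>x. f (U x) * g (V x) \<partial>L)"
    if "continuous_on UNIV f" "continuous_on UNIV g" "\<And>x. \<bar>f x\<bar> \<le> 1" "\<And>x. \<bar>g x\<bar> \<le> 1" for f g :: "real \<Rightarrow> real"
    by (rule product_expectation_limit_from_moments[OF M L meas range moments that])
  have Pn: "measure M {\<omega> \<in> space M. A n \<omega> < s \<and> B n \<omega> < t}
      = (\<integral>\<omega>. indicat_real {..<s} (A n \<omega>) * indicator {..<t} (B n \<omega>) \<partial>M)" for n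
  proof -
    have "measure M {\<omega> \<in> space M. A n \<omega> < s \<and> B n \<omega> < t} = (\<integral>x. indicat_real {\<omega> \<in> space M. A n \<omega> < s \<and> B n \<omega> < t} x \<partial>M)"
      by simp
    also have "\<dots> = (\<integral>\<omega>. indicat_real {..<s} (A n \<omega>) * indicator {..<t} (B n \<omega>) \<partial>M)"
      by (intro Bochner_Integration.integral_cong) (auto simp: indicator_def)
    finally show ?thesis .
  qed
  have intind: "integrable M (\<lambda>\<omega>. indicator {..<s} (A n \<omega>) * indicator {..<t} (B n \<omega>) :: real)" for n
    by (rule M.integrable_const_bound[of _ 1]) (auto simp: indicator_def)
  have intup: "integrable M (\<lambda>\<omega>. up s k (A n \<omega>) * up t k (B n \<omega>))" for k n
    by (rule M.integrable_const_bound[of _ 1]) (auto simp: abs_mult intro!: mult_le_one ab)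
  have intlo: "integrable M (\<lambda>\<omega>. lo s k (A n \<omega>) * lo t k (B n \<omega>))" for k n
    by (rule M.integrable_const_bound[of _ 1]) (auto simp: abs_mult intro!: mult_le_one ab)
  show ?thesis
    unfolding P_def[symmetric]
  proof (rule order_tendstoI)
    fix y assume "y < P"
    then have "eventually (\<lambda>k. y < (\<integral>x. lo s k (U x) * lo t k (V x) \<partial>L)) sequentially"
      using limlo by (rule order_tendstoD(1)[rotated])
    then obtain k where "y < (\<integral>x. lo s k (U x) * lo t k (V x) \<partial>L)"
      by (auto simp: eventually_sequentially)
    then have "eventually (\<lambda>n. y < (\<integral>\<omega>. lo s k (A n \<omega>) * lo t k (B n \<omega>) \<partial>M)) sequentially"
      using limn[OF cont(2) cont(2) ab(2) ab(2)] by (rule order_tendstoD(1)[rotated])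
    then show "eventually (\<lambda>n. y < measure M {\<omega> \<in> space M. A n \<omega> < s \<and> B n \<omega> < t}) sequentially"
    proof eventually_elim
      case (elim n)
      also have "(\<integral>\<omega>. lo s k (A n \<omega>) * lo t k (B n \<omega>) \<partial>M) \<le> (\<integral>\<omega>. indicator {..<s} (A n \<omega>) * indicator {..<t} (B n \<omega>) \<partial>M)"
        by (intro integral_mono intlo intind mult_mono lower rg) auto
      finally show ?case by (simp only: Pn)
    qed
  next
    fix y assume "P < y"
    then have "eventually (\<lambda>k. (\<integral>x. up s k (U x) * up t k (V x) \<partial>L) < y) sequentially"
      using limup by (rule order_tendstoD(2)[rotated])
    then obtain k where "(\<integral>x. up s k (U x) * up t k (V x) \<partial>L) < y"
      by (auto simp: eventually_sequentially)
    then have "eventually (\<lambda>n. (\<integral>\<omega>. up s k (A n \<omega>) * up t k (B n \<omega>) \<partial>M) < y) sequentially"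
      using limn[OF cont(1) cont(1) ab(1) ab(1)] by (rule order_tendstoD(2)[rotated])
    then show "eventually (\<lambda>n. measure M {\<omega> \<in> space M. A n \<omega> < s \<and> B n \<omega> < t} < y) sequentially"
    proof eventually_elim
      case (elim n)
      have "(\<integral>\<omega>. indicator {..<s} (A n \<omega>) * indicator {..<t} (B n \<omega>) \<partial>M) \<le> (\<integral>\<omega>. up s k (A n \<omega>) * up t k (B n \<omega>) \<partial>M)"
        by (intro integral_mono intup intind mult_mono upper rg) auto
      then show ?case using elim by (simp only: Pn)
    qed
  qed
qed

section \<open>Kibble's bivariate gamma law\<close>

abbreviation plane :: "(real \<times> real) measure" where
  "plane \<equiv> lborel \<Otimes>\<^sub>M lborel"

text \<open>
  The Gamma integral with a rate parameter. It serves for the gamma densities of the mixture, for the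
  asymptotics of the Bessel function and for the exponential integrals at the corner.
\<close>

lemma nn_integral_gamma_kernel:
  fixes s y :: real
  assumes s: "s > 0" and y: "y > 0"
  shows "(\<integral>\<^sup>+ v. ennreal (indicator {0<..} v * v powr (s - 1) * exp (- y * v)) \<partial>lborel) = ennreal (Gamma s * y powr (- s))"
    (is "?G = _")
proof -
  have "ennreal (Gamma s) = (\<integral>\<^sup>+t. ennreal (indicator {0..} t * t powr (s - 1) / exp t) \<partial>lborel)"
    by (rule Gamma_conv_nn_integral_real[OF s])
  also have "\<dots> = ennreal \<bar>y\<bar> * (\<integral>\<^sup>+v. ennreal (indicator {0..} (0 + y * v) * (0 + y * v) powr (s - 1) / exp (0 + y * v)) \<partial>lborel)"
    by (rule nn_integral_real_affine) (use y in auto)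
  also have "(\<integral>\<^sup>+v. ennreal (indicator {0..} (0 + y * v) * (0 + y * v) powr (s - 1) / exp (0 + y * v)) \<partial>lborel)
      = (\<integral>\<^sup>+v. ennreal (y powr (s - 1)) * ennreal (indicator {0<..} v * v powr (s - 1) * exp (- y * v)) \<partial>lborel)"
  proof (rule nn_integral_cong)
    fix v :: real
    have "indicator {0..} (y * v) * (y * v) powr (s - 1) / exp (y * v)
       = y powr (s - 1) * (indicator {0<..} v * v powr (s - 1) * exp (- y * v))"
    proof (cases "v > 0")
      case True
      then show ?thesis using y by (simp add: powr_mult exp_minus field_simps)
    next
      case False
      show ?thesis
      proof (cases "v = 0")
        case False
        with \<open>\<not> v > 0\<close> have "y * v < 0" using y by (simp add: mult_pos_neg)
        then show ?thesis using \<open>\<not> v > 0\<close> by simp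
      qed simp
    qed
    then show "ennreal (indicator {0..} (0 + y * v) * (0 + y * v) powr (s - 1) / exp (0 + y * v))
       = ennreal (y powr (s - 1)) * ennreal (indicator {0<..} v * v powr (s - 1) * exp (- y * v))"
      by (subst ennreal_mult[symmetric]) auto
  qed
  also have "\<dots> = ennreal (y powr (s - 1)) * ?G" by (rule nn_integral_cmult) simp
  also have "ennreal \<bar>y\<bar> * (ennreal (y powr (s - 1)) * ?G) = ennreal (y powr s) * ?G"
    unfolding mult.assoc[symmetric] using y by (subst ennreal_mult[symmetric]) (auto simp: powr_mult_base)
  finally have *: "ennreal (Gamma s) = ennreal (y powr s) * ?G" .
  have "ennreal (Gamma s * y powr (- s)) = ennreal (y powr (- s)) * ennreal (Gamma s)"
    using s by (subst ennreal_mult[symmetric]) (auto simp: mult.commute less_imp_le)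
  also have "\<dots> = ennreal (y powr (- s) * y powr s) * ?G"
    unfolding * by (subst ennreal_mult) (auto simp: mult.assoc)
  also have "y powr (- s) * y powr s = 1" using y by (simp add: powr_add[symmetric])
  finally show ?thesis by simp
qed

lemma Gamma_real_add_one: "x > 0 \<Longrightarrow> Gamma (x + 1) = x * Gamma (x :: real)"
  by (intro Gamma_plus1) (auto elim!: nonpos_Ints_cases)

lemma ennreal_mult3:
  "0 \<le> x \<Longrightarrow> 0 \<le> y \<Longrightarrow> 0 \<le> z \<Longrightarrow> ennreal (x * (y * z)) = ennreal x * (ennreal y * ennreal z)"
  by (simp add: ennreal_mult)

text \<open>
  The Bessel--Clifford function: the modified Bessel function is
  \<open>I\<^sub>\<delta>(x) = (x / 2) powr \<delta> * bessel_clifford (\<delta> + 1) (x\<^sup>2 / 4)\<close>.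
\<close>

definition bessel_clifford :: "real \<Rightarrow> real \<Rightarrow> real" where
  "bessel_clifford a z = (\<Sum>m. z ^ m / (fact m * Gamma (a + real m)))"

lemma bessel_clifford_summable:
  assumes a: "a > 0" and z: "z \<ge> 0"
  shows "summable (\<lambda>m. z ^ m / (fact m * Gamma (a + real m)))"
proof -
  obtain k :: nat where k: "2 * z / a \<le> real k" using real_arch_simple by blast
  show ?thesis
  proof (rule summable_ratio_test[of "1/2" k])
    fix m assume m: "m \<ge> k"
    have G: "Gamma (a + real m) > 0" "Gamma (a + real (Suc m)) = (a + real m) * Gamma (a + real m)"
      using a Gamma_real_add_one[of "a + real m"] by (auto simp: add_ac intro!: Gamma_real_pos)
    have "2 * z \<le> a * real k" using k a by (simp add: field_simps)
    also have "\<dots> \<le> (a + real m) * real (Suc m)" using a m by (intro mult_mono) auto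
    finally have "2 * z \<le> (a + real m) * real (Suc m)" .
    moreover have "0 < (a + real m) * real (Suc m)" using a by (intro mult_pos_pos) auto
    ultimately have "z / (real (Suc m) * (a + real m)) \<le> 1 / 2"
      by (simp add: pos_divide_le_eq mult.commute del: of_nat_Suc)
    moreover have "z ^ Suc m / (fact (Suc m) * Gamma (a + real (Suc m)))
        = z / (real (Suc m) * (a + real m)) * (z ^ m / (fact m * Gamma (a + real m)))"
      unfolding G(2) by simp
    moreover have "0 \<le> z / (real (Suc m) * (a + real m))" using z a by simp
    ultimately show "norm (z ^ Suc m / (fact (Suc m) * Gamma (a + real (Suc m))))
        \<le> 1 / 2 * norm (z ^ m / (fact m * Gamma (a + real m)))"
      by (simp only: real_norm_def abs_mult mult_right_mono abs_ge_zero abs_of_nonneg)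
  qed simp
qed

lemma bessel_clifford_nonneg: "a > 0 \<Longrightarrow> z \<ge> 0 \<Longrightarrow> bessel_clifford a z \<ge> 0"
  unfolding bessel_clifford_def by (intro suminf_nonneg bessel_clifford_summable) (auto intro!: Gamma_real_nonneg)

lemma bessel_clifford_measurable[measurable]: "bessel_clifford a \<in> borel_measurable borel"
  unfolding bessel_clifford_def by measurable

text \<open>
  In the variables \<open>v = u / (1 - c\<^sup>2)\<close> this is the density \<open>p\<^sub>2\<^sub>,\<^sub>0(u\<^sub>1, u\<^sub>2)\<close> with \<open>\<delta> = a - 1\<close>: the powers of \<open>c\<close>
  and of \<open>u\<^sub>1 u\<^sub>2\<close> in front of \<open>I\<^sub>\<delta>\<close> are absorbed by passing to the Bessel--Clifford function.
\<close>

definition kibble_density :: "real \<Rightarrow> real \<Rightarrow> real \<times> real \<Rightarrow> real" where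
  "kibble_density a c v =
     indicator ({0<..} \<times> {0<..}) v *
     ((1 - c\<^sup>2) powr a / Gamma a * (fst v * snd v) powr (a - 1) * exp (- fst v - snd v)
      * bessel_clifford a (c\<^sup>2 * (fst v * snd v)))"

lemma kibble_density_measurable[measurable]: "kibble_density a c \<in> borel_measurable plane"
proof -
  have "{0<..} \<times> {0<..} \<in> sets plane" by measurable
  then show ?thesis unfolding kibble_density_def by measurable
qed

lemma kibble_density_nonneg: "a > 0 \<Longrightarrow> kibble_density a c v \<ge> 0"
  by (cases "v \<in> {0<..} \<times> {0<..}")
    (auto simp: kibble_density_def intro!: mult_nonneg_nonneg divide_nonneg_nonneg bessel_clifford_nonneg
       Gamma_real_nonneg)

text \<open>
  The weights of the negative binomial distribution, up to normalisation: the binomial series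
  with exponent \<open>- a\<close>.
\<close>

lemma negative_binomial_series:
  fixes a q :: real
  assumes "a > 0" "0 \<le> q" "q < 1"
  shows "(\<lambda>m. Gamma (a + real m) / (Gamma a * fact m) * q ^ m) sums ((1 - q) powr (- a))"
proof -
  have "(\<lambda>m. ((- a) gchoose m) * (- q) ^ m) sums (1 + - q) powr (- a)"
    using assms by (intro gen_binomial_real) auto
  moreover have "((- a) gchoose m) * (- q) ^ m = Gamma (a + real m) / (Gamma a * fact m) * q ^ m" for m
  proof -
    have "((- a) gchoose m) * (- q) ^ m = ((- 1) ^ m * (- q) ^ m) * pochhammer a m / fact m"
      by (simp add: gbinomial_pochhammer)
    also have "(- 1) ^ m * (- q) ^ m = q ^ m" by (simp flip: power_mult_distrib)
    also have "pochhammer a m = Gamma (a + real m) / Gamma a"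
      using assms by (intro pochhammer_Gamma) (auto simp: nonpos_Ints_def)
    finally show ?thesis by (simp add: field_simps)
  qed
  ultimately show ?thesis by simp
qed

lemma nn_integral_product:
  fixes f g :: "real \<Rightarrow> ennreal"
  assumes [measurable]: "f \<in> borel_measurable borel" "g \<in> borel_measurable borel"
  shows "(\<integral>\<^sup>+ v. f (fst v) * g (snd v) \<partial>plane) = (\<integral>\<^sup>+ x. f x \<partial>lborel) * (\<integral>\<^sup>+ y. g y \<partial>lborel)"
proof -
  have "(\<integral>\<^sup>+ v. f (fst v) * g (snd v) \<partial>plane) = (\<integral>\<^sup>+ x. \<integral>\<^sup>+ y. f x * g y \<partial>lborel \<partial>lborel)"
    by (subst lborel.nn_integral_fst[symmetric]) auto
  also have "\<dots> = (\<integral>\<^sup>+ x. f x \<partial>lborel) * (\<integral>\<^sup>+ y. g y \<partial>lborel)"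
    by (simp add: nn_integral_cmult nn_integral_multc)
  finally show ?thesis .
qed

text \<open>
  The power series of the Bessel--Clifford function writes the density as a mixture of products of
  gamma densities of the common shape \<open>a + m\<close>, with negative binomial weights in \<open>m\<close>. Each product
  has the transform \<open>((1 + \<kappa>) (1 + \<mu>)) powr (- a - m)\<close>, and the weights sum these to a binomial
  series again. Taking \<open>\<kappa> = \<mu> = 0\<close> shows that the total mass is one.
\<close>

lemma kibble_laplace:
  fixes a c \<kappa> \<mu> :: real
  assumes a: "a > 0" and c: "0 \<le> c" "c < 1" and km: "\<kappa> \<ge> 0" "\<mu> \<ge> 0"
  shows "(\<integral>\<^sup>+ v. ennreal (kibble_density a c v * exp (- \<kappa> * fst v - \<mu> * snd v)) \<partial>plane)
    = ennreal ((1 - c\<^sup>2) powr a * ((1 + \<kappa>) * (1 + \<mu>) - c\<^sup>2) powr (- a))"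
proof -
  define \<beta> where "\<beta> = (1 - c\<^sup>2) powr a"
  define w where "w m = \<beta> * Gamma (a + real m) / (Gamma a * fact m) * (c\<^sup>2) ^ m" for m
  define g where "g y m v = indicator {0<..} v * v powr (a + real m - 1) * exp (- y * v)" for y :: real and m and v :: real
  define D where "D = (1 + \<kappa>) * (1 + \<mu>)"
  have [measurable]: "g y m \<in> borel_measurable borel" for y m unfolding g_def by measurable
  have g0: "g y m v \<ge> 0" for y m v by (auto simp: g_def)
  have G: "Gamma (a + real m) > 0" for m using a by (intro Gamma_real_pos) auto
  have w0: "w m \<ge> 0" for m unfolding w_def \<beta>_def using G[of m] a by (auto intro!: mult_nonneg_nonneg divide_nonneg_nonneg Gamma_real_nonneg)
  have c2: "c\<^sup>2 < 1" using c by (simp add: power_less_one_iff abs_square_less_1)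
  have D: "D \<ge> 1" unfolding D_def using km mult_mono[of 1 "1 + \<kappa>" 1 "1 + \<mu>"] by simp
  have pw: "ennreal (kibble_density a c v * exp (- \<kappa> * fst v - \<mu> * snd v))
      = (\<Sum>m. ennreal (w m / (Gamma (a + real m))\<^sup>2) * (ennreal (g (1 + \<kappa>) m (fst v)) * ennreal (g (1 + \<mu>) m (snd v))))" for v
  proof (cases "fst v > 0 \<and> snd v > 0")
    case True
    define z where "z = fst v * snd v"
    define K where "K = \<beta> / Gamma a * z powr (a - 1) * exp (- (1 + \<kappa>) * fst v) * exp (- (1 + \<mu>) * snd v)"
    have z: "z > 0" using True by (simp add: z_def)
    have sm: "summable (\<lambda>m. (c\<^sup>2 * z) ^ m / (fact m * Gamma (a + real m)))"
      using a z by (intro bessel_clifford_summable) auto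
    have summand: "K * ((c\<^sup>2 * z) ^ m / (fact m * Gamma (a + real m)))
       = w m / (Gamma (a + real m))\<^sup>2 * (g (1 + \<kappa>) m (fst v) * g (1 + \<mu>) m (snd v))" for m
    proof -
      have "z powr (a - 1) * z ^ m = z powr (a + real m - 1)"
        using z by (simp add: powr_realpow[symmetric] powr_add[symmetric] algebra_simps)
      also have "\<dots> = fst v powr (a + real m - 1) * snd v powr (a + real m - 1)"
        using True by (simp add: z_def powr_mult)
      finally have p: "z powr (a - 1) * z ^ m = fst v powr (a + real m - 1) * snd v powr (a + real m - 1)" .
      have "K * ((c\<^sup>2 * z) ^ m / (fact m * Gamma (a + real m)))
        = \<beta> / Gamma a * (z powr (a - 1) * z ^ m) * exp (- (1 + \<kappa>) * fst v) * exp (- (1 + \<mu>) * snd v) * (c\<^sup>2) ^ m / (fact m * Gamma (a + real m))"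
        by (simp add: K_def power_mult_distrib)
      also have "\<dots> = w m / (Gamma (a + real m))\<^sup>2 * (g (1 + \<kappa>) m (fst v) * g (1 + \<mu>) m (snd v))"
        unfolding p w_def g_def using True G[of m] by (simp add: power2_eq_square)
      finally show ?thesis .
    qed
    have e: "exp (- fst v - snd v) * exp (- \<kappa> * fst v - \<mu> * snd v) = exp (- (1 + \<kappa>) * fst v) * exp (- (1 + \<mu>) * snd v)"
      by (simp add: exp_add[symmetric] algebra_simps)
    have "kibble_density a c v * exp (- \<kappa> * fst v - \<mu> * snd v)
        = \<beta> / Gamma a * z powr (a - 1) * (exp (- fst v - snd v) * exp (- \<kappa> * fst v - \<mu> * snd v)) * bessel_clifford a (c\<^sup>2 * z)"
      using True by (simp add: kibble_density_def z_def \<beta>_def mem_Times_iff)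
    also have "\<dots> = K * bessel_clifford a (c\<^sup>2 * z)"
      unfolding e K_def by simp
    also have "\<dots> = (\<Sum>m. K * ((c\<^sup>2 * z) ^ m / (fact m * Gamma (a + real m))))"
      unfolding bessel_clifford_def by (rule suminf_mult[OF sm, symmetric])
    finally have kd: "kibble_density a c v * exp (- \<kappa> * fst v - \<mu> * snd v)
        = (\<Sum>m. w m / (Gamma (a + real m))\<^sup>2 * (g (1 + \<kappa>) m (fst v) * g (1 + \<mu>) m (snd v)))"
      unfolding summand .
    have "summable (\<lambda>m. w m / (Gamma (a + real m))\<^sup>2 * (g (1 + \<kappa>) m (fst v) * g (1 + \<mu>) m (snd v)))"
      unfolding summand[symmetric] by (rule summable_mult[OF sm])
    then have "ennreal (kibble_density a c v * exp (- \<kappa> * fst v - \<mu> * snd v))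
        = (\<Sum>m. ennreal (w m / (Gamma (a + real m))\<^sup>2 * (g (1 + \<kappa>) m (fst v) * g (1 + \<mu>) m (snd v))))"
      unfolding kd using w0 g0 by (intro suminf_ennreal2[symmetric]) auto
    moreover have "ennreal (w m / (Gamma (a + real m))\<^sup>2 * (g (1 + \<kappa>) m (fst v) * g (1 + \<mu>) m (snd v)))
        = ennreal (w m / (Gamma (a + real m))\<^sup>2) * (ennreal (g (1 + \<kappa>) m (fst v)) * ennreal (g (1 + \<mu>) m (snd v)))" for m
      by (rule ennreal_mult3) (use w0[of m] g0 in auto)
    ultimately show ?thesis by (simp only:)
  next
    case False
    then have "kibble_density a c v = 0" by (auto simp: kibble_density_def indicator_def mem_Times_iff)
    moreover have "ennreal (g (1 + \<kappa>) m (fst v)) * ennreal (g (1 + \<mu>) m (snd v)) = 0" for m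
      using False by (auto simp: g_def)
    ultimately show ?thesis by (simp only: mult_zero_left mult_zero_right ennreal_0 suminf_zero)
  qed
  have intg: "(\<integral>\<^sup>+ v. ennreal (g y m v) \<partial>lborel) = ennreal (Gamma (a + real m) * y powr (- (a + real m)))" if "y > 0" for y m
    unfolding g_def using a that by (intro nn_integral_gamma_kernel) auto
  have "(\<integral>\<^sup>+ v. ennreal (kibble_density a c v * exp (- \<kappa> * fst v - \<mu> * snd v)) \<partial>plane)
     = (\<Sum>m. \<integral>\<^sup>+ v. ennreal (w m / (Gamma (a + real m))\<^sup>2) * (ennreal (g (1 + \<kappa>) m (fst v)) * ennreal (g (1 + \<mu>) m (snd v))) \<partial>plane)"
    unfolding pw by (rule nn_integral_suminf) measurable
  also have "\<dots> = (\<Sum>m. ennreal (\<beta> * D powr (- a) * (Gamma (a + real m) / (Gamma a * fact m) * (c\<^sup>2 / D) ^ m)))"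
  proof (rule arg_cong[where f=suminf], rule ext)
    fix m
    have "(\<integral>\<^sup>+ v. ennreal (w m / (Gamma (a + real m))\<^sup>2) * (ennreal (g (1 + \<kappa>) m (fst v)) * ennreal (g (1 + \<mu>) m (snd v))) \<partial>plane)
       = ennreal (w m / (Gamma (a + real m))\<^sup>2) * (ennreal (Gamma (a + real m) * (1 + \<kappa>) powr (- (a + real m))) * ennreal (Gamma (a + real m) * (1 + \<mu>) powr (- (a + real m))))"
      using km nn_integral_product[of "\<lambda>x. ennreal (g (1 + \<kappa>) m x)" "\<lambda>x. ennreal (g (1 + \<mu>) m x)"]
      by (subst nn_integral_cmult, measurable) (simp add: intg)
    also have "\<dots> = ennreal (w m / (Gamma (a + real m))\<^sup>2 * (Gamma (a + real m) * (1 + \<kappa>) powr (- (a + real m)) * (Gamma (a + real m) * (1 + \<mu>) powr (- (a + real m)))))"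
      by (rule ennreal_mult3[symmetric]) (use w0[of m] G[of m] in auto)
    also have "w m / (Gamma (a + real m))\<^sup>2 * (Gamma (a + real m) * (1 + \<kappa>) powr (- (a + real m)) * (Gamma (a + real m) * (1 + \<mu>) powr (- (a + real m))))
       = w m * D powr (- (a + real m))"
      using G[of m] km by (simp add: D_def powr_mult power2_eq_square)
    also have "D powr (- (a + real m)) = D powr (- a) / D ^ m"
      using D by (simp add: powr_diff powr_realpow)
    also have "w m * (D powr (- a) / D ^ m) = \<beta> * D powr (- a) * (Gamma (a + real m) / (Gamma a * fact m) * (c\<^sup>2 / D) ^ m)"
      by (simp add: w_def power_divide)
    finally show "(\<integral>\<^sup>+ v. ennreal (w m / (Gamma (a + real m))\<^sup>2) * (ennreal (g (1 + \<kappa>) m (fst v)) * ennreal (g (1 + \<mu>) m (snd v))) \<partial>plane)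
       = ennreal (\<beta> * D powr (- a) * (Gamma (a + real m) / (Gamma a * fact m) * (c\<^sup>2 / D) ^ m))" .
  qed
  also have "\<dots> = ennreal (\<beta> * D powr (- a) * (1 - c\<^sup>2 / D) powr (- a))"
  proof -
    have "c\<^sup>2 / D < 1" using c2 D by (simp add: field_simps)
    then have s: "(\<lambda>m. \<beta> * D powr (- a) * (Gamma (a + real m) / (Gamma a * fact m) * (c\<^sup>2 / D) ^ m)) sums (\<beta> * D powr (- a) * (1 - c\<^sup>2 / D) powr (- a))"
      using a D by (intro sums_mult negative_binomial_series) auto
    have "0 \<le> \<beta> * D powr (- a) * (Gamma (a + real m) / (Gamma a * fact m) * (c\<^sup>2 / D) ^ m)" for m
      unfolding \<beta>_def using G[of m] a D by (auto intro!: mult_nonneg_nonneg divide_nonneg_nonneg Gamma_real_nonneg)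
    then show ?thesis using s by (simp add: suminf_ennreal2 sums_iff)
  qed
  also have "\<beta> * D powr (- a) * (1 - c\<^sup>2 / D) powr (- a) = \<beta> * (D - c\<^sup>2) powr (- a)"
  proof -
    have "D powr (- a) * (1 - c\<^sup>2 / D) powr (- a) = (D * (1 - c\<^sup>2 / D)) powr (- a)"
      using D c2 by (subst powr_mult) (auto simp: field_simps)
    also have "D * (1 - c\<^sup>2 / D) = D - c\<^sup>2" using D by (simp add: field_simps)
    finally show ?thesis by simp
  qed
  finally show ?thesis unfolding \<beta>_def D_def .
qed

definition kibble :: "real \<Rightarrow> real \<Rightarrow> (real \<times> real) measure" where
  "kibble a c = density plane (\<lambda>v. ennreal (kibble_density a c v))"

lemma sets_kibble[measurable_cong, simp]: "sets (kibble a c) = sets (borel \<Otimes>\<^sub>M borel)"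
  by (simp add: kibble_def cong: sets_pair_measure_cong)

lemma space_kibble[simp]: "space (kibble a c) = UNIV"
  by (simp add: kibble_def space_pair_measure)

lemma prob_space_kibble:
  assumes "a > 0" "0 \<le> c" "c < 1"
  shows "prob_space (kibble a c)"
proof
  have "1 - c\<^sup>2 > 0" using assms by (simp add: power_less_one_iff abs_square_less_1)
  moreover have "UNIV \<in> sets plane"
    using sets.top[of "plane"] by (simp add: space_pair_measure)
  then have "emeasure (kibble a c) UNIV = (\<integral>\<^sup>+v. ennreal (kibble_density a c v) * indicator UNIV v \<partial>plane)"
    unfolding kibble_def by (intro emeasure_density) auto
  ultimately show "emeasure (kibble a c) (space (kibble a c)) = 1"
    using kibble_laplace[of a c 0 0] assms by (simp add: powr_minus)
qed

text \<open>
  The absolute values change nothing on the support of the law, and make the integrand bounded on the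
  whole plane.
\<close>

lemma kibble_expectation:
  assumes a: "a > 0" and c: "0 \<le> c" "c < 1" and km: "\<kappa> \<ge> 0" "\<mu> \<ge> 0"
  shows "(\<integral>v. exp (- \<kappa> * \<bar>fst v\<bar> - \<mu> * \<bar>snd v\<bar>) \<partial>kibble a c)
    = (1 - c\<^sup>2) powr a * ((1 + \<kappa>) * (1 + \<mu>) - c\<^sup>2) powr (- a)"
proof -
  have "(\<integral>\<^sup>+v. ennreal (exp (- \<kappa> * \<bar>fst v\<bar> - \<mu> * \<bar>snd v\<bar>)) \<partial>kibble a c)
     = (\<integral>\<^sup>+ v. ennreal (kibble_density a c v * exp (- \<kappa> * fst v - \<mu> * snd v)) \<partial>plane)"
    unfolding kibble_def
  proof (subst nn_integral_density, measurable, rule nn_integral_cong)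
    fix v
    show "ennreal (kibble_density a c v) * ennreal (exp (- \<kappa> * \<bar>fst v\<bar> - \<mu> * \<bar>snd v\<bar>))
      = ennreal (kibble_density a c v * exp (- \<kappa> * fst v - \<mu> * snd v))"
      using kibble_density_nonneg[OF a, of c v]
      by (cases "v \<in> {0<..} \<times> {0<..}") (auto simp: ennreal_mult'[symmetric] kibble_density_def)
  qed
  then show ?thesis
    unfolding kibble_laplace[OF assms]
    by (subst integral_eq_nn_integral) (auto simp: kibble_def)
qed

lemma kibble_no_atoms:
  assumes b: "b > 0"
  shows "AE v in kibble a c. exp (- b * \<bar>fst v\<bar>) \<noteq> s" "AE v in kibble a c. exp (- b * \<bar>snd v\<bar>) \<noteq> s"
proof -
  have one: "AE x in lborel. exp (- b * \<bar>x\<bar>) \<noteq> s"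
  proof -
    have "AE x in lborel. x \<noteq> ln s / b" "AE x in lborel. x \<noteq> - (ln s / b)" by (rule AE_lborel_singleton)+
    then show ?thesis
    proof eventually_elim
      case (elim x)
      show ?case
      proof
        assume "exp (- b * \<bar>x\<bar>) = s"
        then have "ln s = - b * \<bar>x\<bar>" by auto
        then have "\<bar>x\<bar> = - (ln s / b)" using b by (simp add: field_simps)
        with elim show False by (auto simp: abs_if split: if_splits)
      qed
    qed
  qed
  have "AE v in plane. exp (- b * \<bar>fst v\<bar>) \<noteq> s"
  proof (rule lborel_pair.AE_pair_measure)
    show "{v \<in> space plane. exp (- b * \<bar>fst v\<bar>) \<noteq> s} \<in> sets plane"
      by measurable
  qed (use one in \<open>auto elim!: eventually_mono\<close>)
  then show "AE v in kibble a c. exp (- b * \<bar>fst v\<bar>) \<noteq> s"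
    unfolding kibble_def by (subst AE_density) auto
  have "AE v in plane. exp (- b * \<bar>snd v\<bar>) \<noteq> s"
  proof (rule lborel_pair.AE_pair_measure)
    show "{v \<in> space plane. exp (- b * \<bar>snd v\<bar>) \<noteq> s} \<in> sets plane"
      by measurable
  qed (use one in \<open>auto elim!: eventually_mono\<close>)
  then show "AE v in kibble a c. exp (- b * \<bar>snd v\<bar>) \<noteq> s"
    unfolding kibble_def by (subst AE_density) auto
qed

section \<open>Limits along the ratio filter\<close>

text \<open>
  A choice of one pair of sample sizes from each of these events is a sequence that is admissible for
  the limit, so the filter becomes accessible to sequences.
\<close>

lemma eventually_ratio_filter:
  "\<forall>\<^sub>F (n1, n2) in ratio_filter c. m < n1 \<and> n1 < n2 \<and> \<bar>sqrt (real n1 / real n2) - c\<bar> < 1 / real (Suc m)"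
proof -
  let ?g = "\<lambda>(n1, n2). sqrt (real n1 / real n2)"
  have "\<forall>\<^sub>F x in at_top \<times>\<^sub>F at_top. m < (fst x :: nat)"
    using filterlim_fst eventually_gt_at_top unfolding filterlim_iff by blast
  then have 1: "\<forall>\<^sub>F x in ratio_filter c. m < fst x"
    unfolding ratio_filter_def by (rule filter_leD[OF inf_le1])
  have "\<forall>\<^sub>F x in principal {(n1, n2). n1 < n2}. fst x < (snd x :: nat)"
    by (auto simp: eventually_principal)
  then have 2: "\<forall>\<^sub>F x in ratio_filter c. fst x < snd x"
    unfolding ratio_filter_def by (rule filter_leD[OF le_infI2[OF inf_le1]])
  have "\<forall>\<^sub>F y in nhds c. dist y c < 1 / real (Suc m)"
    unfolding eventually_nhds_metric by (intro exI[of _ "1 / real (Suc m)"]) auto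
  then have "\<forall>\<^sub>F x in filtercomap ?g (nhds c). dist (?g x) c < 1 / real (Suc m)"
    by (rule eventually_filtercomapI)
  then have 3: "\<forall>\<^sub>F x in ratio_filter c. dist (?g x) c < 1 / real (Suc m)"
    unfolding ratio_filter_def by (rule filter_leD[OF le_infI2[OF inf_le2]])
  from 1 2 3 show ?thesis by eventually_elim (auto simp: dist_real_def)
qed

text \<open>
  Dominated convergence speaks about sequences. If the limit along the filter failed, some admissible
  sequence of pairs would stay away from \<open>L\<close>.
\<close>

lemma tendsto_ratio_filterI:
  fixes f :: "nat \<times> nat \<Rightarrow> real"
  assumes "\<And>n1 n2. (\<And>m. 0 < n1 m) \<Longrightarrow> (\<And>m. n1 m < n2 m) \<Longrightarrow> filterlim n1 at_top sequentially \<Longrightarrow>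
     (\<lambda>m. sqrt (real (n1 m) / real (n2 m))) \<longlonglongrightarrow> c \<Longrightarrow> (\<lambda>m. f (n1 m, n2 m)) \<longlonglongrightarrow> L"
  shows "(f \<longlongrightarrow> L) (ratio_filter c)"
proof (rule tendstoI, rule ccontr)
  fix e :: real assume e: "e > 0" and not: "\<not> (\<forall>\<^sub>F x in ratio_filter c. dist (f x) L < e)"
  have "\<exists>x. (m < fst x \<and> fst x < snd x \<and> \<bar>sqrt (real (fst x) / real (snd x)) - c\<bar> < 1 / real (Suc m)) \<and> \<not> dist (f x) L < e" for m
  proof (rule ccontr)
    assume no: "\<nexists>x. (m < fst x \<and> fst x < snd x \<and> \<bar>sqrt (real (fst x) / real (snd x)) - c\<bar> < 1 / real (Suc m)) \<and> \<not> dist (f x) L < e"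
    have "\<forall>\<^sub>F x in ratio_filter c. dist (f x) L < e"
      using eventually_ratio_filter[of m c] by (rule eventually_mono) (use no in auto)
    then show False using not by blast
  qed
  then obtain s where s: "\<And>m. m < fst (s m)" "\<And>m. fst (s m) < snd (s m)"
      "\<And>m. \<bar>sqrt (real (fst (s m)) / real (snd (s m))) - c\<bar> < 1 / real (Suc m)" "\<And>m. \<not> dist (f (s m)) L < e"
    by metis
  have "filterlim (\<lambda>m. fst (s m)) at_top sequentially"
    by (rule filterlim_at_top_mono[OF filterlim_ident]) (intro always_eventually allI less_imp_le s(1))
  moreover have "(\<lambda>m. sqrt (real (fst (s m)) / real (snd (s m)))) \<longlonglongrightarrow> c"
  proof (rule LIM_zero_cancel, rule Lim_null_comparison)
    show "\<forall>\<^sub>F m in sequentially. norm (sqrt (real (fst (s m)) / real (snd (s m))) - c) \<le> 1 / real (Suc m)"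
      using s(3) by (auto intro!: always_eventually less_imp_le simp del: of_nat_Suc)
    show "(\<lambda>m. 1 / real (Suc m)) \<longlonglongrightarrow> 0" by (rule LIMSEQ_Suc[OF lim_1_over_n])
  qed
  moreover have "0 < fst (s m)" for m using s(1)[of m] by linarith
  ultimately have "(\<lambda>m. f (fst (s m), snd (s m))) \<longlonglongrightarrow> L" using s(2) by (intro assms)
  then have "\<forall>\<^sub>F m in sequentially. dist (f (s m)) L < e" using e by (auto dest: tendstoD)
  then show False using s(4) by simp
qed

text \<open>
  The pairs \<open>(\<lfloor>c\<^sup>2 k\<rfloor>, k)\<close> converge along the filter. Without this, \<open>Lim\<close> in the definition of \<open>alpha\<close>
  would not single out a value.
\<close>

lemma ratio_filter_nontrivial:
  assumes c: "0 < c" "c < 1"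
  shows "ratio_filter c \<noteq> bot"
proof
  assume bot: "ratio_filter c = bot"
  define n1 where "n1 k = nat \<lfloor>c\<^sup>2 * real k\<rfloor>" for k
  have c2: "0 < c\<^sup>2" "c\<^sup>2 < 1" using c by (auto simp: power_less_one_iff abs_square_less_1)
  have b: "c\<^sup>2 * real k - 1 \<le> real (n1 k)" "real (n1 k) \<le> c\<^sup>2 * real k" for k
    unfolding n1_def using c2 by (simp_all add: of_nat_nat)
  have top: "filterlim n1 at_top sequentially"
  proof -
    have "filterlim (\<lambda>k. c\<^sup>2 * real k - 1) at_top sequentially" using c2 by real_asymp
    then have "filterlim (\<lambda>k. real (n1 k)) at_top sequentially"
      by (rule filterlim_at_top_mono) (use b(1) in auto)
    then show ?thesis by (simp add: filterlim_sequentially_iff_filterlim_real)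
  qed
  have lim: "(\<lambda>k. real (n1 k) / real k) \<longlonglongrightarrow> c\<^sup>2"
  proof (rule tendsto_sandwich)
    show "(\<lambda>k. c\<^sup>2 - 1 / real k) \<longlonglongrightarrow> c\<^sup>2" by real_asymp
    show "(\<lambda>k. c\<^sup>2) \<longlonglongrightarrow> c\<^sup>2" by simp
    show "\<forall>\<^sub>F k in sequentially. c\<^sup>2 - 1 / real k \<le> real (n1 k) / real k"
      using eventually_gt_at_top[of 0]
    proof eventually_elim
      case (elim k)
      have "c\<^sup>2 - 1 / real k = (c\<^sup>2 * real k - 1) / real k" using elim by (simp add: field_simps)
      also have "\<dots> \<le> real (n1 k) / real k" by (intro divide_right_mono b) simp
      finally show ?case .
    qed
    show "\<forall>\<^sub>F k in sequentially. real (n1 k) / real k \<le> c\<^sup>2"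
      using eventually_gt_at_top[of 0] by eventually_elim (use b(2) in \<open>simp add: pos_divide_le_eq\<close>)
  qed
  have "(\<lambda>k. sqrt (real (n1 k) / real k)) \<longlonglongrightarrow> sqrt (c\<^sup>2)" by (intro tendsto_intros lim)
  then have lim': "(\<lambda>k. sqrt (real (n1 k) / real k)) \<longlonglongrightarrow> c" using c by simp
  have lt: "\<forall>\<^sub>F k in sequentially. n1 k < k"
    using eventually_gt_at_top[of 0]
  proof eventually_elim
    case (elim k)
    have "real (n1 k) \<le> c\<^sup>2 * real k" by (rule b)
    also have "\<dots> < 1 * real k" using c2 elim by (intro mult_strict_right_mono) auto
    finally show ?case by simp
  qed
  have "filterlim (\<lambda>k. (n1 k, k)) (ratio_filter c) sequentially"
    unfolding ratio_filter_def filterlim_inf filterlim_principal filterlim_filtercomap_iff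
    using lt lim' by (auto intro!: filterlim_Pair top filterlim_ident simp: o_def)
  then show False
    unfolding bot filterlim_def by (simp add: bot_unique filtermap_bot_iff)
qed

section \<open>The limit law of two Pearson statistics\<close>

lemma pearson_nonneg:
  assumes "\<And>j. j \<in> {1..N} \<Longrightarrow> p j > 0"
  shows "pearson N p T n \<omega> \<ge> 0"
  unfolding pearson_def using assms by (intro sum_nonneg divide_nonneg_nonneg mult_nonneg_nonneg) (auto intro: less_imp_le)

lemma pearson_measurable:
  assumes "independent_trials M N p T"
  shows "pearson N p T n \<in> borel_measurable M"
proof -
  have "(\<lambda>\<omega>. real (occurrences T j n \<omega>)) \<in> borel_measurable M" for j
  proof -
    have "real (occurrences T j n \<omega>) = (\<Sum>i<n. of_bool (T i \<omega> = j))" for \<omega>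
    proof -
      have "{i. i < n \<and> T i \<omega> = j} = {..<n} \<inter> {i. T i \<omega> = j}" by auto
      then show ?thesis by (simp add: occurrences_def)
    qed
    then show ?thesis
      by (simp only:) (intro borel_measurable_sum trial_measurable[OF assms])
  qed
  then show ?thesis unfolding pearson_def[abs_def] by measurable
qed

text \<open>
  Both Laplace transforms agree at natural numbers: \<open>(1 + 2 \<beta> i) (1 + 2 \<beta> j) - c\<^sup>2 = \<beta> D\<close> with
  \<open>\<beta> = 1 - c\<^sup>2\<close> and \<open>D = (1 + 2 i) (1 + 2 j) - 4 i j c\<^sup>2\<close>. The events are expressed through
  \<open>exp (- X)\<close>, to which the moment criterion applies.
\<close>

lemma alpha_eq_kibble_tail:
  assumes N: "N \<ge> 2" and p: "\<And>j. j \<in> {1..N} \<Longrightarrow> p j > 0" "(\<Sum>j=1..N. p j) = 1"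
    and tr: "independent_trials M N p T"
    and c: "0 < c" "c < 1"
  shows "alpha M N p T c x1 x2
    = measure (kibble ((real N - 1) / 2) c) {v. \<bar>fst v\<bar> > x1 / (2 * (1 - c\<^sup>2)) \<and> \<bar>snd v\<bar> > x2 / (2 * (1 - c\<^sup>2))}"
proof -
  define a where "a = (real N - 1) / 2"
  define \<beta> where "\<beta> = 1 - c\<^sup>2"
  define U where "U v = exp (- (2 * \<beta>) * \<bar>fst v\<bar>)" for v :: "real \<times> real"
  define V where "V v = exp (- (2 * \<beta>) * \<bar>snd v\<bar>)" for v :: "real \<times> real"
  have a: "a > 0" using N by (simp add: a_def)
  have \<beta>: "\<beta> > 0" using c by (simp add: \<beta>_def power_less_one_iff abs_square_less_1)
  have nonneg: "pearson N p T n \<omega> \<ge> 0" for n \<omega> by (rule pearson_nonneg[OF p(1)])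
  have limit: "(\<lambda>m. measure M {\<omega> \<in> space M. pearson N p T (n1 m) \<omega> > x1 \<and> pearson N p T (n2 m) \<omega> > x2})
      \<longlonglongrightarrow> measure (kibble a c) {v. \<bar>fst v\<bar> > x1 / (2 * \<beta>) \<and> \<bar>snd v\<bar> > x2 / (2 * \<beta>)}"
    if n: "\<And>m. 0 < n1 m" "\<And>m. n1 m < n2 m" "filterlim n1 at_top sequentially"
      "(\<lambda>m. sqrt (real (n1 m) / real (n2 m))) \<longlonglongrightarrow> c" for n1 n2
  proof -
    have moments: "(\<lambda>m. \<integral>\<omega>. exp (- pearson N p T (n1 m) \<omega>) ^ i * exp (- pearson N p T (n2 m) \<omega>) ^ j \<partial>M)
        \<longlonglongrightarrow> (\<integral>v. U v ^ i * V v ^ j \<partial>kibble a c)" for i j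
    proof -
      define D where "D = (1 + 2 * real i) * (1 + 2 * real j) - 4 * real i * real j * c\<^sup>2"
      have D: "D > 0"
      proof -
        have "c\<^sup>2 * (real i * real j) \<le> 1 * (real i * real j)"
          using c by (intro mult_right_mono) (auto simp: power_le_one)
        then show ?thesis unfolding D_def by (simp add: algebra_simps add_pos_nonneg)
      qed
      have "(\<integral>v. U v ^ i * V v ^ j \<partial>kibble a c) = (\<integral>v. exp (- (2 * \<beta> * real i) * \<bar>fst v\<bar> - (2 * \<beta> * real j) * \<bar>snd v\<bar>) \<partial>kibble a c)"
        unfolding U_def V_def by (simp add: exp_of_nat_mult[symmetric] exp_add[symmetric] algebra_simps)
      also have "\<dots> = \<beta> powr a * ((1 + 2 * \<beta> * real i) * (1 + 2 * \<beta> * real j) - c\<^sup>2) powr (- a)"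
        unfolding \<beta>_def using a c \<beta> by (intro kibble_expectation) (auto simp: \<beta>_def)
      also have "(1 + 2 * \<beta> * real i) * (1 + 2 * \<beta> * real j) - c\<^sup>2 = \<beta> * D"
        unfolding D_def \<beta>_def by (simp add: algebra_simps power2_eq_square)
      also have "\<beta> powr a * (\<beta> * D) powr (- a) = D powr (- a)"
        using \<beta> D by (simp add: powr_mult powr_minus)
      also have "- a = - (real N - 1) / 2" by (simp add: a_def field_simps)
      finally have "(\<integral>v. U v ^ i * V v ^ j \<partial>kibble a c) = D powr (- (real N - 1) / 2)" .
      moreover have "(\<lambda>m. \<integral>\<omega>. exp (- real i * pearson N p T (n1 m) \<omega> - real j * pearson N p T (n2 m) \<omega>) \<partial>M)
         \<longlonglongrightarrow> D powr (- (real N - 1) / 2)"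
        unfolding D_def using N p tr c n by (intro pearson_laplace_limit) auto
      moreover have "exp (- pearson N p T (n1 m) \<omega>) ^ i * exp (- pearson N p T (n2 m) \<omega>) ^ j
          = exp (- real i * pearson N p T (n1 m) \<omega> - real j * pearson N p T (n2 m) \<omega>)" for m \<omega>
        by (simp add: exp_of_nat_mult[symmetric] exp_add[symmetric] algebra_simps)
      ultimately show ?thesis by simp
    qed
    have "(\<lambda>m. measure M {\<omega> \<in> space M. exp (- pearson N p T (n1 m) \<omega>) < exp (- x1) \<and> exp (- pearson N p T (n2 m) \<omega>) < exp (- x2)})
        \<longlonglongrightarrow> measure (kibble a c) {v \<in> space (kibble a c). U v < exp (- x1) \<and> V v < exp (- x2)}"
    proof (rule rectangle_limit_from_moments[OF independent_trialsD(1)[OF tr] prob_space_kibble _ _ _ _ _ _ _ _ moments])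
      show "(\<lambda>\<omega>. exp (- pearson N p T (n1 m) \<omega>)) \<in> borel_measurable M"
        "(\<lambda>\<omega>. exp (- pearson N p T (n2 m) \<omega>)) \<in> borel_measurable M" for m
        using pearson_measurable[OF tr] by measurable
      show "U \<in> borel_measurable (kibble a c)" "V \<in> borel_measurable (kibble a c)"
        unfolding U_def[abs_def] V_def[abs_def] by measurable
      show "AE v in kibble a c. U v \<noteq> exp (- x1)" "AE v in kibble a c. V v \<noteq> exp (- x2)"
        unfolding U_def V_def using \<beta> by (intro kibble_no_atoms; simp)+
    qed (use a c \<beta> nonneg in \<open>auto simp: U_def V_def\<close>)
    moreover have "U v < exp (- x1) \<longleftrightarrow> \<bar>fst v\<bar> > x1 / (2 * \<beta>)" "V v < exp (- x2) \<longleftrightarrow> \<bar>snd v\<bar> > x2 / (2 * \<beta>)" for v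
      using \<beta> by (auto simp: U_def V_def pos_divide_less_eq mult_ac)
    ultimately show ?thesis by simp
  qed
  have "((\<lambda>(n1, n2). measure M {\<omega> \<in> space M. pearson N p T n1 \<omega> > x1 \<and> pearson N p T n2 \<omega> > x2})
      \<longlongrightarrow> measure (kibble a c) {v. \<bar>fst v\<bar> > x1 / (2 * \<beta>) \<and> \<bar>snd v\<bar> > x2 / (2 * \<beta>)}) (ratio_filter c)"
    by (rule tendsto_ratio_filterI) (use limit in simp)
  then show ?thesis
    unfolding alpha_def a_def \<beta>_def by (rule tendsto_Lim[OF ratio_filter_nontrivial[OF c]])
qed

section \<open>Large arguments of the Bessel--Clifford function\<close>

text \<open>
  The duplication formula at half-integers, free of division; it identifies the Bessel--Clifford
  series of order \<open>3 / 2\<close> with the one of \<open>sinh\<close>.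
\<close>

lemma Gamma_half_integer:
  "Gamma (3 / 2 + real m) * fact m * 2 ^ (2 * m + 1) = sqrt pi * fact (2 * m + 1)"
proof (induction m)
  case 0
  have "Gamma (3 / 2 :: real) = 1 / 2 * Gamma (1 / 2)"
    using Gamma_real_add_one[of "1 / 2"] by simp
  then show ?case by (simp add: Gamma_one_half_real)
next
  case (Suc m)
  have "Gamma (3 / 2 + real (Suc m)) = (3 / 2 + real m) * Gamma (3 / 2 + real m)"
    using Gamma_real_add_one[of "3 / 2 + real m"] by (simp add: add_ac)
  then have "Gamma (3 / 2 + real (Suc m)) * fact (Suc m) * 2 ^ (2 * Suc m + 1)
     = ((2 * real m + 3) * (2 * real m + 2)) * (Gamma (3 / 2 + real m) * fact m * 2 ^ (2 * m + 1))"
    by (simp add: algebra_simps)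
  also have "\<dots> = sqrt pi * fact (2 * Suc m + 1)"
    unfolding Suc.IH by (simp add: algebra_simps)
  finally show ?case .
qed

lemma bessel_clifford_three_halves_sums:
  fixes u :: real
  shows "(\<lambda>m. 1 / (fact m * Gamma (3 / 2 + real m)) * u ^ (2 * m + 1)) sums (sinh (2 * u) / sqrt pi)"
proof -
  have "(\<lambda>n. (if even n then 0 else (2 * u) ^ n /\<^sub>R fact n) / sqrt pi) sums (sinh (2 * u) / sqrt pi)"
    by (intro sums_divide sinh_converges)
  then have "(\<lambda>m. (if even (2 * m + 1) then 0 else (2 * u) ^ (2 * m + 1) /\<^sub>R fact (2 * m + 1)) / sqrt pi) sums (sinh (2 * u) / sqrt pi)"
    by (subst sums_mono_reindex[where g="\<lambda>m. 2 * m + 1"])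
      (auto simp: strict_mono_def elim!: oddE)
  moreover have "(if even (2 * m + 1) then 0 else (2 * u) ^ (2 * m + 1) /\<^sub>R fact (2 * m + 1)) / sqrt pi
      = 1 / (fact m * Gamma (3 / 2 + real m)) * u ^ (2 * m + 1)" for m
  proof -
    have G: "Gamma (3 / 2 + real m) > 0" by (intro Gamma_real_pos) auto
    have "(2 * u) ^ (2 * m + 1) / (sqrt pi * fact (2 * m + 1)) = u ^ (2 * m + 1) / (Gamma (3 / 2 + real m) * fact m)"
      unfolding Gamma_half_integer[symmetric] power_mult_distrib using G by (simp del: power_Suc)
    then show ?thesis by (simp add: inverse_eq_divide mult_ac del: fact_Suc power_Suc)
  qed
  ultimately show ?thesis by simp
qed

lemma nn_integral_beta_kernel:
  assumes "a > 0" "b > 0"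
  shows "(\<integral>\<^sup>+ s. ennreal (indicator {0..1} s * (s powr (a - 1) * (1 - s) powr (b - 1))) \<partial>lborel) = ennreal (Beta a b)"
  using nn_integral_has_integral_lebesgue[OF _ has_integral_Beta_real[OF assms]] by simp

text \<open>
  Sonine's integral: averaging order \<open>3 / 2\<close>, which is elementary, against a beta kernel raises the
  order by \<open>\<nu>\<close>. Term by term it is the beta integral, and all terms are nonnegative. Starting from
  order \<open>3 / 2\<close> rather than \<open>1 / 2\<close> keeps the integrand bounded at \<open>s = 1\<close>.
\<close>

lemma bessel_clifford_integral:
  fixes \<nu> y :: real
  assumes \<nu>: "\<nu> > 0" and y: "y > 0"
  shows "(\<integral>\<^sup>+ s. ennreal (indicator {0..1} s * (s powr (\<nu> - 1) * sinh (2 * y * sqrt (1 - s)))) \<partial>lborel)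
    = ennreal (sqrt pi * y * Gamma \<nu> * bessel_clifford (3 / 2 + \<nu>) (y\<^sup>2))"
proof -
  define C where "C m = sqrt pi / (fact m * Gamma (3 / 2 + real m)) * y ^ (2 * m + 1)" for m
  have G: "Gamma (3 / 2 + real m) > 0" "Gamma (3 / 2 + \<nu> + real m) > 0" "Gamma \<nu> > 0" for m
    using \<nu> by (auto intro!: Gamma_real_pos)
  have C0: "C m \<ge> 0" for m using y G(1)[of m] by (simp add: C_def)
  have pw: "ennreal (indicator {0..1} s * (s powr (\<nu> - 1) * sinh (2 * y * sqrt (1 - s))))
      = (\<Sum>m. ennreal (C m) * ennreal (indicator {0..1} s * (s powr (\<nu> - 1) * (1 - s) powr (3 / 2 + real m - 1))))" for s
  proof (cases "s \<in> {0..1}")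
    case True
    define u where "u = y * sqrt (1 - s)"
    have p: "(sqrt (1 - s)) ^ (2 * m + 1) = (1 - s) powr (3 / 2 + real m - 1)" for m
    proof (cases "s = 1")
      case False
      then have "1 - s > 0" using True by simp
      then have "(sqrt (1 - s)) ^ (2 * m + 1) = ((1 - s) powr (1 / 2)) powr (real (2 * m + 1))"
        by (subst powr_realpow) (auto simp: powr_half_sqrt)
      also have "\<dots> = (1 - s) powr (1 / 2 * real (2 * m + 1))" by (rule powr_powr)
      also have "1 / 2 * real (2 * m + 1) = 3 / 2 + real m - 1" by simp
      finally show ?thesis .
    qed simp
    have summand: "s powr (\<nu> - 1) * sqrt pi * (1 / (fact m * Gamma (3 / 2 + real m)) * u ^ (2 * m + 1))
        = C m * (s powr (\<nu> - 1) * (1 - s) powr (3 / 2 + real m - 1))" for m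
      unfolding u_def power_mult_distrib p C_def by simp
    have "(\<lambda>m. s powr (\<nu> - 1) * sqrt pi * (1 / (fact m * Gamma (3 / 2 + real m)) * u ^ (2 * m + 1)))
        sums (s powr (\<nu> - 1) * sqrt pi * (sinh (2 * u) / sqrt pi))"
      by (intro sums_mult bessel_clifford_three_halves_sums)
    then have "(\<lambda>m. C m * (s powr (\<nu> - 1) * (1 - s) powr (3 / 2 + real m - 1))) sums (s powr (\<nu> - 1) * sinh (2 * u))"
      unfolding summand by simp
    then have "(\<Sum>m. ennreal (C m * (s powr (\<nu> - 1) * (1 - s) powr (3 / 2 + real m - 1)))) = ennreal (s powr (\<nu> - 1) * sinh (2 * u))"
      using C0 by (subst suminf_ennreal2) (auto simp: sums_iff)
    then show ?thesis using True C0 by (simp add: u_def ennreal_mult mult.assoc)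
  next
    case False
    then have "indicator {0..1} s = (0 :: real)" by (rule indicator_simps)
    then show ?thesis by (simp only: mult_zero_left mult_zero_right ennreal_0 suminf_zero)
  qed
  have sm: "summable (\<lambda>m. (y\<^sup>2) ^ m / (fact m * Gamma (3 / 2 + \<nu> + real m)))"
    using \<nu> y by (intro bessel_clifford_summable) auto
  have "(\<integral>\<^sup>+ s. ennreal (indicator {0..1} s * (s powr (\<nu> - 1) * sinh (2 * y * sqrt (1 - s)))) \<partial>lborel)
     = (\<Sum>m. \<integral>\<^sup>+ s. ennreal (C m) * ennreal (indicator {0..1} s * (s powr (\<nu> - 1) * (1 - s) powr (3 / 2 + real m - 1))) \<partial>lborel)"
    unfolding pw by (rule nn_integral_suminf) measurable
  also have "\<dots> = (\<Sum>m. ennreal (sqrt pi * y * Gamma \<nu> * ((y\<^sup>2) ^ m / (fact m * Gamma (3 / 2 + \<nu> + real m)))))"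
  proof (rule arg_cong[where f=suminf], rule ext)
    fix m
    have "(\<integral>\<^sup>+ s. ennreal (C m) * ennreal (indicator {0..1} s * (s powr (\<nu> - 1) * (1 - s) powr (3 / 2 + real m - 1))) \<partial>lborel)
        = ennreal (C m) * ennreal (Beta \<nu> (3 / 2 + real m))"
      using \<nu> by (subst nn_integral_cmult, measurable) (subst nn_integral_beta_kernel, auto)
    also have "\<dots> = ennreal (C m * Beta \<nu> (3 / 2 + real m))"
      using C0[of m] by (simp add: ennreal_mult')
    also have "C m * Beta \<nu> (3 / 2 + real m) = sqrt pi * y * Gamma \<nu> * ((y\<^sup>2) ^ m / (fact m * Gamma (3 / 2 + \<nu> + real m)))"
    proof -
      have e: "3 / 2 + \<nu> + real m = \<nu> + (3 / 2 + real m)" by simp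
      have "Gamma (3 / 2 + real m) \<noteq> 0" using G(1)[of m] by (simp only: less_imp_neq[symmetric] not_False_eq_True)
      then show ?thesis unfolding C_def Beta_def e by (simp add: power_mult del: of_nat_add)
    qed
    finally show "(\<integral>\<^sup>+ s. ennreal (C m) * ennreal (indicator {0..1} s * (s powr (\<nu> - 1) * (1 - s) powr (3 / 2 + real m - 1))) \<partial>lborel)
        = ennreal (sqrt pi * y * Gamma \<nu> * ((y\<^sup>2) ^ m / (fact m * Gamma (3 / 2 + \<nu> + real m))))" .
  qed
  also have "\<dots> = ennreal (\<Sum>m. sqrt pi * y * Gamma \<nu> * ((y\<^sup>2) ^ m / (fact m * Gamma (3 / 2 + \<nu> + real m))))"
  proof (rule suminf_ennreal2)
    show "summable (\<lambda>m. sqrt pi * y * Gamma \<nu> * ((y\<^sup>2) ^ m / (fact m * Gamma (3 / 2 + \<nu> + real m))))"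
      by (rule summable_mult[OF sm])
    show "0 \<le> sqrt pi * y * Gamma \<nu> * ((y\<^sup>2) ^ m / (fact m * Gamma (3 / 2 + \<nu> + real m)))" for m
      using G(2)[of m] G(3) y by simp
  qed
  also have "(\<Sum>m. sqrt pi * y * Gamma \<nu> * ((y\<^sup>2) ^ m / (fact m * Gamma (3 / 2 + \<nu> + real m))))
      = sqrt pi * y * Gamma \<nu> * bessel_clifford (3 / 2 + \<nu>) (y\<^sup>2)"
    unfolding bessel_clifford_def by (rule suminf_mult[OF sm])
  finally show ?thesis .
qed

text \<open>
  Watson's lemma in explicit form: the integral is governed by small \<open>s\<close>, where
  \<open>sqrt (1 - s)\<close> is squeezed between \<open>1 - s / 2 - s\<^sup>2 / 2\<close> and \<open>1 - s / 2\<close>. The bound is stated for all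
  \<open>s \<ge> 0\<close>, so that it can be integrated against complete Gamma kernels.
\<close>

lemma sinh_kernel_bounds:
  fixes y s :: real
  assumes y: "y \<ge> 1" and s: "s \<ge> 0"
  defines "F \<equiv> indicator {0..1} s * (2 * exp (- 2 * y) * sinh (2 * y * sqrt (1 - s)))"
  shows "F \<le> exp (- y * s)" "exp (- y * s) \<le> F + (y * s\<^sup>2 * exp (- y * s) + indicator {0..1} s * exp (- 2 * y))"
proof -
  show "F \<le> exp (- y * s)"
  proof (cases "s \<le> 1")
    case True
    define w where "w = sqrt (1 - s)"
    have w: "w \<ge> 0" "w\<^sup>2 = 1 - s" using True by (auto simp: w_def)
    have "w \<le> 1 - s / 2"
    proof -
      have "0 \<le> (1 - w)\<^sup>2" by simp
      then show ?thesis using w(2) by (simp add: power2_eq_square algebra_simps)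
    qed
    then have "y * w \<le> y * (1 - s / 2)" using y by (intro mult_left_mono) auto
    then have "2 * y * w - 2 * y \<le> - y * s" by (simp add: algebra_simps)
    then have "exp (2 * y * w - 2 * y) \<le> exp (- y * s)" by simp
    moreover have "F = exp (2 * y * w - 2 * y) - exp (- 2 * y - 2 * y * w)"
      unfolding F_def using True s by (simp add: sinh_def w_def exp_diff exp_minus field_simps)
    ultimately show ?thesis using exp_gt_zero[of "- 2 * y - 2 * y * w"] by linarith
  qed (simp add: F_def)
  show "exp (- y * s) \<le> F + (y * s\<^sup>2 * exp (- y * s) + indicator {0..1} s * exp (- 2 * y))"
  proof (cases "s \<le> 1")
    case True
    define w where "w = sqrt (1 - s)"
    have w: "w \<ge> 0" "w\<^sup>2 = 1 - s" using True by (auto simp: w_def)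
    have "w \<ge> 1 - s / 2 - s\<^sup>2 / 2"
    proof -
      have sw: "s = 1 - w\<^sup>2" using w(2) by simp
      have "w - (1 - s / 2 - s\<^sup>2 / 2) = w * (1 - w)\<^sup>2 * (2 + w) / 2"
        unfolding sw by (simp add: power2_eq_square field_simps)
      then show ?thesis using w(1) by (metis diff_ge_0_iff_ge divide_nonneg_nonneg mult_nonneg_nonneg zero_le_power2 add_nonneg_nonneg zero_le_numeral)
    qed
    then have "y * w \<ge> y * (1 - s / 2 - s\<^sup>2 / 2)" using y by (intro mult_left_mono) auto
    then have "2 * y * w - 2 * y \<ge> - y * s - y * s\<^sup>2" by (simp add: algebra_simps)
    then have "exp (2 * y * w - 2 * y) \<ge> exp (- y * s) * exp (- y * s\<^sup>2)"
      by (simp add: exp_add[symmetric])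
    moreover have "exp (- y * s) * exp (- y * s\<^sup>2) \<ge> exp (- y * s) * (1 - y * s\<^sup>2)"
      using exp_ge_add_one_self[of "- y * s\<^sup>2"] by (intro mult_left_mono) auto
    moreover have "F = exp (2 * y * w - 2 * y) - exp (- 2 * y - 2 * y * w)"
      unfolding F_def using True s by (simp add: sinh_def w_def exp_diff exp_minus field_simps)
    moreover have "exp (- 2 * y - 2 * y * w) \<le> exp (- 2 * y)" using w y by simp
    ultimately have "exp (- y * s) * (1 - y * s\<^sup>2) \<le> F + exp (- 2 * y)" by linarith
    then show ?thesis using True s by (simp add: algebra_simps)
  next
    case False
    then have "1 * 1 \<le> y * s\<^sup>2" using y by (intro mult_mono) auto
    then have "1 * exp (- y * s) \<le> y * s\<^sup>2 * exp (- y * s)" by (intro mult_right_mono) auto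
    then show ?thesis using False by (simp add: F_def)
  qed
qed

text \<open>
  The Bessel--Clifford function divided by its leading asymptotic term.
\<close>

definition bessel_ratio :: "real \<Rightarrow> real \<Rightarrow> real" where
  "bessel_ratio a y = 2 * sqrt pi * y powr (a - 1 / 2) * exp (- 2 * y) * bessel_clifford a (y\<^sup>2)"

lemma bessel_ratio_bounds:
  fixes \<nu> y :: real
  assumes \<nu>: "\<nu> > 0" and y: "y \<ge> 1"
  shows "bessel_ratio (3 / 2 + \<nu>) y \<le> 1"
    "1 \<le> bessel_ratio (3 / 2 + \<nu>) y + (\<nu> * (\<nu> + 1) / y + y powr \<nu> * exp (- 2 * y) / (\<nu> * Gamma \<nu>))"
proof -
  define H where "H = bessel_clifford (3 / 2 + \<nu>) (y\<^sup>2)"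
  define F where "F s = indicator {0..1} s * (2 * exp (- 2 * y) * sinh (2 * y * sqrt (1 - s)))" for s :: real
  have G: "Gamma \<nu> > 0" "Gamma (\<nu> + 2) = \<nu> * (\<nu> + 1) * Gamma \<nu>"
    using \<nu> Gamma_real_add_one[of \<nu>] Gamma_real_add_one[of "\<nu> + 1"] by (auto simp: add_ac intro!: Gamma_real_pos)
  have H0: "H \<ge> 0" unfolding H_def using \<nu> by (intro bessel_clifford_nonneg) auto
  have [measurable]: "F \<in> borel_measurable borel" unfolding F_def sinh_def by measurable
  have F0: "F s \<ge> 0" for s
    using y by (auto simp: F_def indicator_def intro!: mult_nonneg_nonneg)
  have IF: "(\<integral>\<^sup>+ s. ennreal (indicator {0<..} s * s powr (\<nu> - 1) * F s) \<partial>lborel)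
      = ennreal (2 * exp (- 2 * y) * (sqrt pi * y * Gamma \<nu> * H))" (is "?I = _")
  proof -
    have "?I = (\<integral>\<^sup>+ s. ennreal (2 * exp (- 2 * y)) * ennreal (indicator {0..1} s * (s powr (\<nu> - 1) * sinh (2 * y * sqrt (1 - s)))) \<partial>lborel)"
    proof (rule nn_integral_cong)
      fix s :: real
      have eq: "indicator {0<..} s * s powr (\<nu> - 1) * F s = 2 * exp (- 2 * y) * (indicator {0..1} s * (s powr (\<nu> - 1) * sinh (2 * y * sqrt (1 - s))))"
        by (cases "s > 0"; cases "s = 0"; simp add: F_def indicator_def)
      show "ennreal (indicator {0<..} s * s powr (\<nu> - 1) * F s) = ennreal (2 * exp (- 2 * y)) * ennreal (indicator {0..1} s * (s powr (\<nu> - 1) * sinh (2 * y * sqrt (1 - s))))"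
        unfolding eq by (rule ennreal_mult') simp
    qed
    also have "\<dots> = ennreal (2 * exp (- 2 * y)) * ennreal (sqrt pi * y * Gamma \<nu> * H)"
    proof -
      have [measurable]: "(\<lambda>s. sinh (2 * y * sqrt (1 - s))) \<in> borel_measurable borel"
        unfolding sinh_def by measurable
      have "y > 0" using y by simp
      then show ?thesis
        unfolding H_def bessel_clifford_integral[OF \<nu> \<open>y > 0\<close>, symmetric] by (intro nn_integral_cmult) measurable
    qed
    also have "\<dots> = ennreal (2 * exp (- 2 * y) * (sqrt pi * y * Gamma \<nu> * H))"
      by (rule ennreal_mult'[symmetric]) simp
    finally show ?thesis .
  qed
  have IG: "(\<integral>\<^sup>+ s. ennreal (indicator {0<..} s * s powr (\<nu> - 1) * exp (- y * s)) \<partial>lborel) = ennreal (Gamma \<nu> * y powr (- \<nu>))"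
    using \<nu> y by (intro nn_integral_gamma_kernel) auto
  have IE: "(\<integral>\<^sup>+ s. ennreal (indicator {0<..} s * s powr (\<nu> + 2 - 1) * exp (- y * s)) \<partial>lborel) = ennreal (Gamma (\<nu> + 2) * y powr (- (\<nu> + 2)))"
    using \<nu> y by (intro nn_integral_gamma_kernel) auto
  have IB: "(\<integral>\<^sup>+ s. ennreal (indicator {0..1} s * (s powr (\<nu> - 1) * (1 - s) powr (1 - 1))) \<partial>lborel) = ennreal (1 / \<nu>)"
  proof -
    have "Gamma \<nu> \<noteq> 0" using G(1) by simp
    moreover have "g * 1 / (\<nu> * g) = 1 / \<nu>" if "g \<noteq> 0" for g :: real using that by simp
    ultimately have "Beta \<nu> 1 = 1 / \<nu>"
      unfolding Beta_def Gamma_real_add_one[OF \<nu>] Gamma_1 by blast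
    then show ?thesis using \<nu> by (subst nn_integral_beta_kernel) auto
  qed
  have ratio: "bessel_ratio (3 / 2 + \<nu>) y = 2 * exp (- 2 * y) * (sqrt pi * y * Gamma \<nu> * H) * (y powr \<nu> / Gamma \<nu>)"
    using y G(1) unfolding bessel_ratio_def H_def by (simp add: powr_add)
  have one: "Gamma \<nu> * y powr (- \<nu>) * (y powr \<nu> / Gamma \<nu>) = 1"
    using y G(1) by (simp add: powr_minus)
  have pos: "y powr \<nu> / Gamma \<nu> \<ge> 0" using G(1) by simp
  have kb: "F s \<le> exp (- y * s)" if "s \<ge> 0" for s
    unfolding F_def by (rule sinh_kernel_bounds(1)[OF y that])
  have kb2: "exp (- y * s) \<le> F s + (y * s\<^sup>2 * exp (- y * s) + indicator {0..1} s * exp (- 2 * y))" if "s \<ge> 0" for s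
    unfolding F_def by (rule sinh_kernel_bounds(2)[OF y that])
  have "?I \<le> (\<integral>\<^sup>+ s. ennreal (indicator {0<..} s * s powr (\<nu> - 1) * exp (- y * s)) \<partial>lborel)"
    by (intro nn_integral_mono ennreal_leI) (auto simp: indicator_def intro!: mult_left_mono kb[simplified])
  then have "2 * exp (- 2 * y) * (sqrt pi * y * Gamma \<nu> * H) \<le> Gamma \<nu> * y powr (- \<nu>)"
    unfolding IF IG using G(1) by (subst (asm) ennreal_le_iff) auto
  from mult_right_mono[OF this pos] show "bessel_ratio (3 / 2 + \<nu>) y \<le> 1"
    unfolding ratio one .
  have "(\<integral>\<^sup>+ s. ennreal (indicator {0<..} s * s powr (\<nu> - 1) * exp (- y * s)) \<partial>lborel)
     \<le> (\<integral>\<^sup>+ s. ennreal (indicator {0<..} s * s powr (\<nu> - 1) * F s)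
            + (ennreal y * ennreal (indicator {0<..} s * s powr (\<nu> + 2 - 1) * exp (- y * s))
              + ennreal (exp (- 2 * y)) * ennreal (indicator {0..1} s * (s powr (\<nu> - 1) * (1 - s) powr (1 - 1)))) \<partial>lborel)"
  proof (rule nn_integral_mono)
    fix s :: real
    show "ennreal (indicator {0<..} s * s powr (\<nu> - 1) * exp (- y * s)) \<le> ennreal (indicator {0<..} s * s powr (\<nu> - 1) * F s)
            + (ennreal y * ennreal (indicator {0<..} s * s powr (\<nu> + 2 - 1) * exp (- y * s))
              + ennreal (exp (- 2 * y)) * ennreal (indicator {0..1} s * (s powr (\<nu> - 1) * (1 - s) powr (1 - 1))))"
    proof (cases "s > 0")
      case True
      have p: "s powr (\<nu> + 2 - 1) = s powr (\<nu> - 1) * s\<^sup>2"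
        using True by (simp add: powr_add[symmetric] flip: powr_numeral)
      have q: "indicator {0..1} s * (s powr (\<nu> - 1) * (1 - s) powr (1 - 1)) \<ge> s powr (\<nu> - 1) * (if s < 1 then 1 else 0)"
        using True by (auto simp: indicator_def)
      have "exp (- y * s) \<le> F s + (y * s\<^sup>2 * exp (- y * s) + (if s < 1 then exp (- 2 * y) else 0))"
      proof (cases "s < 1")
        case True
        then show ?thesis using kb2[of s] \<open>s > 0\<close> by simp
      next
        case False
        then have "1 * 1 \<le> y * s\<^sup>2" using y by (intro mult_mono) auto
        then have "1 * exp (- y * s) \<le> y * s\<^sup>2 * exp (- y * s)" by (intro mult_right_mono) auto
        moreover have "(if s < 1 then exp (- 2 * y) else 0) = 0" using False by simp
        ultimately show ?thesis using F0[of s] by linarith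
      qed
      then have "s powr (\<nu> - 1) * exp (- y * s) \<le> s powr (\<nu> - 1) * (F s + (y * s\<^sup>2 * exp (- y * s) + (if s < 1 then exp (- 2 * y) else 0)))"
        by (intro mult_left_mono) auto
      also have "\<dots> = s powr (\<nu> - 1) * F s + (y * (s powr (\<nu> + 2 - 1) * exp (- y * s)) + exp (- 2 * y) * (s powr (\<nu> - 1) * (if s < 1 then 1 else 0)))"
        unfolding p by (simp add: algebra_simps)
      also have "\<dots> \<le> s powr (\<nu> - 1) * F s + (y * (s powr (\<nu> + 2 - 1) * exp (- y * s)) + exp (- 2 * y) * (indicator {0..1} s * (s powr (\<nu> - 1) * (1 - s) powr (1 - 1))))"
        using q by (intro add_left_mono mult_left_mono) auto
      finally show ?thesis
        using True y F0[of s]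
        by (simp add: ennreal_mult'[symmetric] ennreal_plus[symmetric] del: ennreal_plus)
    qed simp
  qed
  also have "\<dots> = ennreal (2 * exp (- 2 * y) * (sqrt pi * y * Gamma \<nu> * H))
       + (ennreal y * ennreal (Gamma (\<nu> + 2) * y powr (- (\<nu> + 2))) + ennreal (exp (- 2 * y)) * ennreal (1 / \<nu>))"
    unfolding IF[symmetric] IE[symmetric] IB[symmetric]
    by (subst nn_integral_add, measurable, subst nn_integral_add, measurable, subst nn_integral_cmult, measurable, subst nn_integral_cmult, measurable)
  also have "\<dots> = ennreal (2 * exp (- 2 * y) * (sqrt pi * y * Gamma \<nu> * H) + (y * (Gamma (\<nu> + 2) * y powr (- (\<nu> + 2))) + exp (- 2 * y) * (1 / \<nu>)))"
    using G \<nu> y H0 by (simp add: ennreal_mult'[symmetric] ennreal_plus[symmetric] del: ennreal_plus)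
  finally have "Gamma \<nu> * y powr (- \<nu>) \<le> 2 * exp (- 2 * y) * (sqrt pi * y * Gamma \<nu> * H) + (y * (Gamma (\<nu> + 2) * y powr (- (\<nu> + 2))) + exp (- 2 * y) * (1 / \<nu>))"
    unfolding IG using G \<nu> y H0 by (subst (asm) ennreal_le_iff) auto
  from mult_right_mono[OF this pos]
  have "1 \<le> bessel_ratio (3 / 2 + \<nu>) y + (y * (Gamma (\<nu> + 2) * y powr (- (\<nu> + 2))) + exp (- 2 * y) * (1 / \<nu>)) * (y powr \<nu> / Gamma \<nu>)"
    unfolding ratio one by (simp only: distrib_right)
  also have "(y * (Gamma (\<nu> + 2) * y powr (- (\<nu> + 2))) + exp (- 2 * y) * (1 / \<nu>)) * (y powr \<nu> / Gamma \<nu>)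
     = \<nu> * (\<nu> + 1) / y + y powr \<nu> * exp (- 2 * y) / (\<nu> * Gamma \<nu>)"
  proof -
    have yp: "y * y powr (- (\<nu> + 2)) * y powr \<nu> = 1 / y"
      using y by (simp add: powr_diff powr_minus powr_add power2_eq_square field_simps)
    have cancel: "(y * (\<nu> * (\<nu> + 1) * g * P)) * (Q / g) = \<nu> * (\<nu> + 1) * (y * P * Q)" if "g > 0" for g P Q :: real
      using that by simp
    have "(y * (Gamma (\<nu> + 2) * y powr (- (\<nu> + 2)))) * (y powr \<nu> / Gamma \<nu>) = \<nu> * (\<nu> + 1) / y"
      unfolding G(2) cancel[OF G(1)] yp by simp
    then show ?thesis unfolding distrib_right by (simp add: field_simps)
  qed
  finally show "1 \<le> bessel_ratio (3 / 2 + \<nu>) y + (\<nu> * (\<nu> + 1) / y + y powr \<nu> * exp (- 2 * y) / (\<nu> * Gamma \<nu>))" .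
qed

text \<open>
  The three-term recurrence of the Bessel functions; it carries the asymptotics down to orders up to
  \<open>3 / 2\<close>, which Sonine's integral does not reach.
\<close>

lemma bessel_clifford_recurrence:
  assumes a: "a > 0" and z: "z \<ge> 0"
  shows "bessel_clifford a z = a * bessel_clifford (a + 1) z + z * bessel_clifford (a + 2) z"
proof -
  define t where "t b m = z ^ m / (fact m * Gamma (b + real m))" for b :: real and m
  have s: "t b sums bessel_clifford b z" if "b > 0" for b
    unfolding t_def bessel_clifford_def using bessel_clifford_summable[OF that z] by (simp add: summable_sums)
  have G: "Gamma (a + real m) > 0" "Gamma (a + 1 + real m) = (a + real m) * Gamma (a + real m)" for m
    using a Gamma_real_add_one[of "a + real m"] by (auto simp: add_ac intro!: Gamma_real_pos)
  have split: "t a m = a * t (a + 1) m + real m * t (a + 1) m" for m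
  proof -
    have "a + real m \<noteq> 0" using a by linarith
    then have "t a m = (a + real m) * t (a + 1) m"
      unfolding t_def G(2) by simp
    then show ?thesis by (simp only: distrib_right)
  qed
  have shift: "real (Suc m) * t (a + 1) (Suc m) = z * t (a + 2) m" for m
  proof -
    have e: "a + 1 + real (Suc m) = a + 2 + real m" by simp
    show ?thesis unfolding t_def e by (simp del: of_nat_Suc)
  qed
  have "(\<lambda>m. real (Suc m) * t (a + 1) (Suc m)) sums (z * bessel_clifford (a + 2) z)"
    unfolding shift using a by (intro sums_mult s) simp
  then have "(\<lambda>m. real m * t (a + 1) m) sums (z * bessel_clifford (a + 2) z)"
    by (subst (asm) sums_Suc_iff) simp
  moreover have "(\<lambda>m. a * t (a + 1) m) sums (a * bessel_clifford (a + 1) z)"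
    using a by (intro sums_mult s) simp
  ultimately have "t a sums (a * bessel_clifford (a + 1) z + z * bessel_clifford (a + 2) z)"
    using sums_add unfolding split[abs_def] by blast
  then show ?thesis using s[OF a] sums_unique2 by blast
qed

text \<open>
  In normalised form the recurrence reads \<open>R\<^sub>a = (a / y) R\<^sub>a\<^sub>+\<^sub>1 + R\<^sub>a\<^sub>+\<^sub>2\<close>: the first term is \<open>O(1 / y)\<close>, and the
  second has an order to which the explicit bounds apply.
\<close>

lemma bessel_ratio_asymptotics:
  assumes a: "a > 1 / 2"
  shows "\<exists>K. \<forall>\<^sub>F y in at_top. \<bar>bessel_ratio a y - 1\<bar> \<le> K / y"
proof -
  \<comment> \<open>Order \<open>a + 2 = 3 / 2 + \<nu>\<close>.\<close>
  define \<nu> where "\<nu> = a + 1 / 2"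
  have \<nu>: "\<nu> > 0" using a by (simp add: \<nu>_def)
  have G: "Gamma \<nu> > 0" using \<nu> by (rule Gamma_real_pos)
  define K where "K = a + \<nu> * (\<nu> + 1) + 1"
  have "((\<lambda>y::real. y powr (\<nu> + 1) * exp (- 2 * y)) \<longlongrightarrow> 0) at_top" by real_asymp
  then have "((\<lambda>y. y powr (\<nu> + 1) * exp (- 2 * y) / (\<nu> * Gamma \<nu>)) \<longlongrightarrow> 0) at_top"
    by (rule tendsto_divide_zero)
  then have "\<forall>\<^sub>F y in at_top. y powr (\<nu> + 1) * exp (- 2 * y) / (\<nu> * Gamma \<nu>) < 1"
    by (rule order_tendstoD) simp
  then have "\<forall>\<^sub>F y in at_top. \<bar>bessel_ratio a y - 1\<bar> \<le> K / y"
    using eventually_ge_at_top[of 1]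
  proof eventually_elim
    case (elim y)
    have e1: "a + 1 = 3 / 2 + (a - 1 / 2)" and e2: "a + 2 = 3 / 2 + \<nu>" by (simp_all add: \<nu>_def)
    have r1: "0 \<le> bessel_ratio (a + 1) y" "bessel_ratio (a + 1) y \<le> 1"
      using bessel_ratio_bounds(1)[of "a - 1 / 2" y] a elim(2) unfolding e1
      by (auto simp: bessel_ratio_def intro!: mult_nonneg_nonneg bessel_clifford_nonneg)
    have r2: "bessel_ratio (a + 2) y \<le> 1"
      "1 \<le> bessel_ratio (a + 2) y + (\<nu> * (\<nu> + 1) / y + y powr \<nu> * exp (- 2 * y) / (\<nu> * Gamma \<nu>))"
      unfolding e2 using bessel_ratio_bounds[OF \<nu> elim(2)] by blast+
    have small: "y powr \<nu> * exp (- 2 * y) / (\<nu> * Gamma \<nu>) \<le> 1 / y"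
      using elim by (simp add: powr_add field_simps)
    have rec: "bessel_ratio a y = a / y * bessel_ratio (a + 1) y + bessel_ratio (a + 2) y"
    proof -
      have p1: "y powr (a + 1 - 1 / 2) = y powr (a - 1 / 2) * y" and p2: "y powr (a + 2 - 1 / 2) = y powr (a - 1 / 2) * y\<^sup>2"
        using elim(2) powr_add[of y "a - 1 / 2" 1] powr_add[of y "a - 1 / 2" 2] by (simp_all add: algebra_simps)
      show ?thesis
        unfolding bessel_ratio_def p1 p2 using a elim(2)
        by (subst bessel_clifford_recurrence) (auto simp: field_simps)
    qed
    have "0 \<le> a / y * bessel_ratio (a + 1) y" using r1 a elim(2) by simp
    moreover have "a / y * bessel_ratio (a + 1) y \<le> a / y * 1" using r1 a elim(2) by (intro mult_left_mono) auto
    moreover have "K / y = a / y + \<nu> * (\<nu> + 1) / y + 1 / y" by (simp add: K_def add_divide_distrib)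
    moreover have "0 \<le> 1 / y" "0 \<le> a / y" "0 \<le> \<nu> * (\<nu> + 1) / y" using elim(2) a \<nu> by auto
    ultimately show ?case using r2 small unfolding rec by linarith
  qed
  then show ?thesis by blast
qed

section \<open>Corner probabilities of Kibble's law\<close>

lemma abs_exp_minus_one_le: "\<bar>exp x - 1\<bar> \<le> \<bar>x\<bar> * exp (max x 0)" for x :: real
proof (cases "x \<ge> 0")
  case True
  have "exp x * (1 - x) \<le> exp x * exp (- x)"
    using exp_ge_add_one_self[of "- x"] by (intro mult_left_mono) auto
  then have "exp x - 1 \<le> x * exp x" by (simp add: exp_minus algebra_simps)
  then show ?thesis using True by simp
next
  case False
  then have "\<bar>exp x - 1\<bar> = 1 - exp x" "\<bar>x\<bar> * exp (max x 0) = - x" by (auto simp: max_def)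
  then show ?thesis using exp_ge_add_one_self[of x] by linarith
qed

text \<open>
  Absorbs the polynomial error at the corner into a slightly weaker exponential decay.
\<close>

lemma linear_quadratic_le_exp:
  fixes k u :: real
  assumes "k > 0" "u \<ge> 0"
  shows "u + u\<^sup>2 \<le> (1 / k + 2 / k\<^sup>2) * exp (k * u)"
proof -
  have "k * u \<le> exp (k * u)" using exp_ge_add_one_self[of "k * u"] by linarith
  then have "u \<le> 1 / k * exp (k * u)" using assms by (simp add: field_simps)
  moreover have "(k * u)\<^sup>2 / 2 \<le> exp (k * u)"
  proof -
    have "0 \<le> k * u" using assms by simp
    then show ?thesis using exp_lower_Taylor_quadratic[of "k * u"] by linarith
  qed
  then have "u\<^sup>2 \<le> 2 / k\<^sup>2 * exp (k * u)" using assms by (simp add: field_simps)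
  ultimately show ?thesis by (simp add: distrib_right)
qed

lemma nn_integral_shifted_exp:
  fixes l X :: real
  assumes l: "l > 0"
  shows "(\<integral>\<^sup>+ x. ennreal (indicator {X<..} x * exp (- l * (x - X))) \<partial>lborel) = ennreal (1 / l)"
proof -
  have "(\<integral>\<^sup>+ x. ennreal (indicator {X<..} x * exp (- l * (x - X))) \<partial>lborel)
      = ennreal \<bar>1\<bar> * (\<integral>\<^sup>+ x. ennreal (indicator {X<..} (X + 1 * x) * exp (- l * ((X + 1 * x) - X))) \<partial>lborel)"
    by (rule nn_integral_real_affine) auto
  also have "\<dots> = (\<integral>\<^sup>+ x. ennreal (indicator {0<..} x * x powr (1 - 1) * exp (- l * x)) \<partial>lborel)"
    by (simp, intro nn_integral_cong) (auto simp: indicator_def)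
  also have "\<dots> = ennreal (Gamma 1 * l powr (- 1))"
    using l by (intro nn_integral_gamma_kernel) auto
  finally show ?thesis using l by (simp add: powr_minus divide_inverse)
qed

lemma nn_integral_corner_exp:
  fixes l m X Y :: real
  assumes "l > 0" "m > 0"
  shows "(\<integral>\<^sup>+ v. ennreal (indicator ({X<..} \<times> {Y<..}) v * exp (- l * (fst v - X) - m * (snd v - Y))) \<partial>plane)
    = ennreal (1 / (l * m))"
proof -
  have "(\<integral>\<^sup>+ v. ennreal (indicator ({X<..} \<times> {Y<..}) v * exp (- l * (fst v - X) - m * (snd v - Y))) \<partial>plane)
     = (\<integral>\<^sup>+ v. ennreal (indicator {X<..} (fst v) * exp (- l * (fst v - X))) * ennreal (indicator {Y<..} (snd v) * exp (- m * (snd v - Y))) \<partial>plane)"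
  proof (rule nn_integral_cong)
    fix v :: "real \<times> real"
    have "exp (- l * (fst v - X) - m * (snd v - Y)) = exp (- l * (fst v - X)) * exp (- m * (snd v - Y))"
      by (simp add: exp_add[symmetric])
    then show "ennreal (indicator ({X<..} \<times> {Y<..}) v * exp (- l * (fst v - X) - m * (snd v - Y)))
       = ennreal (indicator {X<..} (fst v) * exp (- l * (fst v - X))) * ennreal (indicator {Y<..} (snd v) * exp (- m * (snd v - Y)))"
      by (cases v) (auto simp: ennreal_mult'[symmetric] indicator_def)
  qed
  also have "\<dots> = ennreal (1 / l) * ennreal (1 / m)"
    using nn_integral_product[of "\<lambda>x. ennreal (indicator {X<..} x * exp (- l * (x - X)))" "\<lambda>y. ennreal (indicator {Y<..} y * exp (- m * (y - Y)))"]
    by (simp only: nn_integral_shifted_exp[OF assms(1)] nn_integral_shifted_exp[OF assms(2)]) simp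
  also have "\<dots> = ennreal (1 / (l * m))" using assms by (simp add: ennreal_mult'[symmetric])
  finally show ?thesis .
qed

text \<open>
  The leading term of the density at the corner \<open>(X, \<rho>\<^sup>2 X)\<close>.
\<close>

definition corner_mass :: "real \<Rightarrow> real \<Rightarrow> real \<Rightarrow> real \<Rightarrow> real" where
  "corner_mass a c \<rho> X = (1 - c\<^sup>2) powr a * c powr (1 / 2 - a) / (2 * sqrt pi * Gamma a)
     * (\<rho> * X) powr (a - 3 / 2) * exp (- X * (1 + \<rho>\<^sup>2 - 2 * c * \<rho>))"

text \<open>
  The logarithm of the density, without the factor \<open>bessel_ratio\<close>, minus its value at the corner and
  minus the linear part of the exponent \<open>- x - y + 2 * c * sqrt (x * y)\<close> there.
  The square is the exact remainder of \<open>2 * sqrt (x * y)\<close> below its tangent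
  \<open>\<rho> * x + y / \<rho>\<close>.
\<close>

definition corner_defect :: "real \<Rightarrow> real \<Rightarrow> real \<Rightarrow> real \<Rightarrow> real \<Rightarrow> real \<Rightarrow> real" where
  "corner_defect a c \<rho> X x y =
     (a / 2 - 3 / 4) * (ln (x / X) + ln (y / (\<rho>\<^sup>2 * X))) - c * (sqrt (\<rho> * x) - sqrt (y / \<rho>))\<^sup>2"

text \<open>
  An identity, not an estimate: everything that has to be estimated later is collected in the defect
  and in the normalised Bessel--Clifford function.
\<close>

lemma kibble_density_corner:
  assumes a: "a > 0" and c: "0 < c" and \<rho>: "\<rho> > 0" and X: "X > 0" and v: "x > X" "y > \<rho>\<^sup>2 * X"
  shows "kibble_density a c (x, y) = corner_mass a c \<rho> X
     * (exp (- (1 - c * \<rho>) * (x - X) - (1 - c / \<rho>) * (y - \<rho>\<^sup>2 * X) + corner_defect a c \<rho> X x y)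
        * bessel_ratio a (c * sqrt (x * y)))"
proof -
  define Y where "Y = \<rho>\<^sup>2 * X"
  define p where "p = x * y"
  define g where "g = a / 2 - 3 / 4"
  define B where "B = (1 - c\<^sup>2) powr a / (2 * sqrt pi * Gamma a)"
  define R where "R = bessel_ratio a (c * sqrt p)"
  have Y: "Y > 0" using \<rho> X by (simp add: Y_def)
  have xy: "x > 0" "y > 0" using v X Y by (auto simp: Y_def)
  have p: "p > 0" using xy by (simp add: p_def)
  have G: "Gamma a > 0" using a by (rule Gamma_real_pos)
  have bc: "bessel_clifford a (c\<^sup>2 * p) = R * exp (2 * c * sqrt p) * (c * sqrt p) powr (1 / 2 - a) / (2 * sqrt pi)"
  proof -
    have sq: "(c * sqrt p)\<^sup>2 = c\<^sup>2 * p" using p by (simp add: power_mult_distrib)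
    have "(c * sqrt p) powr (a - 1 / 2) * (c * sqrt p) powr (1 / 2 - a) = 1"
      using c p by (simp add: powr_add[symmetric])
    moreover have "exp (- 2 * (c * sqrt p)) * exp (2 * c * sqrt p) = 1" by (simp add: exp_add[symmetric])
    moreover have "R * exp (2 * c * sqrt p) * (c * sqrt p) powr (1 / 2 - a) / (2 * sqrt pi)
      = ((c * sqrt p) powr (a - 1 / 2) * (c * sqrt p) powr (1 / 2 - a)) * (exp (- 2 * (c * sqrt p)) * exp (2 * c * sqrt p)) * bessel_clifford a (c\<^sup>2 * p)"
      unfolding R_def bessel_ratio_def sq by (simp add: field_simps)
    ultimately show ?thesis by simp
  qed
  have pp: "p powr (a - 1) * (c * sqrt p) powr (1 / 2 - a) = c powr (1 / 2 - a) * p powr g"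
  proof -
    have "(c * sqrt p) powr (1 / 2 - a) = c powr (1 / 2 - a) * p powr (1 / 2 * (1 / 2 - a))"
      using c p by (simp add: powr_mult powr_half_sqrt[symmetric] powr_powr)
    moreover have "p powr (a - 1) * p powr (1 / 2 * (1 / 2 - a)) = p powr g"
      by (simp add: powr_add[symmetric] g_def field_simps)
    ultimately show ?thesis by simp
  qed
  have pg: "p powr g = (\<rho> * X) powr (a - 3 / 2) * exp (g * (ln (x / X) + ln (y / Y)))"
  proof -
    have pX: "p = (\<rho> * X)\<^sup>2 * (x / X * (y / Y))"
      using X \<rho> by (simp add: p_def Y_def power2_eq_square)
    have "p powr g = ((\<rho> * X)\<^sup>2) powr g * (x / X * (y / Y)) powr g"
      unfolding pX by (rule powr_mult)
    moreover have "((\<rho> * X)\<^sup>2) powr g = (\<rho> * X) powr (a - 3 / 2)"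
    proof -
      have "(\<rho> * X)\<^sup>2 = (\<rho> * X) powr 2" using X \<rho> by simp
      moreover have "2 * g = a - 3 / 2" by (simp add: g_def)
      ultimately show ?thesis by (simp only: powr_powr)
    qed
    moreover have "(x / X * (y / Y)) powr g = exp (g * (ln (x / X) + ln (y / Y)))"
    proof -
      have pos: "x / X > 0" "y / Y > 0" using xy X Y by auto
      have "x / X * (y / Y) \<noteq> 0" using pos by (intro mult_pos_pos[THEN less_imp_neq, THEN not_sym])
      then have "(x / X * (y / Y)) powr g = exp (g * ln (x / X * (y / Y)))" unfolding powr_def by (rule if_not_P)
      then show ?thesis by (simp only: ln_mult_pos[OF pos])
    qed
    ultimately show ?thesis by simp
  qed
  have ex: "- x - y + 2 * c * sqrt p = - X * (1 + \<rho>\<^sup>2 - 2 * c * \<rho>)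
      + (- (1 - c * \<rho>) * (x - X) - (1 - c / \<rho>) * (y - Y) - c * (sqrt (\<rho> * x) - sqrt (y / \<rho>))\<^sup>2)"
  proof -
    have prod: "sqrt (\<rho> * x) * sqrt (y / \<rho>) = sqrt p"
      using \<rho> by (simp add: p_def real_sqrt_mult[symmetric])
    have squares: "(sqrt (\<rho> * x))\<^sup>2 = \<rho> * x" "(sqrt (y / \<rho>))\<^sup>2 = y / \<rho>"
      using \<rho> xy by (auto intro!: real_sqrt_pow2)
    have "(sqrt (\<rho> * x) - sqrt (y / \<rho>))\<^sup>2 = \<rho> * x + y / \<rho> - 2 * sqrt p"
      by (simp only: power2_diff squares mult.assoc prod)
    moreover have "- x - y + 2 * c * S = - X * (1 + \<rho>\<^sup>2 - 2 * c * \<rho>)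
      + (- (1 - c * \<rho>) * (x - X) - (1 - c / \<rho>) * (y - Y) - c * (\<rho> * x + y / \<rho> - 2 * S))" for S
      unfolding Y_def using \<rho> by (simp add: power2_eq_square field_simps)
    ultimately show ?thesis by (simp only:)
  qed
  have "kibble_density a c (x, y) = (1 - c\<^sup>2) powr a / Gamma a * p powr (a - 1) * exp (- x - y) * bessel_clifford a (c\<^sup>2 * p)"
    using xy by (simp add: kibble_density_def p_def)
  also have "\<dots> = B * (p powr (a - 1) * (c * sqrt p) powr (1 / 2 - a)) * (exp (- x - y) * exp (2 * c * sqrt p)) * R"
    unfolding bc B_def by (simp add: ac_simps)
  also have "\<dots> = B * c powr (1 / 2 - a) * (\<rho> * X) powr (a - 3 / 2) * (exp (g * (ln (x / X) + ln (y / Y))) * exp (- x - y + 2 * c * sqrt p)) * R"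
    unfolding pp pg exp_add[of "- x - y"] by (simp only: ac_simps)
  also have "exp (g * (ln (x / X) + ln (y / Y))) * exp (- x - y + 2 * c * sqrt p)
     = exp (- X * (1 + \<rho>\<^sup>2 - 2 * c * \<rho>)) * exp (- (1 - c * \<rho>) * (x - X) - (1 - c / \<rho>) * (y - Y) + corner_defect a c \<rho> X x y)"
    unfolding ex exp_add[symmetric] corner_defect_def g_def Y_def by (simp add: algebra_simps)
  finally show ?thesis
    unfolding corner_mass_def B_def R_def Y_def p_def by simp
qed

text \<open>
  The logarithms are at most linear over \<open>X\<close>. In the square, \<open>\<rho> x - y / \<rho>\<close> vanishes at the corner and
  is therefore linear in the distances; dividing by \<open>sqrt (\<rho> x) + sqrt (y / \<rho>)\<close> gains the
  factor \<open>1 / X\<close>. The square enters with a minus sign, so the upper bound is linear in \<open>u\<close>; this is what keeps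
  \<open>exp\<close> of the defect under control far away from the corner.
\<close>

lemma corner_defect_bounds:
  fixes a c \<rho> X x y :: real
  assumes c: "0 < c" and \<rho>: "\<rho> > 0" and X: "X > 0" and v: "x \<ge> X" "y \<ge> \<rho>\<^sup>2 * X"
  defines "u \<equiv> (x - X) + (y - \<rho>\<^sup>2 * X)"
    and "C \<equiv> \<bar>a / 2 - 3 / 4\<bar> * (1 + 1 / \<rho>\<^sup>2) + c / \<rho> * (\<rho> + 1 / \<rho>)\<^sup>2"
  shows "\<bar>corner_defect a c \<rho> X x y\<bar> \<le> C / X * (u + u\<^sup>2)" "corner_defect a c \<rho> X x y \<le> C / X * u"
proof -
  define Y where "Y = \<rho>\<^sup>2 * X"
  define s where "s = x - X"
  define t where "t = y - Y"
  define L where "L = ln (x / X) + ln (y / Y)"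
  define q where "q = (sqrt (\<rho> * x) - sqrt (y / \<rho>))\<^sup>2"
  have Y: "Y > 0" using \<rho> X by (simp add: Y_def)
  have st: "s \<ge> 0" "t \<ge> 0" "u = s + t" using v by (auto simp: s_def t_def u_def Y_def)
  have "0 \<le> ln (x / X)" "ln (x / X) \<le> s / X"
  proof -
    have "x / X = 1 + s / X" using X by (simp add: s_def field_simps)
    then show "0 \<le> ln (x / X)" "ln (x / X) \<le> s / X"
      using ln_add_one_self_le_self[of "s / X"] st X by auto
  qed
  moreover have "0 \<le> ln (y / Y)" "ln (y / Y) \<le> t / Y"
  proof -
    have "y / Y = 1 + t / Y" using Y by (simp add: t_def field_simps)
    then show "0 \<le> ln (y / Y)" "ln (y / Y) \<le> t / Y"
      using ln_add_one_self_le_self[of "t / Y"] st Y by auto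
  qed
  ultimately have L0: "0 \<le> L" and L1: "L \<le> s / X + t / Y" by (auto simp: L_def)
  have "s / X + t / Y \<le> (1 + 1 / \<rho>\<^sup>2) / X * u"
  proof -
    have "s / X \<le> u / X" "t / Y \<le> u / Y" using st X Y by (auto intro!: divide_right_mono)
    moreover have "u / X + u / Y = (1 + 1 / \<rho>\<^sup>2) / X * u" using \<rho> X by (simp add: Y_def field_simps)
    ultimately show ?thesis by linarith
  qed
  with L1 have L2: "L \<le> (1 + 1 / \<rho>\<^sup>2) / X * u" by simp
  have gL: "\<bar>a / 2 - 3 / 4\<bar> * L \<le> \<bar>a / 2 - 3 / 4\<bar> * (1 + 1 / \<rho>\<^sup>2) / X * u"
    using mult_left_mono[OF L2, of "\<bar>a / 2 - 3 / 4\<bar>"] by (simp add: mult.assoc)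
  have q0: "q \<ge> 0" by (simp add: q_def)
  have q1: "q \<le> (\<rho> + 1 / \<rho>)\<^sup>2 * u\<^sup>2 / (\<rho> * X)"
  proof -
    have xy: "x > 0" "y > 0" using v X Y by (auto simp: Y_def)
    define A where "A = sqrt (\<rho> * x) + sqrt (y / \<rho>)"
    have "\<rho> * X \<le> A\<^sup>2"
    proof -
      have "\<rho> * X \<le> \<rho> * x" using v \<rho> by simp
      also have "\<dots> = (sqrt (\<rho> * x))\<^sup>2" using \<rho> xy by simp
      also have "\<dots> \<le> A\<^sup>2" unfolding A_def using \<rho> xy by (intro power_mono) auto
      finally show ?thesis .
    qed
    then have "q * (\<rho> * X) \<le> q * A\<^sup>2" using q0 by (rule mult_left_mono)
    also have "q * A\<^sup>2 = ((sqrt (\<rho> * x) - sqrt (y / \<rho>)) * (sqrt (\<rho> * x) + sqrt (y / \<rho>)))\<^sup>2"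
      by (simp add: q_def A_def power_mult_distrib)
    also have "(sqrt (\<rho> * x) - sqrt (y / \<rho>)) * (sqrt (\<rho> * x) + sqrt (y / \<rho>)) = \<rho> * x - y / \<rho>"
      using \<rho> xy by (simp add: algebra_simps flip: power2_eq_square)
    also have "\<rho> * x - y / \<rho> = \<rho> * s - t / \<rho>"
      using \<rho> by (simp add: s_def t_def Y_def power2_eq_square field_simps)
    also have "(\<rho> * s - t / \<rho>)\<^sup>2 \<le> ((\<rho> + 1 / \<rho>) * u)\<^sup>2"
    proof (rule power2_le_iff_abs_le[THEN iffD2])
      show "0 \<le> (\<rho> + 1 / \<rho>) * u" using \<rho> st by simp
      have "0 \<le> \<rho> * s" "0 \<le> t / \<rho>" "0 \<le> \<rho> * t" "0 \<le> s / \<rho>" using \<rho> st by auto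
      moreover have "(\<rho> + 1 / \<rho>) * u = \<rho> * s + t / \<rho> + \<rho> * t + s / \<rho>" by (simp add: st(3) algebra_simps add_divide_distrib)
      ultimately show "\<bar>\<rho> * s - t / \<rho>\<bar> \<le> (\<rho> + 1 / \<rho>) * u" by linarith
    qed
    finally have "q * (\<rho> * X) \<le> ((\<rho> + 1 / \<rho>) * u)\<^sup>2" .
    then show ?thesis using \<rho> X by (simp add: pos_le_divide_eq power_mult_distrib)
  qed
  have cq: "c * q \<le> c / \<rho> * (\<rho> + 1 / \<rho>)\<^sup>2 / X * u\<^sup>2"
    using mult_left_mono[OF q1, of c] c \<rho> X by (simp add: field_simps)
  have d: "corner_defect a c \<rho> X x y = (a / 2 - 3 / 4) * L - c * q"
    by (simp add: corner_defect_def L_def q_def Y_def)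
  have gabs: "\<bar>(a / 2 - 3 / 4) * L\<bar> = \<bar>a / 2 - 3 / 4\<bar> * L" using L0 by (simp add: abs_mult)
  have cq0: "0 \<le> c * q" using c q0 by simp
  define C1 where "C1 = \<bar>a / 2 - 3 / 4\<bar> * (1 + 1 / \<rho>\<^sup>2)"
  define C2 where "C2 = c / \<rho> * (\<rho> + 1 / \<rho>)\<^sup>2"
  have C12: "C1 \<ge> 0" "C2 \<ge> 0" "C = C1 + C2" using c \<rho> by (auto simp: C1_def C2_def C_def)
  have u: "u \<ge> 0" using st by simp
  have "0 \<le> C2 / X * u" "0 \<le> C1 / X * u\<^sup>2" using C12 u X by auto
  moreover have "C / X * (u + u\<^sup>2) = C1 / X * u + C1 / X * u\<^sup>2 + C2 / X * u + C2 / X * u\<^sup>2"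
    "C / X * u = C1 / X * u + C2 / X * u" unfolding C12(3) by (simp_all add: algebra_simps add_divide_distrib)
  moreover define W where "W = (a / 2 - 3 / 4) * L"
  moreover have "\<bar>W\<bar> \<le> C1 / X * u" using gL gabs unfolding W_def C1_def by simp
  moreover have "c * q \<le> C2 / X * u\<^sup>2" using cq unfolding C2_def .
  ultimately have "\<bar>W - c * q\<bar> \<le> C / X * (u + u\<^sup>2)" and "W - c * q \<le> C / X * u"
    using cq0 by linarith+
  then show "\<bar>corner_defect a c \<rho> X x y\<bar> \<le> C / X * (u + u\<^sup>2)" "corner_defect a c \<rho> X x y \<le> C / X * u"
    unfolding d W_def by blast+
qed

text \<open>
  Once \<open>X\<close> is large, the defect is dominated by the decay of the tangent exponential, so the
  comparison holds uniformly over the whole quadrant and costs only part of the decay rate.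
\<close>

lemma kibble_corner_pointwise:
  assumes a: "a > 1 / 2" and c: "0 < c" "c < 1" and \<rho>: "c < \<rho>" "\<rho> < 1 / c"
  shows "\<exists>K\<ge>0. \<exists>k>0. \<forall>\<^sub>F X in at_top. \<forall>x y. x > X \<longrightarrow> y > \<rho>\<^sup>2 * X \<longrightarrow>
    \<bar>kibble_density a c (x, y) - corner_mass a c \<rho> X * exp (- (1 - c * \<rho>) * (x - X) - (1 - c / \<rho>) * (y - \<rho>\<^sup>2 * X))\<bar>
    \<le> corner_mass a c \<rho> X * (K / X * exp (- k * (x - X) - k * (y - \<rho>\<^sup>2 * X)))"
proof -
  define l where "l = 1 - c * \<rho>"
  define m where "m = 1 - c / \<rho>"
  have \<rho>0: "\<rho> > 0" using c \<rho> by simp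
  have lm: "l > 0" "m > 0" using c \<rho> \<rho>0 by (auto simp: l_def m_def field_simps)
  \<comment> \<open>Half of the smaller decay rate; the other half pays for the defect.\<close>
  define k where "k = min l m / 2"
  have k: "k > 0" "2 * k \<le> l" "2 * k \<le> m" using lm by (auto simp: k_def)
  define C where "C = \<bar>a / 2 - 3 / 4\<bar> * (1 + 1 / \<rho>\<^sup>2) + c / \<rho> * (\<rho> + 1 / \<rho>)\<^sup>2"
  have C0: "C \<ge> 0" unfolding C_def using c \<rho>0 by (intro add_nonneg_nonneg mult_nonneg_nonneg) auto
  obtain K1 where K1: "\<forall>\<^sub>F y in at_top. \<bar>bessel_ratio a y - 1\<bar> \<le> K1 / y"
    using bessel_ratio_asymptotics[OF a] by blast
  then obtain y0 where y0: "\<And>y. y \<ge> y0 \<Longrightarrow> \<bar>bessel_ratio a y - 1\<bar> \<le> K1 / y"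
    by (auto simp: eventually_at_top_linorder)
  define K2 where "K2 = max K1 0 / (c * \<rho>)"
  have K2: "K2 \<ge> 0" using c \<rho>0 by (simp add: K2_def)
  define D where "D = 1 / (k / 2) + 2 / (k / 2)\<^sup>2"
  have D: "D \<ge> 0" using k by (simp add: D_def)
  define K where "K = C * D * (1 + K2) + K2"
  have K0: "K \<ge> 0" using C0 D K2 by (simp add: K_def)
  have "\<forall>\<^sub>F X in at_top. \<forall>x y. x > X \<longrightarrow> y > \<rho>\<^sup>2 * X \<longrightarrow>
    \<bar>kibble_density a c (x, y) - corner_mass a c \<rho> X * exp (- l * (x - X) - m * (y - \<rho>\<^sup>2 * X))\<bar>
    \<le> corner_mass a c \<rho> X * (K / X * exp (- k * (x - X) - k * (y - \<rho>\<^sup>2 * X)))"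
    using eventually_ge_at_top[of 1] eventually_ge_at_top[of "y0 / (c * \<rho>)"] eventually_ge_at_top[of "2 * C / k"]
  proof eventually_elim
    case (elim X)
    show ?case
    proof (intro allI impI)
      fix x y assume v: "x > X" "y > \<rho>\<^sup>2 * X"
      define u where "u = (x - X) + (y - \<rho>\<^sup>2 * X)"
      define E where "E = corner_defect a c \<rho> X x y"
      define R where "R = bessel_ratio a (c * sqrt (x * y))"
      define e where "e = exp (- l * (x - X) - m * (y - \<rho>\<^sup>2 * X))"
      have X: "X > 0" "X \<ge> 1" using elim by auto
      have u: "u \<ge> 0" using v by (simp add: u_def)
      have Eb: "\<bar>E\<bar> \<le> C / X * (u + u\<^sup>2)" "E \<le> C / X * u"
        using corner_defect_bounds[OF c(1) \<rho>0 X(1) less_imp_le[OF v(1)] less_imp_le[OF v(2)], of a]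
        unfolding E_def C_def u_def by auto
      have "C / X \<le> k / 2" using elim(3) X k by (simp add: field_simps)
      then have "C / X * u \<le> k / 2 * u" using u by (rule mult_right_mono)
      moreover have "0 \<le> k / 2 * u" using u k by simp
      ultimately have Emax: "max E 0 \<le> k / 2 * u" using Eb(2) by (intro max.boundedI) linarith+
      have expE: "\<bar>exp E - 1\<bar> \<le> C * D / X * exp (k * u)"
      proof -
        have "\<bar>exp E - 1\<bar> \<le> \<bar>E\<bar> * exp (max E 0)" by (rule abs_exp_minus_one_le)
        also have "\<dots> \<le> (C / X * (u + u\<^sup>2)) * exp (k / 2 * u)"
          using Eb(1) Emax C0 X u by (intro mult_mono) auto
        also have "\<dots> \<le> (C / X * (D * exp (k / 2 * u))) * exp (k / 2 * u)"
          unfolding D_def using linear_quadratic_le_exp[of "k / 2" u] k u C0 X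
          by (intro mult_right_mono mult_left_mono) auto
        also have "\<dots> = C * D / X * (exp (k / 2 * u) * exp (k / 2 * u))" by simp
        also have "exp (k / 2 * u) * exp (k / 2 * u) = exp (k * u)" by (simp add: exp_add[symmetric])
        finally show ?thesis .
      qed
      have Rb: "\<bar>R - 1\<bar> \<le> K2 / X"
      proof -
        have "\<rho> * X = sqrt (X * (\<rho>\<^sup>2 * X))" using \<rho>0 X by (simp add: real_sqrt_mult power2_eq_square)
        also have "\<dots> \<le> sqrt (x * y)" using v X \<rho>0 by (intro real_sqrt_le_mono mult_mono) auto
        finally have z: "c * \<rho> * X \<le> c * sqrt (x * y)" using c by simp
        have zpos': "0 < c * \<rho> * X" using c \<rho>0 X by simp
        from this z have zpos: "0 < c * sqrt (x * y)" by (rule less_le_trans)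
        have "y0 \<le> c * \<rho> * X" using elim(2) c \<rho>0 by (simp add: field_simps)
        with z have "\<bar>R - 1\<bar> \<le> K1 / (c * sqrt (x * y))" unfolding R_def by (intro y0) simp
        also have "\<dots> \<le> max K1 0 / (c * sqrt (x * y))" using less_imp_le[OF zpos] by (intro divide_right_mono) auto
        also have "\<dots> \<le> max K1 0 / (c * \<rho> * X)" by (intro divide_left_mono[OF z] mult_pos_pos zpos zpos') simp
        finally show ?thesis by (simp add: K2_def)
      qed
      have R1: "\<bar>R\<bar> \<le> 1 + K2"
      proof -
        have "K2 / X \<le> K2 / 1" using K2 X by (intro divide_left_mono) auto
        then show ?thesis using Rb by linarith
      qed
      have M0: "corner_mass a c \<rho> X \<ge> 0"
        unfolding corner_mass_def using a by (auto intro!: mult_nonneg_nonneg divide_nonneg_nonneg Gamma_real_nonneg)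
      have e_le: "e * exp (k * u) \<le> exp (- k * u)"
      proof -
        have "2 * k * (x - X) \<le> l * (x - X)" "2 * k * (y - \<rho>\<^sup>2 * X) \<le> m * (y - \<rho>\<^sup>2 * X)"
          using k v by (auto intro!: mult_right_mono)
        then show ?thesis unfolding e_def u_def exp_add[symmetric] by (simp add: algebra_simps)
      qed
      have e0: "e > 0" by (simp add: e_def)
      have "kibble_density a c (x, y) = corner_mass a c \<rho> X * (exp (- l * (x - X) - m * (y - \<rho>\<^sup>2 * X) + E) * R)"
        unfolding l_def m_def E_def R_def using a c \<rho>0 X v by (intro kibble_density_corner) auto
      also have "exp (- l * (x - X) - m * (y - \<rho>\<^sup>2 * X) + E) = e * exp E" by (simp add: e_def exp_add)
      finally have "kibble_density a c (x, y) - corner_mass a c \<rho> X * e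
          = corner_mass a c \<rho> X * (e * ((exp E - 1) * R + (R - 1)))" by (simp add: algebra_simps)
      then have "\<bar>kibble_density a c (x, y) - corner_mass a c \<rho> X * e\<bar>
          = corner_mass a c \<rho> X * (e * \<bar>(exp E - 1) * R + (R - 1)\<bar>)" using M0 e0 by (simp add: abs_mult)
      also have "\<dots> \<le> corner_mass a c \<rho> X * (K / X * exp (- k * u))"
      proof (rule mult_left_mono[OF _ M0])
        have "\<bar>(exp E - 1) * R + (R - 1)\<bar> \<le> \<bar>exp E - 1\<bar> * \<bar>R\<bar> + \<bar>R - 1\<bar>"
          by (metis abs_mult abs_triangle_ineq)
        also have "\<dots> \<le> (C * D / X * exp (k * u)) * (1 + K2) + K2 / X * exp (k * u)"
        proof (rule add_mono)
          show "\<bar>exp E - 1\<bar> * \<bar>R\<bar> \<le> (C * D / X * exp (k * u)) * (1 + K2)"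
            using expE R1 C0 D X by (intro mult_mono) auto
          have "K2 / X * 1 \<le> K2 / X * exp (k * u)" using K2 X k u by (intro mult_left_mono) auto
          then show "\<bar>R - 1\<bar> \<le> K2 / X * exp (k * u)" using Rb by simp
        qed
        also have "\<dots> = K / X * exp (k * u)" using X by (simp add: K_def field_simps)
        finally have "e * \<bar>(exp E - 1) * R + (R - 1)\<bar> \<le> e * (K / X * exp (k * u))"
          using e0 by (intro mult_left_mono) auto
        also have "\<dots> = K / X * (e * exp (k * u))" by simp
        also have "\<dots> \<le> K / X * exp (- k * u)" using e_le K0 X by (intro mult_left_mono) auto
        finally show "e * \<bar>(exp E - 1) * R + (R - 1)\<bar> \<le> K / X * exp (- k * u)" .
      qed
      also have "- k * u = - k * (x - X) - k * (y - \<rho>\<^sup>2 * X)" by (simp add: u_def algebra_simps)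
      finally show "\<bar>kibble_density a c (x, y) - corner_mass a c \<rho> X * exp (- l * (x - X) - m * (y - \<rho>\<^sup>2 * X))\<bar>
        \<le> corner_mass a c \<rho> X * (K / X * exp (- k * (x - X) - k * (y - \<rho>\<^sup>2 * X)))"
        unfolding e_def .
    qed
  qed
  then show ?thesis using K0 k(1) unfolding l_def m_def by blast
qed

text \<open>
  Two-sided comparison of integrals for nonnegative functions; finiteness of the integral of \<open>f\<close> comes
  out of the comparison.
\<close>

lemma nn_integral_close:
  assumes [measurable]: "f \<in> borel_measurable M" "g \<in> borel_measurable M" "h \<in> borel_measurable M"
    and nonneg: "\<And>x. 0 \<le> f x" "\<And>x. 0 \<le> g x" "\<And>x. 0 \<le> h x"
    and close: "\<And>x. \<bar>f x - g x\<bar> \<le> (h x :: real)"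
    and G: "(\<integral>\<^sup>+ x. ennreal (g x) \<partial>M) = ennreal G" "G \<ge> 0"
    and H: "(\<integral>\<^sup>+ x. ennreal (h x) \<partial>M) = ennreal H" "H \<ge> 0"
  shows "\<bar>enn2real (\<integral>\<^sup>+ x. ennreal (f x) \<partial>M) - G\<bar> \<le> H"
proof -
  have "(\<integral>\<^sup>+ x. ennreal (f x) \<partial>M) \<le> (\<integral>\<^sup>+ x. ennreal (g x) + ennreal (h x) \<partial>M)"
  proof (rule nn_integral_mono)
    fix x
    have "f x \<le> g x + h x" using close[of x] by linarith
    then show "ennreal (f x) \<le> ennreal (g x) + ennreal (h x)"
      using nonneg by (simp add: ennreal_plus[symmetric] ennreal_leI del: ennreal_plus)
  qed
  also have "\<dots> = ennreal (G + H)" using G H by (simp add: nn_integral_add)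
  finally have u: "(\<integral>\<^sup>+ x. ennreal (f x) \<partial>M) \<le> ennreal (G + H)" .
  then obtain F where F: "(\<integral>\<^sup>+ x. ennreal (f x) \<partial>M) = ennreal F" "F \<ge> 0"
    by (metis ennreal_cases ennreal_less_top neq_top_trans less_irrefl top.not_eq_extremum order_le_less_trans)
  have "F \<le> G + H" using u G H unfolding F(1) by (subst (asm) ennreal_le_iff) auto
  moreover have "G \<le> F + H"
  proof -
    have "(\<integral>\<^sup>+ x. ennreal (g x) \<partial>M) \<le> (\<integral>\<^sup>+ x. ennreal (f x) + ennreal (h x) \<partial>M)"
    proof (rule nn_integral_mono)
      fix x
      have "g x \<le> f x + h x" using close[of x] by linarith
      then show "ennreal (g x) \<le> ennreal (f x) + ennreal (h x)"
        using nonneg by (simp add: ennreal_plus[symmetric] ennreal_leI del: ennreal_plus)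
    qed
    also have "\<dots> = ennreal (F + H)" using F H by (simp add: nn_integral_add)
    finally show ?thesis using F H unfolding G(1) by (subst (asm) ennreal_le_iff) auto
  qed
  ultimately show ?thesis using F by (simp add: abs_le_iff)
qed

lemma kibble_corner_asymptotics:
  assumes a: "a > 1 / 2" and c: "0 < c" "c < 1" and \<rho>: "c < \<rho>" "\<rho> < 1 / c"
  shows "\<exists>K. \<forall>\<^sub>F X in at_top.
    \<bar>measure (kibble a c) {v. \<bar>fst v\<bar> > X \<and> \<bar>snd v\<bar> > \<rho>\<^sup>2 * X} - corner_mass a c \<rho> X / ((1 - c * \<rho>) * (1 - c / \<rho>))\<bar>
      \<le> corner_mass a c \<rho> X * (K / X)"
proof -
  define l where "l = 1 - c * \<rho>"
  define m where "m = 1 - c / \<rho>"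
  have \<rho>0: "\<rho> > 0" using c \<rho> by simp
  have lm: "l > 0" "m > 0" using c \<rho> \<rho>0 by (auto simp: l_def m_def field_simps)
  obtain K k where K: "K \<ge> 0" and k: "k > 0" and
    ev: "\<forall>\<^sub>F X in at_top. \<forall>x y. x > X \<longrightarrow> y > \<rho>\<^sup>2 * X \<longrightarrow>
    \<bar>kibble_density a c (x, y) - corner_mass a c \<rho> X * exp (- l * (x - X) - m * (y - \<rho>\<^sup>2 * X))\<bar>
    \<le> corner_mass a c \<rho> X * (K / X * exp (- k * (x - X) - k * (y - \<rho>\<^sup>2 * X)))"
    using kibble_corner_pointwise[OF assms] unfolding l_def m_def by blast
  have "\<forall>\<^sub>F X in at_top.
    \<bar>measure (kibble a c) {v. \<bar>fst v\<bar> > X \<and> \<bar>snd v\<bar> > \<rho>\<^sup>2 * X} - corner_mass a c \<rho> X / (l * m)\<bar>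
      \<le> corner_mass a c \<rho> X * ((K / (k * k)) / X)"
    using ev eventually_gt_at_top[of 0]
  proof eventually_elim
    case (elim X)
    define Y where "Y = \<rho>\<^sup>2 * X"
    define M where "M = corner_mass a c \<rho> X"
    define S where "S = {X<..} \<times> {Y<..}"
    have X: "X > 0" and Y: "Y > 0" using elim \<rho>0 by (auto simp: Y_def)
    have M0: "M \<ge> 0"
      unfolding M_def corner_mass_def using a by (auto intro!: mult_nonneg_nonneg divide_nonneg_nonneg Gamma_real_nonneg)
    have S[measurable]: "S \<in> sets plane" unfolding S_def by measurable
    have "emeasure (kibble a c) {v. \<bar>fst v\<bar> > X \<and> \<bar>snd v\<bar> > Y}
        = (\<integral>\<^sup>+ v. ennreal (kibble_density a c v) * indicator {v. \<bar>fst v\<bar> > X \<and> \<bar>snd v\<bar> > Y} v \<partial>plane)"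
      unfolding kibble_def
    proof (rule emeasure_density)
      have "{v \<in> space plane. \<bar>fst v\<bar> > X \<and> \<bar>snd v\<bar> > Y} \<in> sets plane"
        by measurable
      then show "{v. \<bar>fst v\<bar> > X \<and> \<bar>snd v\<bar> > Y} \<in> sets plane"
        by (simp add: space_pair_measure)
    qed measurable
    also have "\<dots> = (\<integral>\<^sup>+ v. ennreal (indicator S v * kibble_density a c v) \<partial>plane)"
      by (intro nn_integral_cong) (auto simp: S_def kibble_density_def indicator_def)
    finally have em: "measure (kibble a c) {v. \<bar>fst v\<bar> > X \<and> \<bar>snd v\<bar> > Y}
        = enn2real (\<integral>\<^sup>+ v. ennreal (indicator S v * kibble_density a c v) \<partial>plane)"
      by (simp add: measure_def)
    have I: "(\<integral>\<^sup>+ v. ennreal (q * (indicator S v * exp (- r * (fst v - X) - t * (snd v - Y)))) \<partial>plane) = ennreal (q * (1 / (r * t)))"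
      if "q \<ge> 0" "r > 0" "t > 0" for q r t
    proof -
      have "(\<integral>\<^sup>+ v. ennreal (q * (indicator S v * exp (- r * (fst v - X) - t * (snd v - Y)))) \<partial>plane)
        = (\<integral>\<^sup>+ v. ennreal q * ennreal (indicator S v * exp (- r * (fst v - X) - t * (snd v - Y))) \<partial>plane)"
        using that by (simp add: ennreal_mult')
      also have "\<dots> = ennreal q * ennreal (1 / (r * t))"
        unfolding nn_integral_corner_exp[OF that(2,3), of X Y, folded S_def, symmetric] by (rule nn_integral_cmult) measurable
      also have "\<dots> = ennreal (q * (1 / (r * t)))" by (rule ennreal_mult'[OF that(1), symmetric])
      finally show ?thesis .
    qed
    have "\<bar>enn2real (\<integral>\<^sup>+ v. ennreal (indicator S v * kibble_density a c v) \<partial>plane) - M * (1 / (l * m))\<bar>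
      \<le> M * (K / X) * (1 / (k * k))"
    proof (rule nn_integral_close)
      show "(\<integral>\<^sup>+ v. ennreal (M * (indicator S v * exp (- l * (fst v - X) - m * (snd v - Y)))) \<partial>plane) = ennreal (M * (1 / (l * m)))"
        using M0 lm by (rule I)
      show "(\<integral>\<^sup>+ v. ennreal (M * (K / X) * (indicator S v * exp (- k * (fst v - X) - k * (snd v - Y)))) \<partial>plane) = ennreal (M * (K / X) * (1 / (k * k)))"
        using M0 K X k by (intro I) auto
      show "0 \<le> M * (1 / (l * m))" "0 \<le> M * (K / X) * (1 / (k * k))" using M0 lm K X k by auto
      show "0 \<le> indicator S v * kibble_density a c v" for v
        using kibble_density_nonneg[of a c v] a by (auto simp: indicator_def)
      show "0 \<le> M * (indicator S v * exp (- l * (fst v - X) - m * (snd v - Y)))"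
        "0 \<le> M * (K / X) * (indicator S v * exp (- k * (fst v - X) - k * (snd v - Y)))" for v
        using M0 K X by (auto simp: indicator_def)
      show "\<bar>indicator S v * kibble_density a c v - M * (indicator S v * exp (- l * (fst v - X) - m * (snd v - Y)))\<bar>
        \<le> M * (K / X) * (indicator S v * exp (- k * (fst v - X) - k * (snd v - Y)))" for v
      proof (cases "v \<in> S")
        case True
        then have "fst v > X" "snd v > \<rho>\<^sup>2 * X" by (auto simp: S_def Y_def)
        from elim(1)[rule_format, OF this] show ?thesis
          using True unfolding M_def Y_def by (simp add: mult.assoc)
      qed simp
    qed measurable
    then show ?case unfolding em[unfolded Y_def, symmetric] M_def by (simp add: field_simps)
  qed
  then show ?thesis unfolding l_def m_def by blast
qed

section \<open>Asymptotics of the limit probability\<close>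

text \<open>
  Pure bookkeeping of the constants: with \<open>n = N / 2\<close> both sides are compared after taking the
  logarithm of each power.
\<close>

lemma corner_mass_explicit:
  fixes N :: nat and c \<rho> x :: real
  assumes c: "0 < c" "c < 1" and \<rho>: "c < \<rho>" "\<rho> < 1 / c" and x: "x > 0"
  shows "corner_mass ((real N - 1) / 2) c \<rho> (x / (2 * (1 - c\<^sup>2))) / ((1 - c * \<rho>) * (1 - c / \<rho>))
    = x powr (real N / 2 - 2) * (\<rho> / (2 * c)) powr (real N / 2 - 1) * (1 - c\<^sup>2) powr (3 / 2)
      * exp (- (x / (2 * (1 - c\<^sup>2))) * (\<rho>\<^sup>2 - 2 * c * \<rho> + 1))
      / (sqrt pi * Gamma ((real N - 1) / 2) * (\<rho> - c) * (1 - c * \<rho>))"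
proof -
  define n where "n = real N / 2"
  define \<beta> where "\<beta> = 1 - c\<^sup>2"
  define G where "G = Gamma ((real N - 1) / 2)"
  define e where "e = exp (- (x / (2 * \<beta>)) * (\<rho>\<^sup>2 - 2 * c * \<rho> + 1))"
  have \<beta>: "\<beta> > 0" using c by (simp add: \<beta>_def power_less_one_iff abs_square_less_1)
  have \<rho>0: "\<rho> > 0" using c \<rho> by simp
  have pos: "1 - c * \<rho> > 0" "\<rho> - c > 0" using c \<rho> by (auto simp: field_simps)
  have key: "\<beta> powr (n - 1 / 2) * c powr (1 - n) * (\<rho> * (x / (2 * \<beta>))) powr (n - 2) * \<rho>
      = 2 * (x powr (n - 2) * (\<rho> / (2 * c)) powr (n - 1) * \<beta> powr (3 / 2))"
  proof -
    have "(\<rho> * (x / (2 * \<beta>))) powr (n - 2) = exp ((n - 2) * (ln \<rho> + ln x - (ln 2 + ln \<beta>)))"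
      using \<rho>0 x \<beta> by (simp add: powr_def ln_mult_pos ln_div)
    moreover have "(\<rho> / (2 * c)) powr (n - 1) = exp ((n - 1) * (ln \<rho> - (ln 2 + ln c)))"
      using \<rho>0 c by (simp add: powr_def ln_mult_pos ln_div)
    moreover have "\<beta> powr r = exp (r * ln \<beta>)" "c powr r = exp (r * ln c)" "x powr r = exp (r * ln x)" for r
      using \<beta> c x by (simp_all add: powr_def)
    moreover have "\<rho> = exp (ln \<rho>)" "(2 :: real) = exp (ln 2)" using \<rho>0 by simp_all
    ultimately have "\<beta> powr (n - 1 / 2) * c powr (1 - n) * (\<rho> * (x / (2 * \<beta>))) powr (n - 2) * \<rho>
        = exp ((n - 1 / 2) * ln \<beta> + (1 - n) * ln c + (n - 2) * (ln \<rho> + ln x - (ln 2 + ln \<beta>)) + ln \<rho>)"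
      "2 * (x powr (n - 2) * (\<rho> / (2 * c)) powr (n - 1) * \<beta> powr (3 / 2))
        = exp (ln 2 + ((n - 2) * ln x + (n - 1) * (ln \<rho> - (ln 2 + ln c)) + 3 / 2 * ln \<beta>))"
      unfolding exp_add by metis+
    moreover have "(n - 1 / 2) * ln \<beta> + (1 - n) * ln c + (n - 2) * (ln \<rho> + ln x - (ln 2 + ln \<beta>)) + ln \<rho>
       = ln 2 + ((n - 2) * ln x + (n - 1) * (ln \<rho> - (ln 2 + ln c)) + 3 / 2 * ln \<beta>)"
      by (simp add: algebra_simps)
    ultimately show ?thesis by simp
  qed
  have "corner_mass ((real N - 1) / 2) c \<rho> (x / (2 * \<beta>)) / ((1 - c * \<rho>) * (1 - c / \<rho>))
     = (\<beta> powr (n - 1 / 2) * c powr (1 - n) * (\<rho> * (x / (2 * \<beta>))) powr (n - 2) * \<rho>) * e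
       / (2 * sqrt pi * G * (\<rho> - c) * (1 - c * \<rho>))"
  proof -
    have ex: "(real N - 1) / 2 = n - 1 / 2" "1 / 2 - (real N - 1) / 2 = 1 - n" "(real N - 1) / 2 - 3 / 2 = n - 2"
      by (simp_all add: n_def field_simps)
    have e': "exp (- (x / (2 * \<beta>)) * (1 + \<rho>\<^sup>2 - 2 * c * \<rho>)) = e" by (simp add: e_def algebra_simps)
    have d: "(1 - c * \<rho>) * (1 - c / \<rho>) = (\<rho> - c) * (1 - c * \<rho>) / \<rho>" using \<rho>0 by (simp add: field_simps)
    show ?thesis
      unfolding corner_mass_def e' d ex(2,3) G_def[symmetric] \<beta>_def[symmetric] unfolding ex(1)
      using \<rho>0 by (simp add: field_simps)
  qed
  also have "\<dots> = x powr (n - 2) * (\<rho> / (2 * c)) powr (n - 1) * \<beta> powr (3 / 2) * e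
       / (sqrt pi * G * (\<rho> - c) * (1 - c * \<rho>))"
    unfolding key by simp
  finally show ?thesis unfolding n_def \<beta>_def e_def G_def .
qed

theorem theorem2:
  fixes M :: "'a measure" and N :: nat and p :: "nat \<Rightarrow> real" and T :: "nat \<Rightarrow> 'a \<Rightarrow> nat"
    and c \<rho> :: real
  assumes "N \<ge> 3"
    and "\<And>j. j \<in> {1..N} \<Longrightarrow> p j > 0" and "(\<Sum>j=1..N. p j) = 1"
    and "independent_trials M N p T"
    and "0 < c" and "c < 1"
    and "c < \<rho>" and "\<rho> < 1 / c"
  shows "\<exists>\<epsilon> \<in> O[at_top](\<lambda>x1. ln x1 / x1).
           \<forall>\<^sub>F x1 in at_top. \<forall>x2 > 0. sqrt (x2 / x1) = \<rho> \<longrightarrow>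
             alpha M N p T c x1 x2 =
               x1 powr (real N / 2 - 2) * (\<rho> / (2 * c)) powr (real N / 2 - 1)
               * (1 - c\<^sup>2) powr (3 / 2)
               * exp (- (x1 / (2 * (1 - c\<^sup>2))) * (\<rho>\<^sup>2 - 2 * c * \<rho> + 1))
               / (sqrt pi * Gamma ((real N - 1) / 2) * (\<rho> - c) * (1 - c * \<rho>))
               * (1 + \<epsilon> x1)"
proof -
  define a where "a = (real N - 1) / 2"
  define \<beta> where "\<beta> = 1 - c\<^sup>2"
  define q where "q = (1 - c * \<rho>) * (1 - c / \<rho>)"
  define main where "main x = x powr (real N / 2 - 2) * (\<rho> / (2 * c)) powr (real N / 2 - 1)
     * (1 - c\<^sup>2) powr (3 / 2) * exp (- (x / (2 * (1 - c\<^sup>2))) * (\<rho>\<^sup>2 - 2 * c * \<rho> + 1))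
     / (sqrt pi * Gamma ((real N - 1) / 2) * (\<rho> - c) * (1 - c * \<rho>))" for x
  define \<epsilon> where "\<epsilon> x = alpha M N p T c x (\<rho>\<^sup>2 * x) / main x - 1" for x
  have \<beta>: "\<beta> > 0" using assms by (simp add: \<beta>_def power_less_one_iff abs_square_less_1)
  have \<rho>0: "\<rho> > 0" using assms by simp
  have q: "q > 0" unfolding q_def using assms \<rho>0 by (intro mult_pos_pos) (auto simp: field_simps)
  have a: "a > 1 / 2" using assms(1) by (simp add: a_def)
  have mass: "main x = corner_mass a c \<rho> (x / (2 * \<beta>)) / q" if "x > 0" for x
    unfolding main_def a_def \<beta>_def q_def using assms that by (intro corner_mass_explicit[symmetric]) auto
  have mass_pos: "corner_mass a c \<rho> (x / (2 * \<beta>)) > 0" if "x > 0" for x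
  proof -
    have "Gamma a > 0" using a by (intro Gamma_real_pos) simp
    then show ?thesis
      unfolding corner_mass_def \<beta>_def[symmetric] using that \<beta> \<rho>0 assms by simp
  qed
  have tail: "alpha M N p T c x (\<rho>\<^sup>2 * x)
      = measure (kibble a c) {v. \<bar>fst v\<bar> > x / (2 * \<beta>) \<and> \<bar>snd v\<bar> > \<rho>\<^sup>2 * (x / (2 * \<beta>))}" for x
    unfolding a_def \<beta>_def using assms by (subst alpha_eq_kibble_tail[where p=p]) auto
  obtain K where K: "\<forall>\<^sub>F X in at_top.
      \<bar>measure (kibble a c) {v. \<bar>fst v\<bar> > X \<and> \<bar>snd v\<bar> > \<rho>\<^sup>2 * X} - corner_mass a c \<rho> X / q\<bar>
        \<le> corner_mass a c \<rho> X * (K / X)"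
    using kibble_corner_asymptotics[OF a assms(5-8)] unfolding q_def by blast
  have "filterlim (\<lambda>x. x / (2 * \<beta>)) at_top at_top" using \<beta> by real_asymp
  from eventually_compose_filterlim[OF K this]
  have "\<forall>\<^sub>F x in at_top. norm (\<epsilon> x) \<le> (q * \<bar>K\<bar> * (2 * \<beta>)) * norm (ln x / x)"
    using eventually_ge_at_top[of "exp 1"]
  proof eventually_elim
    case (elim x)
    define m where "m = corner_mass a c \<rho> (x / (2 * \<beta>))"
    have x: "x > 0" using elim(2) exp_gt_zero[of 1] by linarith
    have lnx: "ln x \<ge> 1" using elim(2) x by (simp add: ln_ge_iff)
    have m: "m > 0" unfolding m_def using x by (rule mass_pos)
    have main: "main x = m / q" unfolding m_def using x by (rule mass)
    have "\<bar>alpha M N p T c x (\<rho>\<^sup>2 * x) - m / q\<bar> \<le> m * (K / (x / (2 * \<beta>)))"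
      using elim(1) unfolding tail m_def .
    also have "\<dots> \<le> m * (\<bar>K\<bar> / (x / (2 * \<beta>)))"
      using m x \<beta> by (intro mult_left_mono divide_right_mono) auto
    finally have d: "\<bar>alpha M N p T c x (\<rho>\<^sup>2 * x) - m / q\<bar> \<le> m * (\<bar>K\<bar> / (x / (2 * \<beta>)))" .
    have "\<epsilon> x = (alpha M N p T c x (\<rho>\<^sup>2 * x) - m / q) * (q / m)"
      unfolding \<epsilon>_def main using m q by (simp add: field_simps)
    then have "\<bar>\<epsilon> x\<bar> = \<bar>alpha M N p T c x (\<rho>\<^sup>2 * x) - m / q\<bar> * (q / m)"
      using m q by (simp add: abs_mult)
    also have "\<dots> \<le> m * (\<bar>K\<bar> / (x / (2 * \<beta>))) * (q / m)"
      using d m q by (intro mult_right_mono) auto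
    also have "\<dots> = (q * \<bar>K\<bar> * (2 * \<beta>)) * (1 / x)" using m by simp
    also have "\<dots> \<le> (q * \<bar>K\<bar> * (2 * \<beta>)) * (ln x / x)"
      using q \<beta> x lnx by (intro mult_left_mono divide_right_mono) auto
    finally show ?case using x lnx by simp
  qed
  then have "\<epsilon> \<in> O[at_top](\<lambda>x1. ln x1 / x1)" by (rule bigoI)
  moreover have "\<forall>\<^sub>F x1 in at_top. \<forall>x2 > 0. sqrt (x2 / x1) = \<rho> \<longrightarrow> alpha M N p T c x1 x2 = main x1 * (1 + \<epsilon> x1)"
    using eventually_gt_at_top[of 0]
  proof eventually_elim
    case (elim x1)
    show ?case
    proof (intro allI impI)
      fix x2 :: real assume x2: "x2 > 0" and r: "sqrt (x2 / x1) = \<rho>"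
      have "\<rho>\<^sup>2 = x2 / x1" unfolding r[symmetric] using x2 elim by simp
      then have "x2 = \<rho>\<^sup>2 * x1" using elim by simp
      moreover have "main x1 \<noteq> 0" using mass[OF elim] mass_pos[OF elim] q by simp
      ultimately show "alpha M N p T c x1 x2 = main x1 * (1 + \<epsilon> x1)" by (simp add: \<epsilon>_def)
    qed
  qed
  ultimately show ?thesis unfolding main_def by blast
qed

end
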